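(* Let $G$ be a finite group and let $S\subseteq G$ be a subset for which there exists a subset $T\subseteq G$ such that $2\le |T|$ and $|TS|\le \min(|G|-2,\ |T|+|S|-1)$. Suppose moreover that $|S|\le |G|-4|G|^{1/2}$. Then - either $S$ is a geometric progression, i.e. there exist $g,a\in G$ such that one of the two sets $gS$, $Sg$ equals $\{1,a,a^2,\ldots,a^{|S|-1}\}$, - or there exist a non-trivial proper subgroup $H$ of $G$ and $\varepsilon\in\{1,-1\}$ such that $|HS^{\varepsilon}|\le |H|+|S|-1$.
   Context: For subsets $X,Y$ of a group, $XY=\{xy: x\in X, y\in Y\}$. $S^{1}=S$ and $S^{-1}=\{s^{-1}: s\in S\}$. *)

theory Defs
  imports Complex_Main "HOL-Algebra.Coset"
begin

definition geometric_progression :: "('a, 'b) monoid_scheme \<Rightarrow> 'a set \<Rightarrow> bool" where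
  "geometric_progression G S \<longleftrightarrow>
     (\<exists>g \<in> carrier G. \<exists>a \<in> carrier G.
        g <#\<^bsub>G\<^esub> S = {a [^]\<^bsub>G\<^esub> i | i::nat. i < card S} \<or>
        S #>\<^bsub>G\<^esub> g = {a [^]\<^bsub>G\<^esub> i | i::nat. i < card S})"

definition set_power :: "('a, 'b) monoid_scheme \<Rightarrow> 'a set \<Rightarrow> int \<Rightarrow> 'a set" where
  "set_power G S \<epsilon> = (\<lambda>s. s [^]\<^bsub>G\<^esub> \<epsilon>) ` S"

text \<open>The power is taken elementwise (it is not an iterated product set), so that
  exponents \<open>1\<close> and \<open>-1\<close> give \<open>S\<close> and the set of inverses:\<close>

lemma (in group) set_power_1: "S \<subseteq> carrier G \<Longrightarrow> set_power G S 1 = S"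
  by (force simp: set_power_def)

lemma (in group) set_power_minus_1: "S \<subseteq> carrier G \<Longrightarrow> set_power G S (- 1) = set_inv S"
  by (force simp: set_power_def SET_INV_def int_pow_neg)

end

theory Submission
  imports Defs "HOL-Algebra.Multiplicative_Group"
begin

text \<open>The proof combines Hamidoune's isoperimetric method with an edge-cut argument.

  \<^bold>\<open>Atoms.\<close> Among all sets \<open>B\<close> with at least two elements and \<open>card (B R) \<le> card G - 2\<close>, where
  \<open>R\<close> is \<open>S\<close> or its set of inverses, choose one for which \<open>card (B R) - card B\<close> is least and, among those,
  \<open>card B\<close> is least. Left translated so as to contain the identity it is a set \<open>A\<close> that meets every translate
  \<open>g A \<noteq> A\<close> in at most one element (\<open>isoperimetric_atom\<close>). The conclusion of the theorem is invariant under
  inversion, so \<open>R = S\<close> may be assumed. If \<open>A = {1, a}\<close>, then \<open>S\<close> is a progression or the subgroup generated by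
  \<open>a\<close> has a small product with \<open>S\<close> (\<open>two_element_case\<close>); if \<open>A\<close> is equal to its left stabilizer \<open>K\<close>, then \<open>A\<close> itself
  is the required subgroup. It remains to treat the case that \<open>A\<close> has at least three elements and is
  not a subgroup (locale \<open>sidon_block\<close>); then every element outside \<open>K\<close> is a quotient \<open>a b\<^sup>-\<^sup>1\<close> with
  \<open>a, b \<in> A\<close> in at most one way.

  \<^bold>\<open>Cuts.\<close> Regard the right translates \<open>A h\<close> as hyperedges on the set \<open>G\<close>, and let \<open>cut A P\<close> count the
  pairs of points of a common hyperedge that are separated by \<open>P\<close>. Uniqueness of quotients
  bounds \<open>cut A P\<close> from below in terms of \<open>card P\<close> (\<open>cut_lower\<close>), whereas the cut of \<open>P = A S\<close> is small because few
  of the incidences between \<open>P\<close> and the hyperedges belong to hyperedges that are not contained in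
  \<open>P\<close> (\<open>cut_upper\<close>). The function \<open>P \<mapsto> cut A P\<close> is submodular, symmetric under complements and invariant under right translation. Hence a smallest set of minimum cut either
  is small, or its right translates form a partition, and then one of them is a subgroup (\<open>uncrossing\<close>).
  Small sets are excluded by the lower bound, and subgroups that do not contain \<open>A\<close> have
  large cuts. So \<open>A\<close> lies in a proper subgroup as soon as \<open>A S\<close> is larger than \<open>A\<close> and omits more than \<open>card A\<close>
  elements of \<open>G\<close>, and this last condition is what the assumption \<open>card S \<le> card G - 4 (card G)\<^sup>1\<^sup>/\<^sup>2\<close> provides.

  \<^bold>\<open>Small parameters.\<close> The numerical comparison fails only if \<open>(card A, card K)\<close> is \<open>(3, 1)\<close> or \<open>(4, 2)\<close>. In the
  first case the atom argument is applied once more, to \<open>A\<close> in the place of \<open>S\<close> (\<open>three_elements\<close>). In the second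
  case \<open>A = K \<union> K y\<close> for a group \<open>K\<close> of order two, and uncrossing shows that \<open>y\<close> can be chosen of order three. Then
  the subgroup generated by \<open>y\<close> has a small product with \<open>S\<close>, or \<open>A S\<close> gives a nontrivial
  edge cut with at most three edges in the arc-transitive cubic graph whose vertices and edges are the right cosets of that
  subgroup and of \<open>K\<close>, which is again excluded by uncrossing (\<open>exceptional_case\<close>).

  \<^bold>\<open>Descent.\<close> If \<open>A\<close> lies in a proper subgroup, take a minimal such subgroup \<open>H\<close>. Applying the estimates for \<open>A\<close>
  in \<open>H\<close> to the part of \<open>S\<close> in each right coset of \<open>H\<close> and adding up gives \<open>card (H S) \<le> card H + card S - 1\<close>
  (\<open>compressing_of_proper\<close>).\<close>

section \<open>Translates and inverses of subsets of a finite group\<close>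

lemma card_le1D: "finite X \<Longrightarrow> card X \<le> 1 \<Longrightarrow> x \<in> X \<Longrightarrow> y \<in> X \<Longrightarrow> x = y"
  by (metis One_nat_def card_le_Suc0_iff_eq)

lemma card_le1I: "(\<And>x y. x \<in> X \<Longrightarrow> y \<in> X \<Longrightarrow> x = y) \<Longrightarrow> card X \<le> 1"
  by (metis One_nat_def card_le_Suc0_iff_eq card.infinite zero_le_one)

lemma nat_downset:
  fixes I :: "nat set"
  assumes "finite I" "\<And>i. Suc i \<in> I \<Longrightarrow> i \<in> I"
  shows "I = {..<card I}"
proof -
  define m where "m = (LEAST i. i \<notin> I)"
  have "\<exists>i. i \<notin> I" using assms(1) by (metis UNIV_I finite_subset infinite_UNIV_nat subsetI)
  then have m: "m \<notin> I" "\<And>i. i < m \<Longrightarrow> i \<in> I" unfolding m_def using LeastI_ex not_less_Least by metis+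
  have "i \<notin> I" if "m \<le> i" for i
    using that m(1) by (induction i rule: dec_induct) (use assms(2) in auto)
  then have "I = {..<m}" using m(2) by (auto simp: not_le[symmetric])
  then show ?thesis by simp
qed

lemma sum_of_bool_mem: "finite S \<Longrightarrow> Y \<subseteq> S \<Longrightarrow> (\<Sum>h\<in>S. of_bool (h \<in> Y)) = card Y"
  by (simp add: of_bool_def sum.If_cases Int_absorb1)

locale fin_group = group G for G (structure) +
  assumes fin: "finite (carrier G)"
begin

lemma l_coset_image: "g <# A = (\<lambda>x. g \<otimes> x) ` A"
  by (auto simp: l_coset_def)

lemma r_coset_image: "A #> g = (\<lambda>x. x \<otimes> g) ` A"
  by (auto simp: r_coset_def)

lemma set_mult_iff: "x \<in> A <#> B \<longleftrightarrow> (\<exists>a\<in>A. \<exists>b\<in>B. x = a \<otimes> b)"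
  by (auto simp: set_mult_def)

lemma finite_sub: "A \<subseteq> carrier G \<Longrightarrow> finite A"
  using fin finite_subset by blast

lemma mult_inv_left [simp]: "x \<in> carrier G \<Longrightarrow> z \<in> carrier G \<Longrightarrow> x \<otimes> (inv x \<otimes> z) = z"
  by (simp add: m_assoc[symmetric])

lemma inv_mult_left [simp]: "x \<in> carrier G \<Longrightarrow> z \<in> carrier G \<Longrightarrow> inv x \<otimes> (x \<otimes> z) = z"
  by (simp add: m_assoc[symmetric])

lemma card_l_coset: "A \<subseteq> carrier G \<Longrightarrow> g \<in> carrier G \<Longrightarrow> card (g <# A) = card A"
  unfolding l_coset_image by (intro card_image inj_onI) (metis in_mono inv_mult_left)

lemma card_r_coset: "A \<subseteq> carrier G \<Longrightarrow> g \<in> carrier G \<Longrightarrow> card (A #> g) = card A"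
  unfolding r_coset_image
  by (intro card_image inj_onI) (meson in_mono right_cancel)

lemma r_coset_mem: "A \<subseteq> carrier G \<Longrightarrow> g \<in> carrier G \<Longrightarrow> x \<in> carrier G \<Longrightarrow> x \<in> A #> g \<longleftrightarrow> x \<otimes> inv g \<in> A"
  unfolding r_coset_image
  by (smt (verit, ccfv_threshold) image_iff inv_closed inv_solve_right m_closed subsetD)

lemma l_coset_mem: "A \<subseteq> carrier G \<Longrightarrow> g \<in> carrier G \<Longrightarrow> x \<in> carrier G \<Longrightarrow> x \<in> g <# A \<longleftrightarrow> inv g \<otimes> x \<in> A"
  unfolding l_coset_image
  by (smt (verit, ccfv_threshold) image_iff inv_closed inv_solve_left m_closed subsetD)

section \<open>Cuts of translates, and uncrossing\<close>

text \<open>The number of triples \<open>(h, a, b)\<close> with \<open>a, b \<in> A\<close> such that exactly one of \<open>a h\<close> and \<open>b h\<close> lies in \<open>P\<close>: the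
  ordered pairs of points that lie on a common right translate of \<open>A\<close> and are separated by \<open>P\<close>. Each separated
  pair of positions \<open>{a, b}\<close> in a translate is thus counted twice.\<close>

definition cut :: "'a set \<Rightarrow> 'a set \<Rightarrow> nat" where
  "cut A P = (\<Sum>h\<in>carrier G. \<Sum>a\<in>A. \<Sum>b\<in>A. of_bool ((a \<otimes> h \<in> P) \<noteq> (b \<otimes> h \<in> P)))"

lemma cut_compl:
  assumes "A \<subseteq> carrier G"
  shows "cut A (carrier G - P) = cut A P"
  unfolding cut_def using assms by (intro sum.cong refl) (auto simp: of_bool_def subset_iff)

text \<open>Submodularity; the next lemma is the form that submodularity takes for a function that is symmetric under
  complements.\<close>

lemma cut_Int_Un: "cut A (X \<inter> Y) + cut A (X \<union> Y) \<le> cut A X + cut A Y"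
  unfolding cut_def sum.distrib[symmetric]
  by (intro sum_mono) (auto simp: of_bool_def)

lemma cut_Diff: "cut A (X - Y) + cut A (Y - X) \<le> cut A X + cut A Y"
  unfolding cut_def sum.distrib[symmetric]
  by (intro sum_mono) (auto simp: of_bool_def)

lemma bij_right: "g \<in> carrier G \<Longrightarrow> bij_betw (\<lambda>h. h \<otimes> g) (carrier G) (carrier G)"
  by (rule bij_betwI[where g = "\<lambda>h. h \<otimes> inv g"]) (auto simp: m_assoc)

lemma cut_r_coset:
  assumes "A \<subseteq> carrier G" "P \<subseteq> carrier G" "g \<in> carrier G"
  shows "cut A (P #> g) = cut A P"
proof -
  have "cut A (P #> g) = (\<Sum>h\<in>carrier G. \<Sum>a\<in>A. \<Sum>b\<in>A.
      of_bool ((a \<otimes> (h \<otimes> g) \<in> P #> g) \<noteq> (b \<otimes> (h \<otimes> g) \<in> P #> g)))"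
    unfolding cut_def using sum.reindex_bij_betw[OF bij_right[OF assms(3)]] by (rule sym)
  also have "\<dots> = cut A P"
    unfolding cut_def
  proof (intro sum.cong refl)
    fix h a b assume *: "h \<in> carrier G" "a \<in> A" "b \<in> A"
    have "c \<otimes> (h \<otimes> g) \<in> P #> g \<longleftrightarrow> c \<otimes> h \<in> P" if "c \<in> A" for c
    proof -
      have c: "c \<in> carrier G" using that assms by auto
      then have "c \<otimes> (h \<otimes> g) \<otimes> inv g = c \<otimes> h" using * assms by (simp add: m_assoc)
      then show ?thesis using r_coset_mem[OF assms(2,3), of "c \<otimes> (h \<otimes> g)"] c * assms by simp
    qed
    then show "(of_bool ((a \<otimes> (h \<otimes> g) \<in> P #> g) \<noteq> (b \<otimes> (h \<otimes> g) \<in> P #> g)) :: nat) =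
       of_bool ((a \<otimes> h \<in> P) \<noteq> (b \<otimes> h \<in> P))"
      using * by simp
  qed
  finally show ?thesis .
qed

text \<open>\<open>P\<close> is invariant under left multiplication by the elements of \<open>K\<close>. The equivalence makes the notion stable under
  complements also if \<open>K\<close> is not closed under inverses.\<close>

definition left_stable :: "'a set \<Rightarrow> 'a set \<Rightarrow> bool" where
  "left_stable K P \<longleftrightarrow> (\<forall>k\<in>K. \<forall>p\<in>carrier G. k \<otimes> p \<in> P \<longleftrightarrow> p \<in> P)"

lemma left_stable_r_coset:
  assumes "left_stable K P" "K \<subseteq> carrier G" "P \<subseteq> carrier G" "g \<in> carrier G"
  shows "left_stable K (P #> g)"
  unfolding left_stable_def
proof (intro ballI)
  fix k p assume *: "k \<in> K" "p \<in> carrier G"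
  then have k: "k \<in> carrier G" using assms by auto
  have "k \<otimes> p \<in> P #> g \<longleftrightarrow> k \<otimes> (p \<otimes> inv g) \<in> P"
    using r_coset_mem[OF assms(3,4), of "k \<otimes> p"] k * assms by (simp add: m_assoc)
  also have "\<dots> \<longleftrightarrow> p \<otimes> inv g \<in> P" using assms * unfolding left_stable_def by simp
  also have "\<dots> \<longleftrightarrow> p \<in> P #> g" using r_coset_mem[OF assms(3,4), of p] * by simp
  finally show "k \<otimes> p \<in> P #> g \<longleftrightarrow> p \<in> P #> g" .
qed

lemma left_stable_ops:
  assumes "left_stable K X" "left_stable K Y" "K \<subseteq> carrier G"
  shows "left_stable K (X \<inter> Y)" "left_stable K (X - Y)" "left_stable K (carrier G - X)"
  using assms unfolding left_stable_def by (blast intro: m_closed)+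

text \<open>If every right translate of \<open>X\<close> is equal to \<open>X\<close> or disjoint from it, then \<open>X\<close> is a right coset of a subgroup.\<close>

lemma block_subgroup:
  assumes X: "X \<subseteq> carrier G" "y \<in> X"
    and block: "\<And>g. g \<in> carrier G \<Longrightarrow> X #> g = X \<or> X \<inter> (X #> g) = {}"
  shows "subgroup (X #> inv y) G"
proof -
  let ?H = "X #> inv y"
  have y: "y \<in> carrier G" using X by auto
  have Hc: "?H \<subseteq> carrier G" using X y by (simp add: r_coset_subset_G)
  have one: "\<one> \<in> ?H" using r_coset_mem[OF X(1), of "inv y" \<one>] y X by simp
  have stab: "?H #> g = ?H" if g: "g \<in> carrier G" "?H \<inter> (?H #> g) \<noteq> {}" for g
  proof -
    obtain x where x: "x \<in> ?H" "x \<in> ?H #> g" using g by auto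
    have xc: "x \<in> carrier G" using x Hc by auto
    have "x \<otimes> y \<in> X" using x(1) r_coset_mem[OF X(1), of "inv y" x] y xc by simp
    moreover have "x \<otimes> y \<in> X #> (inv y \<otimes> g \<otimes> y)"
    proof -
      have "x \<otimes> inv g \<otimes> y \<in> X"
        using x(2) r_coset_mem[OF Hc g(1) xc] r_coset_mem[OF X(1), of "inv y" "x \<otimes> inv g"] y xc g by simp
      moreover have "x \<otimes> y \<otimes> inv (inv y \<otimes> g \<otimes> y) = x \<otimes> inv g \<otimes> y"
      proof -
        have "inv (inv y \<otimes> g \<otimes> y) = inv y \<otimes> inv g \<otimes> y"
          using y g by (simp add: inv_mult_group m_assoc)
        then show ?thesis using y g xc by (simp add: m_assoc)
      qed
      ultimately show ?thesis using r_coset_mem[OF X(1), of "inv y \<otimes> g \<otimes> y" "x \<otimes> y"] y g xc by simp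
    qed
    ultimately have "X #> (inv y \<otimes> g \<otimes> y) = X" using block[of "inv y \<otimes> g \<otimes> y"] y g by auto
    then have "X #> (inv y \<otimes> g \<otimes> y) #> inv y = ?H" by simp
    moreover have "X #> (inv y \<otimes> g \<otimes> y) #> inv y = X #> (inv y \<otimes> g)"
      using X y g by (simp add: coset_mult_assoc m_assoc)
    ultimately show ?thesis using X y g by (simp add: coset_mult_assoc)
  qed
  show ?thesis
  proof (rule subgroupI)
    show "?H \<subseteq> carrier G" "?H \<noteq> {}" using Hc one by auto
  next
    fix a assume a: "a \<in> ?H"
    have ac: "a \<in> carrier G" using a Hc by auto
    have "\<one> \<in> ?H #> inv a" using r_coset_mem[OF Hc, of "inv a" \<one>] ac a by simp
    then have "?H #> inv a = ?H" using stab[of "inv a"] one ac by auto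
    moreover have "inv a \<in> ?H #> inv a" using r_coset_mem[OF Hc, of "inv a" "inv a"] ac one by simp
    ultimately show "inv a \<in> ?H" by simp
  next
    fix a b assume ab: "a \<in> ?H" "b \<in> ?H"
    have c: "a \<in> carrier G" "b \<in> carrier G" using ab Hc by auto
    have "b \<in> ?H #> b" using r_coset_mem[OF Hc, of b b] c one by simp
    then have "?H #> b = ?H" using stab[of b] ab c by auto
    moreover have "a \<otimes> b \<in> ?H #> b" using r_coset_mem[OF Hc, of b "a \<otimes> b"] c ab by (simp add: m_assoc)
    ultimately show "a \<otimes> b \<in> ?H" by simp
  qed
qed

text \<open>Take \<open>X\<close> of least cut, and then of least cardinality, among the \<open>K\<close>-stable sets that have more than \<open>\<tau>\<close> elements and
  miss more than \<open>\<tau>\<close> elements. If \<open>X\<close> meets a different translate \<open>Y = X g\<close>, then \<open>X - Y\<close> and \<open>X \<inter> Y\<close> have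
  at most \<open>\<tau>\<close> elements each, since otherwise submodularity would produce a smaller set of the same cut. So \<open>X\<close>
  is small, or its translates are disjoint.\<close>

theorem uncrossing:
  assumes A: "A \<subseteq> carrier G" and K: "K \<subseteq> carrier G"
    and W: "W \<subseteq> carrier G" "left_stable K W" "\<tau> < card W" "\<tau> < card (carrier G - W)"
  obtains (small) X where "X \<subseteq> carrier G" "left_stable K X" "\<tau> < card X" "card X \<le> 2 * \<tau>"
      "cut A X \<le> cut A W"
    | (subgroup) H where "subgroup H G" "K \<subseteq> H" "H \<noteq> carrier G" "\<tau> < card H" "cut A H \<le> cut A W"
proof -
  define Om where "Om = {X. X \<subseteq> carrier G \<and> left_stable K X \<and> \<tau> < card X \<and> \<tau> < card (carrier G - X)}"
  have "W \<in> Om" using W by (simp add: Om_def)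
  then obtain X0 where X0: "X0 \<in> Om" "\<And>Y. Y \<in> Om \<Longrightarrow> cut A X0 \<le> cut A Y"
    using ex_has_least_nat[of "\<lambda>X. X \<in> Om" W "cut A"] by blast
  obtain X where X: "X \<in> Om" "cut A X = cut A X0"
      and Xmin: "\<And>Y. Y \<in> Om \<Longrightarrow> cut A Y = cut A X0 \<Longrightarrow> card X \<le> card Y"
    using ex_has_least_nat[of "\<lambda>X. X \<in> Om \<and> cut A X = cut A X0" X0 card] X0(1) by blast
  have Xlow: "cut A X \<le> cut A Y" if "Y \<in> Om" for Y using X0(2)[OF that] X(2) by simp
  have Xc: "X \<subseteq> carrier G" "left_stable K X" "\<tau> < card X" "\<tau> < card (carrier G - X)"
    using X(1) by (auto simp: Om_def)
  have finX: "finite X" using Xc finite_sub by blast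
  have XW: "cut A X \<le> cut A W" using Xlow \<open>W \<in> Om\<close> by blast
  have "carrier G - X \<in> Om"
    using Xc left_stable_ops(3)[OF Xc(2) Xc(2) K] by (auto simp: Om_def double_diff)
  then have Xhalf: "card X \<le> card (carrier G - X)"
    using Xmin cut_compl[OF A] X(2) by simp
  then have Xhalf': "2 * card X \<le> card (carrier G)"
    using card_Diff_subset[OF finX Xc(1)] by simp
  show thesis
  proof (cases "\<forall>g\<in>carrier G. X #> g = X \<or> X \<inter> (X #> g) = {}")
    case True
    obtain y where y: "y \<in> X" using Xc(3) by fastforce
    have yc: "y \<in> carrier G" using y Xc by auto
    let ?H = "X #> inv y"
    have H: "subgroup ?H G" using block_subgroup[OF Xc(1) y] True by blast
    have cH: "card ?H = card X" using card_r_coset Xc yc by simp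
    have "K \<subseteq> ?H"
    proof
      fix k assume k: "k \<in> K"
      then have kc: "k \<in> carrier G" using K by auto
      have "\<one> \<in> ?H" using H subgroup.one_closed by blast
      then show "k \<in> ?H"
        using left_stable_r_coset[OF Xc(2) K Xc(1), of "inv y"] yc k kc unfolding left_stable_def
        by (metis inv_closed one_closed r_one)
    qed
    moreover have "?H \<noteq> carrier G" using cH Xhalf' Xc(3) by force
    ultimately show ?thesis
      using subgroup[OF H] cH Xc(3) cut_r_coset[OF A Xc(1), of "inv y"] yc XW by simp
  next
    case False
    then obtain g where g: "g \<in> carrier G" "X #> g \<noteq> X" "X \<inter> (X #> g) \<noteq> {}" by blast
    let ?Y = "X #> g"
    have Y: "?Y \<subseteq> carrier G" "left_stable K ?Y" "card ?Y = card X" "cut A ?Y = cut A X"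
      using Xc g left_stable_r_coset[OF Xc(2) K Xc(1)] card_r_coset cut_r_coset[OF A]
      by (auto simp: r_coset_subset_G)
    have finY: "finite ?Y" using Y finite_sub by blast
    have cd: "card (X - ?Y) + card (X \<inter> ?Y) = card X" "card (?Y - X) + card (X \<inter> ?Y) = card X"
      using card_Int_Diff[OF finX, of ?Y] card_Int_Diff[OF finY, of X] Y(3) by (auto simp: Int_commute)
    have up: "card (carrier G - X) \<le> card (carrier G - Z)" if "Z \<subseteq> X" for Z
      using that fin by (intro card_mono) auto
    have upY: "card (carrier G - ?Y) = card (carrier G - X)"
      using card_Diff_subset finX finY Xc Y by metis
    have upY': "card (carrier G - X) \<le> card (carrier G - Z)" if "Z \<subseteq> ?Y" for Z
      using that fin upY card_mono[of "carrier G - Z" "carrier G - ?Y"] by auto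
    have 1: "card (X - ?Y) \<le> \<tau>"
    proof (rule ccontr)
      assume "\<not> ?thesis"
      then have gt: "\<tau> < card (X - ?Y)" "\<tau> < card (?Y - X)" using cd by auto
      have m: "X - ?Y \<in> Om" "?Y - X \<in> Om"
        unfolding Om_def
        using gt Xc Y up[of "X - ?Y"] upY'[of "?Y - X"] left_stable_ops(2)[OF Xc(2) Y(2) K]
          left_stable_ops(2)[OF Y(2) Xc(2) K] by auto
      then have "cut A (X - ?Y) = cut A X0"
        using Xlow[OF m(1)] Xlow[OF m(2)] cut_Diff[of A X ?Y] Y(4) X(2) by linarith
      then have "card X \<le> card (X - ?Y)" using Xmin m by blast
      then have "card (X \<inter> ?Y) = 0" using cd by linarith
      then show False using g(3) finX by auto
    qed
    have 2: "card (X \<inter> ?Y) \<le> \<tau>"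
    proof (rule ccontr)
      assume "\<not> ?thesis"
      then have gt: "\<tau> < card (X \<inter> ?Y)" by simp
      have cu: "card (X \<union> ?Y) + card (X \<inter> ?Y) = 2 * card X"
        using card_Un_Int[OF finX finY] Y(3) by simp
      have "card (carrier G - (X \<union> ?Y)) = card (carrier G) - card (X \<union> ?Y)"
        using finX finY Xc Y by (intro card_Diff_subset) auto
      then have gt2: "\<tau> < card (carrier G - (X \<union> ?Y))" using cu gt Xhalf' by linarith
      have m: "X \<inter> ?Y \<in> Om"
        unfolding Om_def
        using gt Xc Y up[of "X \<inter> ?Y"] left_stable_ops(1)[OF Xc(2) Y(2) K] by auto
      have li: "left_stable K (X \<union> ?Y)"
        using Xc(2) Y(2) unfolding left_stable_def by blast
      have gt3: "\<tau> < card (X \<union> ?Y)" using cu cd gt by linarith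
      have m2: "X \<union> ?Y \<in> Om"
        unfolding Om_def using gt2 gt3 li Xc Y by auto
      have "cut A (X \<inter> ?Y) = cut A X0"
        using Xlow[OF m] Xlow[OF m2] cut_Int_Un[of A X ?Y] Y(4) X(2) by linarith
      then have "card X \<le> card (X \<inter> ?Y)" using Xmin m by blast
      then have "X \<inter> ?Y = X" using finX by (intro card_subset_eq) (auto intro: le_antisym card_mono)
      then have "X \<subseteq> ?Y" by blast
      then have "X = ?Y" using finY Y(3) by (intro card_subset_eq) auto
      then show False using g(2) by simp
    qed
    show ?thesis using small[OF Xc(1,2,3) _ XW] 1 2 cd by linarith
  qed
qed

section \<open>The isoperimetric atom\<close>

lemma set_inv_image: "set_inv S = m_inv G ` S"
  by (auto simp: SET_INV_def)

lemma set_inv_closed: "S \<subseteq> carrier G \<Longrightarrow> set_inv S \<subseteq> carrier G"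
  by (auto simp: set_inv_image)

lemma set_inv_set_inv: "S \<subseteq> carrier G \<Longrightarrow> set_inv (set_inv S) = S"
  by (force simp: set_inv_image subset_iff)

lemma card_set_inv: "S \<subseteq> carrier G \<Longrightarrow> card (set_inv S) = card S"
  unfolding set_inv_image by (intro card_image inj_onI) (metis in_mono inv_inv)

lemma set_inv_set_mult:
  assumes "A \<subseteq> carrier G" "B \<subseteq> carrier G"
  shows "set_inv (A <#> B) = set_inv B <#> set_inv A"
proof -
  have "inv (a \<otimes> b) = inv b \<otimes> inv a" if "a \<in> A" "b \<in> B" for a b
    using that assms by (simp add: inv_mult_group subset_iff)
  then show ?thesis unfolding set_inv_image set_mult_def by force
qed

text \<open>Duality: the complement of \<open>A S\<close> is to the set of inverses of \<open>S\<close> what \<open>A\<close> is to \<open>S\<close>.\<close>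

lemma compl_set_mult:
  assumes "A \<subseteq> carrier G" "S \<subseteq> carrier G"
  shows "(carrier G - (A <#> S)) <#> set_inv S \<subseteq> carrier G - A"
proof
  fix x assume "x \<in> (carrier G - (A <#> S)) <#> set_inv S"
  then obtain f s where fs: "f \<in> carrier G" "f \<notin> A <#> S" "s \<in> S" "x = f \<otimes> inv s"
    by (auto simp: set_mult_iff set_inv_image)
  have s: "s \<in> carrier G" using fs assms by auto
  have "x \<otimes> s = f" using fs s by (simp add: m_assoc)
  then have "x \<notin> A" using fs unfolding set_mult_iff by metis
  then show "x \<in> carrier G - A" using fs s by simp
qed

text \<open>The pair \<open>(R, B)\<close> is minimized over both \<open>S\<close> and its set of inverses at the same time. This makes the
  complement of \<open>B R\<close> at least as large as \<open>B\<close>, which leaves room for the union of \<open>B\<close> with a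
  translate in the submodularity argument.\<close>

theorem isoperimetric_atom:
  assumes S: "S \<subseteq> carrier G" and T: "T \<subseteq> carrier G" "2 \<le> card T"
    "card (T <#> S) + 2 \<le> card (carrier G)" "card (T <#> S) < card T + card S"
  obtains S' A where "S' = S \<or> S' = set_inv S" "A \<subseteq> carrier G" "\<one> \<in> A" "2 \<le> card A"
    "card (A <#> S') + 2 \<le> card (carrier G)" "card (A <#> S') < card A + card S'"
    "\<And>g. g \<in> carrier G \<Longrightarrow> g <# A = A \<or> card (A \<inter> (g <# A)) \<le> 1"
proof -
  define Om where "Om = {(R, B). (R = S \<or> R = set_inv S) \<and> B \<subseteq> carrier G \<and> 2 \<le> card B \<and>
     card (B <#> R) + 2 \<le> card (carrier G)}"
  \<comment> \<open>adding \<open>card G\<close> keeps the subtraction of natural numbers exact\<close>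
  define gap where "gap = (\<lambda>(R, B). card (B <#> R) + card (carrier G) - card B)"
  have gap: "gap (R, B) + card B = card (B <#> R) + card (carrier G)" if "B \<subseteq> carrier G" for R B
    using card_mono[OF fin that] unfolding gap_def by simp
  have "(S, T) \<in> Om" using assms by (simp add: Om_def)
  then obtain p0 where p0: "p0 \<in> Om" "\<And>q. q \<in> Om \<Longrightarrow> gap p0 \<le> gap q"
    using ex_has_least_nat[of "\<lambda>p. p \<in> Om" _ gap] by blast
  obtain p where p: "p \<in> Om" "gap p = gap p0"
    and pmin: "\<And>q. q \<in> Om \<Longrightarrow> gap q = gap p0 \<Longrightarrow> card (snd p) \<le> card (snd q)"
    using ex_has_least_nat[of "\<lambda>p. p \<in> Om \<and> gap p = gap p0" p0 "\<lambda>p. card (snd p)"] p0(1) by blast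
  obtain R B where RB: "p = (R, B)" by (cases p)
  have R: "R = S \<or> R = set_inv S" and B: "B \<subseteq> carrier G" "2 \<le> card B" "card (B <#> R) + 2 \<le> card (carrier G)"
    using p(1) RB by (auto simp: Om_def)
  have low: "gap (R, B) \<le> gap q" if "q \<in> Om" for q using p0(2)[OF that] p(2) RB by simp
  have cmin: "card B \<le> card C" if "(R', C) \<in> Om" "gap (R', C) = gap (R, B)" for R' C
    using pmin[OF that(1)] that(2) p(2) RB by simp
  have Rc: "R \<subseteq> carrier G" using R S set_inv_closed by auto
  have cR: "card R = card S" using R S card_set_inv by auto
  have BRc: "B <#> R \<subseteq> carrier G" using B Rc setmult_subset_G by blast
  let ?F = "carrier G - (B <#> R)"
  have cF: "card ?F + card (B <#> R) = card (carrier G)"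
    using card_Diff_subset[OF finite_sub[OF BRc] BRc] card_mono[OF fin BRc] by simp
  have cFB: "card B \<le> card ?F"
  proof -
    have sub: "?F <#> set_inv R \<subseteq> carrier G - B" using compl_set_mult[OF B(1) Rc] .
    have c: "card (?F <#> set_inv R) + card B \<le> card (carrier G)"
      using card_mono[OF _ sub] card_Diff_subset[OF finite_sub[OF B(1)] B(1)] card_mono[OF fin B(1)] fin by simp
    have m: "(set_inv R, ?F) \<in> Om"
      unfolding Om_def using c B cF R S set_inv_set_inv by auto
    have "gap (set_inv R, ?F) = gap (R, B)"
      using low[OF m] gap[of ?F "set_inv R"] gap[OF B(1), of R] c cF by auto
    then show ?thesis using cmin[OF m] by simp
  qed
  have sidon: "g <# B = B \<or> card (B \<inter> (g <# B)) \<le> 1" if g: "g \<in> carrier G" for g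
  proof (rule ccontr)
    assume neg: "\<not> ?thesis"
    let ?Y = "g <# B"
    have Y: "?Y \<subseteq> carrier G" "card ?Y = card B" using B g card_l_coset l_coset_subset_G by auto
    have finB: "finite B" "finite ?Y" using B Y finite_sub by auto
    have YR: "?Y <#> R = g <# (B <#> R)" using setmult_lcos_assoc[OF B(1) Rc g] by simp
    then have cYR: "card (?Y <#> R) = card (B <#> R)" using card_l_coset[OF BRc g] by simp
    have YRc: "?Y <#> R \<subseteq> carrier G" using Y Rc setmult_subset_G by blast
    have fin2: "finite (B <#> R)" "finite (?Y <#> R)" using BRc YRc finite_sub by auto
    have ne: "B \<inter> ?Y \<noteq> B"
    proof
      assume "B \<inter> ?Y = B"
      then have "B \<subseteq> ?Y" by blast
      then have "B = ?Y" using finB Y(2) by (intro card_subset_eq) auto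
      then show False using neg by auto
    qed
    have clt: "card (B \<inter> ?Y) < card B" using ne finB by (intro psubset_card_mono) auto
    have cI: "card ((B \<inter> ?Y) <#> R) \<le> card ((B <#> R) \<inter> (?Y <#> R))"
      using fin2 by (intro card_mono) (auto simp: set_mult_def)
    have cI2: "card ((B <#> R) \<inter> (?Y <#> R)) \<le> card (B <#> R)" using fin2 by (intro card_mono) auto
    have UR: "(B \<union> ?Y) <#> R = (B <#> R) \<union> (?Y <#> R)" by (auto simp: set_mult_def)
    have cU: "card ((B \<union> ?Y) <#> R) + card ((B <#> R) \<inter> (?Y <#> R)) = 2 * card (B <#> R)"
      unfolding UR using card_Un_Int[OF fin2] cYR by simp
    have cB: "card (B \<union> ?Y) + card (B \<inter> ?Y) = 2 * card B"
      using card_Un_Int[OF finB] Y(2) by simp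
    have mI: "(R, B \<inter> ?Y) \<in> Om" unfolding Om_def using neg R B cI cI2 by auto
    have g1: "gap (R, B) < gap (R, B \<inter> ?Y)"
      using low[OF mI] cmin[OF mI] clt by linarith
    note gI = gap[of "B \<inter> ?Y" R, OF le_infI1[OF B(1)]]
    note gB = gap[OF B(1), of R]
    have Uc: "B \<union> ?Y \<subseteq> carrier G" using B Y by auto
    note gU = gap[OF Uc, of R]
    have bigU: "card ((B \<union> ?Y) <#> R) + 2 \<le> card (carrier G)"
      using cU cI g1 gI gB cF cFB neg by linarith
    have mU: "(R, B \<union> ?Y) \<in> Om" unfolding Om_def using R Uc bigU cB clt by auto
    show False using low[OF mU] gU gB gI g1 cU cI cB by linarith
  qed
  obtain b where b: "b \<in> B" using B(2) by fastforce
  have bc: "b \<in> carrier G" using b B by auto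
  let ?A = "inv b <# B"
  have A: "?A \<subseteq> carrier G" "card ?A = card B" using B bc card_l_coset l_coset_subset_G by auto
  have AR: "card (?A <#> R) = card (B <#> R)"
    using setmult_lcos_assoc[OF B(1) Rc, of "inv b"] card_l_coset[OF BRc, of "inv b"] bc by simp
  have "gap (R, B) \<le> gap (S, T)" using low[OF \<open>(S, T) \<in> Om\<close>] .
  then have lt: "card (B <#> R) < card B + card R"
    using gap[OF B(1), of R] gap[OF T(1), of S] T(4) cR by linarith
  show thesis
  proof (rule that[OF R A(1)])
    show "\<one> \<in> ?A" using l_coset_mem[OF B(1), of "inv b" \<one>] b bc by simp
    show "2 \<le> card ?A" "card (?A <#> R) + 2 \<le> card (carrier G)" "card (?A <#> R) < card ?A + card R"
      using A AR B lt by auto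
  next
    fix g assume g: "g \<in> carrier G"
    let ?g' = "b \<otimes> g \<otimes> inv b"
    have g': "?g' \<in> carrier G" using g bc by simp
    have e: "g <# ?A = inv b <# (?g' <# B)"
      using B bc g by (simp add: lcos_m_assoc m_assoc)
    have "?A \<inter> (g <# ?A) = inv b <# (B \<inter> (?g' <# B))"
    proof -
      have i: "inj_on (\<lambda>x. inv b \<otimes> x) (carrier G)"
        using bc by (intro inj_onI) (metis mult_inv_left)
      show ?thesis unfolding e unfolding l_coset_image[of "inv b"]
        using inj_on_image_Int[OF i B(1) l_coset_subset_G[OF B(1) g']] by simp
    qed
    then have "card (?A \<inter> (g <# ?A)) = card (B \<inter> (?g' <# B))"
      using card_l_coset[of "B \<inter> (?g' <# B)" "inv b"] B bc by (simp add: le_infI1)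
    then show "g <# ?A = ?A \<or> card (?A \<inter> (g <# ?A)) \<le> 1"
      using sidon[OF g'] e by auto
  qed
qed

section \<open>Counting incidences of translates\<close>

text \<open>The number of points of the translate \<open>A h\<close> that lie in \<open>P\<close>, counted by their positions in \<open>A\<close>.\<close>

definition hits :: "'a set \<Rightarrow> 'a set \<Rightarrow> 'a \<Rightarrow> nat" where
  "hits A P h = card {a \<in> A. a \<otimes> h \<in> P}"

lemma hits_le: "A \<subseteq> carrier G \<Longrightarrow> hits A P h \<le> card A"
  unfolding hits_def using finite_sub by (intro card_mono) auto

lemma cut_hits:
  assumes A: "A \<subseteq> carrier G"
  shows "int (cut A P) = 2 * (\<Sum>h\<in>carrier G. int (hits A P h) * (int (card A) - int (hits A P h)))"
proof -
  have finA: "finite A" using A finite_sub by blast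
  have "(\<Sum>a\<in>A. \<Sum>b\<in>A. of_bool ((a \<otimes> h \<in> P) \<noteq> (b \<otimes> h \<in> P))) =
     2 * (int (hits A P h) * (int (card A) - int (hits A P h)))" (is "?l = ?r") for h
  proof -
    let ?u = "\<lambda>a. a \<otimes> h \<in> P"
    have c: "card {a \<in> A. \<not> ?u a} + hits A P h = card A"
      using card_Int_Diff[OF finA, of "{a. ?u a}"] unfolding hits_def
      by (simp add: Int_def set_diff_eq)
    have s: "(\<Sum>b\<in>A. (of_bool (?u a \<noteq> ?u b) :: int)) = (if ?u a then int (card A) - int (hits A P h) else int (hits A P h))" for a
    proof (cases "?u a")
      case True
      then have "(\<Sum>b\<in>A. (of_bool (?u a \<noteq> ?u b) :: int)) = int (card {b \<in> A. \<not> ?u b})"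
        using finA by (simp add: of_bool_def sum.If_cases Int_def)
      then show ?thesis using True c by simp
    next
      case False
      then show ?thesis using finA by (simp add: of_bool_def sum.If_cases Int_def hits_def)
    qed
    have "?l = (\<Sum>a\<in>A. (if ?u a then int (card A) - int (hits A P h) else int (hits A P h)))"
      using s by simp
    also have "\<dots> = int (hits A P h) * (int (card A) - int (hits A P h)) + int (card {a\<in>A. \<not> ?u a}) * int (hits A P h)"
      using finA by (simp add: sum.If_cases hits_def Int_def)
    also have "int (card {a\<in>A. \<not> ?u a}) = int (card A) - int (hits A P h)" using c by simp
    finally show ?thesis by (simp add: algebra_simps)
  qed
  then have e: "int (\<Sum>a\<in>A. \<Sum>b\<in>A. of_bool ((a \<otimes> h \<in> P) \<noteq> (b \<otimes> h \<in> P))) =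
     2 * (int (hits A P h) * (int (card A) - int (hits A P h)))" for h by simp
  show ?thesis unfolding cut_def of_nat_sum[of _ "carrier G"] e sum_distrib_left ..
qed

lemma hits_alt:
  assumes "A \<subseteq> carrier G" "P \<subseteq> carrier G" "h \<in> carrier G"
  shows "hits A P h = card {p \<in> P. p \<otimes> inv h \<in> A}"
proof -
  have "bij_betw (\<lambda>a. a \<otimes> h) {a \<in> A. a \<otimes> h \<in> P} {p \<in> P. p \<otimes> inv h \<in> A}"
    by (rule bij_betwI[where g = "\<lambda>p. p \<otimes> inv h"]) (use assms in \<open>auto simp: m_assoc subset_iff\<close>)
  then show ?thesis unfolding hits_def by (rule bij_betw_same_card)
qed

lemma sum_hits:
  assumes "A \<subseteq> carrier G" "P \<subseteq> carrier G"
  shows "(\<Sum>h\<in>carrier G. hits A P h) = card A * card P"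
proof -
  have finA: "finite A" using assms finite_sub by blast
  have "(\<Sum>h\<in>carrier G. hits A P h) = (\<Sum>h\<in>carrier G. \<Sum>a\<in>A. of_bool (a \<otimes> h \<in> P))"
    using finA by (intro sum.cong refl) (simp add: hits_def of_bool_def sum.If_cases Int_def)
  also have "\<dots> = (\<Sum>a\<in>A. \<Sum>h\<in>carrier G. of_bool (a \<otimes> h \<in> P))" by (rule sum.swap)
  also have "\<dots> = (\<Sum>a\<in>A. card P)"
  proof (rule sum.cong[OF refl])
    fix a assume "a \<in> A"
    then have a: "a \<in> carrier G" using assms by auto
    have "(\<Sum>h\<in>carrier G. of_bool (a \<otimes> h \<in> P)) = card {h \<in> carrier G. a \<otimes> h \<in> P}"
      using fin by (simp add: of_bool_def sum.If_cases Int_def)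
    also have "\<dots> = card P"
    proof (rule bij_betw_same_card)
      show "bij_betw (\<lambda>h. a \<otimes> h) {h \<in> carrier G. a \<otimes> h \<in> P} P"
        by (rule bij_betwI[where g = "\<lambda>p. inv a \<otimes> p"]) (use assms a in \<open>auto simp: subset_iff\<close>)
    qed
    finally show "(\<Sum>h\<in>carrier G. of_bool (a \<otimes> h \<in> P)) = card P" .
  qed
  finally show ?thesis by simp
qed

text \<open>Double counting of the pairs \<open>(p, q)\<close> of points of \<open>P\<close> on a common translate of \<open>A\<close>: they lie on
  \<open>card (A \<inter> p q\<^sup>-\<^sup>1 A)\<close> translates, the number of ways to write \<open>p q\<^sup>-\<^sup>1\<close> as a quotient of elements of \<open>A\<close>.\<close>

lemma sum_hits_sq:
  assumes A: "A \<subseteq> carrier G" and P: "P \<subseteq> carrier G"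
  shows "(\<Sum>h\<in>carrier G. (hits A P h)\<^sup>2) = (\<Sum>p\<in>P. \<Sum>q\<in>P. card (A \<inter> ((p \<otimes> inv q) <# A)))"
proof -
  have finP: "finite P" using P finite_sub by blast
  let ?v = "\<lambda>h p. p \<otimes> inv h \<in> A"
  have "(\<Sum>h\<in>carrier G. (hits A P h)\<^sup>2) = (\<Sum>h\<in>carrier G. \<Sum>p\<in>P. \<Sum>q\<in>P. of_bool (?v h p) * of_bool (?v h q))"
  proof (rule sum.cong[OF refl])
    fix h assume h: "h \<in> carrier G"
    have "hits A P h = (\<Sum>p\<in>P. of_bool (?v h p))"
      using finP hits_alt[OF A P h] by (simp add: of_bool_def sum.If_cases Int_def)
    then show "(hits A P h)\<^sup>2 = (\<Sum>p\<in>P. \<Sum>q\<in>P. of_bool (?v h p) * of_bool (?v h q))"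
      by (simp add: power2_eq_square sum_product)
  qed
  also have "\<dots> = (\<Sum>p\<in>P. \<Sum>h\<in>carrier G. \<Sum>q\<in>P. of_bool (?v h p) * of_bool (?v h q))" by (rule sum.swap)
  also have "\<dots> = (\<Sum>p\<in>P. \<Sum>q\<in>P. \<Sum>h\<in>carrier G. of_bool (?v h p) * of_bool (?v h q))"
    by (intro sum.cong refl sum.swap)
  also have "\<dots> = (\<Sum>p\<in>P. \<Sum>q\<in>P. card (A \<inter> ((p \<otimes> inv q) <# A)))"
  proof (intro sum.cong refl)
    fix p q assume "p \<in> P" "q \<in> P"
    then have pq: "p \<in> carrier G" "q \<in> carrier G" using P by auto
    have "(\<Sum>h\<in>carrier G. of_bool (?v h p) * of_bool (?v h q)) = card {h \<in> carrier G. ?v h p \<and> ?v h q}"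
      unfolding of_bool_conj[symmetric] using fin by (simp add: of_bool_def sum.If_cases Int_def)
    also have "\<dots> = card (A \<inter> ((p \<otimes> inv q) <# A))"
    proof (rule bij_betw_same_card)
      have m: "x \<in> (p \<otimes> inv q) <# A \<longleftrightarrow> q \<otimes> inv p \<otimes> x \<in> A" if "x \<in> carrier G" for x
        using l_coset_mem[OF A, of "p \<otimes> inv q" x] pq that by (simp add: inv_mult_group)
      show "bij_betw (\<lambda>h. p \<otimes> inv h) {h \<in> carrier G. ?v h p \<and> ?v h q} (A \<inter> ((p \<otimes> inv q) <# A))"
      proof (rule bij_betwI[where g = "\<lambda>a. inv a \<otimes> p"])
        show "(\<lambda>h. p \<otimes> inv h) \<in> {h \<in> carrier G. ?v h p \<and> ?v h q} \<rightarrow> A \<inter> ((p \<otimes> inv q) <# A)"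
          using m pq by (auto simp: m_assoc)
        show "(\<lambda>a. inv a \<otimes> p) \<in> A \<inter> ((p \<otimes> inv q) <# A) \<rightarrow> {h \<in> carrier G. ?v h p \<and> ?v h q}"
          using m pq A by (auto simp: m_assoc inv_mult_group subset_iff)
      qed (use pq A in \<open>auto simp: inv_mult_group m_assoc subset_iff\<close>)
    qed
    finally show "(\<Sum>h\<in>carrier G. of_bool (?v h p) * of_bool (?v h q)) = card (A \<inter> ((p \<otimes> inv q) <# A))" .
  qed
  finally show ?thesis .
qed

lemma left_stable_dvd:
  assumes K: "subgroup K G" and P: "P \<subseteq> carrier G" "left_stable K P"
  shows "card K dvd card P"
proof -
  have eq: "\<Union>((\<lambda>p. K #> p) ` P) = P"
  proof
    show "\<Union>((\<lambda>p. K #> p) ` P) \<subseteq> P" using P by (auto simp: r_coset_image left_stable_def)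
    show "P \<subseteq> \<Union>((\<lambda>p. K #> p) ` P)" using P K rcos_self by blast
  qed
  have Kc: "K \<subseteq> carrier G" using K subgroup.subset by blast
  have "card K dvd card (\<Union>((\<lambda>p. K #> p) ` P))"
  proof (rule dvd_partition)
    show "finite (\<Union> ((#>) K ` P))" using eq P finite_sub by simp
    show "\<forall>c\<in>(#>) K ` P. card K dvd card c" using card_r_coset[OF Kc] P by auto
    show "\<forall>c1\<in>(#>) K ` P. \<forall>c2\<in>(#>) K ` P. c1 \<noteq> c2 \<longrightarrow> c1 \<inter> c2 = {}"
      using rcos_disjoint[OF K] P rcosetsI[OF Kc] unfolding pairwise_def disjnt_def by blast
  qed
  then show ?thesis using eq by simp
qed

text \<open>At least the translates \<open>A h\<close> with \<open>h\<close> in \<open>H\<close> or in \<open>a\<^sup>-\<^sup>1 H\<close>, for a fixed \<open>a \<in> A - H\<close>, are split by \<open>H\<close>.\<close>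

lemma cut_subgroup:
  assumes A: "A \<subseteq> carrier G" "\<one> \<in> A" and H: "subgroup H G" and nA: "\<not> A \<subseteq> H"
  shows "4 * (int (card A) - 1) * int (card H) \<le> int (cut A H)"
proof -
  have Hc: "H \<subseteq> carrier G" using H subgroup.subset by blast
  have finA: "finite A" using A finite_sub by blast
  let ?f = "\<lambda>h. int (hits A H h) * (int (card A) - int (hits A H h))"
  have big: "int (card A) - 1 \<le> ?f h" if "a \<in> A" "a \<otimes> h \<in> H" "b \<in> A" "b \<otimes> h \<notin> H" for a b h
  proof -
    have "0 < hits A H h" unfolding hits_def using that finA by (auto simp: card_gt_0_iff)
    moreover have "hits A H h < card A" unfolding hits_def using that finA by (intro psubset_card_mono) auto
    ultimately have "0 \<le> (int (hits A H h) - 1) * (int (card A) - int (hits A H h) - 1)" by simp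
    then show ?thesis by (simp add: algebra_simps)
  qed
  obtain a where a: "a \<in> A" "a \<notin> H" using nA by auto
  have ac: "a \<in> carrier G" using a A by auto
  have im: "inv a <# H \<subseteq> carrier G" "card (inv a <# H) = card H"
    using Hc ac card_l_coset l_coset_subset_G by auto
  have dis: "H \<inter> (inv a <# H) = {}"
  proof -
    have "x \<notin> H" if "x \<in> inv a <# H" for x
    proof
      assume x: "x \<in> H"
      have xc: "x \<in> carrier G" using x Hc by auto
      have "a \<otimes> x \<in> H" using that l_coset_mem[OF Hc, of "inv a" x] ac xc by simp
      then have "a \<otimes> x \<otimes> inv x \<in> H" using x H by (simp add: subgroup.m_closed subgroup.m_inv_closed)
      then show False using a ac xc by (simp add: m_assoc)
    qed
    then show ?thesis by blast
  qed
  have 1: "int (card A) - 1 \<le> ?f h" if "h \<in> H" for h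
  proof (rule big[OF A(2) _ a(1)])
    show "\<one> \<otimes> h \<in> H" using that Hc by (simp add: subset_iff)
    show "a \<otimes> h \<notin> H"
    proof
      assume "a \<otimes> h \<in> H"
      then have "a \<otimes> h \<otimes> inv h \<in> H" using that H by (simp add: subgroup.m_closed subgroup.m_inv_closed)
      moreover have "h \<in> carrier G" using that Hc by auto
      ultimately show False using a ac by (simp add: m_assoc)
    qed
  qed
  have 2: "int (card A) - 1 \<le> ?f h" if "h \<in> inv a <# H" for h
  proof (rule big[OF a(1) _ A(2)])
    have hc: "h \<in> carrier G" using that im by auto
    show "a \<otimes> h \<in> H" using that l_coset_mem[OF Hc, of "inv a" h] ac hc by simp
    show "\<one> \<otimes> h \<notin> H" using that dis hc by auto
  qed
  have "(int (card A) - 1) * (2 * int (card H)) = (\<Sum>h\<in>H \<union> (inv a <# H). int (card A) - 1)"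
    using card_Un_disjoint[OF finite_sub[OF Hc] finite_sub[OF im(1)] dis] im by simp
  also have "\<dots> \<le> (\<Sum>h\<in>H \<union> (inv a <# H). ?f h)"
    using 1 2 by (intro sum_mono) auto
  also have "\<dots> \<le> (\<Sum>h\<in>carrier G. ?f h)"
    using fin Hc im(1) hits_le[OF A(1)] by (intro sum_mono2) auto
  finally show ?thesis using cut_hits[OF A(1), of H] by (simp add: algebra_simps)
qed

end

section \<open>Sets with unique quotients\<close>

text \<open>A set \<open>A\<close> with left stabilizer \<open>K\<close> that meets its other left translates in at most one element; in other words,
  an element outside \<open>K\<close> is a quotient \<open>a b\<^sup>-\<^sup>1\<close> of elements of \<open>A\<close> in at most one way. For trivial \<open>K\<close> this is a
  Sidon set. That \<open>A \<noteq> K\<close> says, as \<open>1 \<in> A\<close>, that \<open>A\<close> is not a subgroup. The group \<open>K\<close> is a parameter, rather than being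
  defined as a stabilizer, so that it does not change on passing to a subgroup that contains \<open>A\<close>.\<close>

locale sidon_block = fin_group +
  fixes A K
  assumes A_carrier: "A \<subseteq> carrier G" and one_A: "\<one> \<in> A" and K_subgroup: "subgroup K G"
    and A_stable: "\<And>g. g \<in> K \<Longrightarrow> g <# A = A"
    and A_sidon: "\<And>g. g \<in> carrier G \<Longrightarrow> g \<notin> K \<Longrightarrow> card (A \<inter> (g <# A)) \<le> 1"
    and A_neq_K: "A \<noteq> K" and card_A: "3 \<le> card A"
begin

lemma K_carrier: "K \<subseteq> carrier G"
  using K_subgroup subgroup.subset by blast

lemma K_subset_A: "K \<subseteq> A"
proof
  fix g assume g: "g \<in> K"
  then have "g \<otimes> \<one> \<in> g <# A" using one_A unfolding l_coset_image by blast
  then show "g \<in> A" using A_stable[OF g] g K_carrier by auto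
qed

lemma finite_A: "finite A" and finite_K: "finite K"
  using A_carrier K_carrier finite_sub by auto

lemma card_K_pos: "0 < card K"
  using finite_K subgroup.one_closed[OF K_subgroup] by (auto simp: card_gt_0_iff)

lemma left_stable_A: "left_stable K A"
  unfolding left_stable_def
proof (intro ballI)
  fix g p assume g: "g \<in> K" and p: "p \<in> carrier G"
  have gc: "g \<in> carrier G" using g K_carrier by auto
  show "g \<otimes> p \<in> A \<longleftrightarrow> p \<in> A"
    using l_coset_mem[OF A_carrier gc, of "g \<otimes> p"] A_stable[OF g] gc p by simp
qed

lemma card_K_dvd: "card K dvd card A"
  using left_stable_dvd[OF K_subgroup A_carrier left_stable_A] .

lemma card_K_le: "2 * card K \<le> card A"
proof -
  obtain j where j: "card A = card K * j" using card_K_dvd by blast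
  have "j \<noteq> 0" using j card_A by (intro notI) simp
  moreover have "j \<noteq> 1"
  proof
    assume "j = 1"
    then have "K = A" using j by (intro card_subset_eq[OF finite_A K_subset_A]) simp
    then show False using A_neq_K by simp
  qed
  ultimately have "2 \<le> j" by simp
  then show ?thesis using j by simp
qed

lemma card_overlap: "g \<in> carrier G \<Longrightarrow> card (A \<inter> (g <# A)) \<le> 1 + (card A - 1) * of_bool (g \<in> K)"
  using A_sidon[of g] A_stable[of g] card_A by auto

lemma sum_hits_sq_le:
  assumes P: "P \<subseteq> carrier G"
  shows "(\<Sum>h\<in>carrier G. (hits A P h)\<^sup>2) \<le> (card P)\<^sup>2 + (card A - 1) * (card P * card K)"
proof -
  have finP: "finite P" using P finite_sub by blast
  have k: "(\<Sum>q\<in>P. of_bool (p \<otimes> inv q \<in> K)) \<le> card K" if p: "p \<in> P" for p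
  proof -
    have pc: "p \<in> carrier G" using p P by auto
    have "(\<Sum>q\<in>P. of_bool (p \<otimes> inv q \<in> K)) = card {q \<in> P. p \<otimes> inv q \<in> K}"
      using finP by (simp add: of_bool_def sum.If_cases Int_def)
    also have "\<dots> \<le> card K"
    proof (rule card_inj_on_le[OF _ _ finite_K])
      show "inj_on (\<lambda>q. p \<otimes> inv q) {q \<in> P. p \<otimes> inv q \<in> K}"
      proof (rule inj_onI)
        fix q r assume "q \<in> {q \<in> P. p \<otimes> inv q \<in> K}" "r \<in> {q \<in> P. p \<otimes> inv q \<in> K}" "p \<otimes> inv q = p \<otimes> inv r"
        moreover from this have qr: "q \<in> carrier G" "r \<in> carrier G" using P by auto
        ultimately have "inv q = inv r" using pc by simp
        then show "q = r" using qr inv_inv by metis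
      qed
    qed auto
    finally show ?thesis .
  qed
  have "(\<Sum>h\<in>carrier G. (hits A P h)\<^sup>2) = (\<Sum>p\<in>P. \<Sum>q\<in>P. card (A \<inter> ((p \<otimes> inv q) <# A)))"
    using sum_hits_sq[OF A_carrier P] .
  also have "\<dots> \<le> (\<Sum>p\<in>P. \<Sum>q\<in>P. 1 + (card A - 1) * of_bool (p \<otimes> inv q \<in> K))"
    using P by (intro sum_mono card_overlap) auto
  also have "\<dots> = (\<Sum>p\<in>P. card P + (card A - 1) * (\<Sum>q\<in>P. of_bool (p \<otimes> inv q \<in> K)))"
    by (simp add: sum_Suc sum.distrib sum_distrib_left)
  also have "\<dots> \<le> (\<Sum>p\<in>P. card P + (card A - 1) * card K)"
    using k by (intro sum_mono add_mono mult_left_mono) auto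
  also have "\<dots> = (card P)\<^sup>2 + (card A - 1) * (card P * card K)"
    by (simp add: power2_eq_square algebra_simps)
  finally show ?thesis .
qed

lemma cut_sum:
  assumes P: "P \<subseteq> carrier G"
  shows "int (cut A P) = 2 * ((int (card A))\<^sup>2 * int (card P) - int (\<Sum>h\<in>carrier G. (hits A P h)\<^sup>2))"
proof -
  have "int (cut A P) = 2 * (int (card A) * int (\<Sum>h\<in>carrier G. hits A P h) - int (\<Sum>h\<in>carrier G. (hits A P h)\<^sup>2))"
    unfolding cut_hits[OF A_carrier] of_nat_sum sum_distrib_left sum_subtractf[symmetric]
    by (intro sum.cong refl) (simp add: algebra_simps power2_eq_square)
  then show ?thesis
    unfolding sum_hits[OF A_carrier P] by (simp add: algebra_simps power2_eq_square)
qed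

lemma cut_lower:
  assumes P: "P \<subseteq> carrier G"
  shows "2 * int (card P) * ((int (card A))\<^sup>2 - (int (card A) - 1) * int (card K) - int (card P)) \<le> int (cut A P)"
proof -
  have "int (\<Sum>h\<in>carrier G. (hits A P h)\<^sup>2) \<le> int ((card P)\<^sup>2 + (card A - 1) * (card P * card K))"
    using sum_hits_sq_le[OF P] by (simp only: of_nat_le_iff)
  also have "\<dots> = (int (card P))\<^sup>2 + (int (card A) - 1) * (int (card P) * int (card K))"
    using card_A by (simp add: of_nat_diff)
  finally show ?thesis unfolding cut_sum[OF P] by (simp add: algebra_simps power2_eq_square)
qed

text \<open>A translate \<open>A h\<close> with \<open>h \<in> Q\<close> lies inside \<open>P\<close> and contributes nothing to the cut; any other translate that is split
  by \<open>P\<close> meets \<open>P\<close> in at least \<open>card K\<close> points.\<close>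

lemma cut_upper:
  assumes P: "P \<subseteq> carrier G" "left_stable K P" and Q: "Q \<subseteq> carrier G" "A <#> Q \<subseteq> P"
  shows "int (cut A P) \<le> 2 * int (card A) * (int (card A) - int (card K)) * (int (card P) - int (card Q))"
proof -
  let ?r = "\<lambda>h. int (hits A P h)" and ?a = "int (card A)" and ?k = "int (card K)"
  have full: "?r h = ?a" if "h \<in> Q" for h
  proof -
    have "{a \<in> A. a \<otimes> h \<in> P} = A" using that Q by (auto simp: set_mult_def)
    then show ?thesis unfolding hits_def by simp
  qed
  have pos: "?r h * (?a - ?r h) \<le> (?a - ?k) * ?r h" if h: "h \<in> carrier G" for h
  proof (cases "hits A P h = 0")
    case False
    then obtain a where a: "a \<in> A" "a \<otimes> h \<in> P"
      unfolding hits_def using card_gt_0_iff[of "{a \<in> A. a \<otimes> h \<in> P}"] by auto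
    have ac: "a \<in> carrier G" using a A_carrier by auto
    have "K #> a \<subseteq> {a \<in> A. a \<otimes> h \<in> P}"
    proof
      fix x assume "x \<in> K #> a"
      then obtain g where g: "g \<in> K" "x = g \<otimes> a" by (auto simp: r_coset_image)
      have gc: "g \<in> carrier G" using g K_carrier by auto
      have "x \<in> A" using left_stable_A g a ac unfolding left_stable_def by simp
      moreover have "g \<otimes> (a \<otimes> h) \<in> P" using P(2) g a ac h unfolding left_stable_def by simp
      ultimately show "x \<in> {a \<in> A. a \<otimes> h \<in> P}" using g gc ac h by (simp add: m_assoc)
    qed
    then have "card (K #> a) \<le> hits A P h" unfolding hits_def using finite_A by (intro card_mono) auto
    then have "?k \<le> ?r h" using card_r_coset[OF K_carrier ac] by simp
    then have "?r h * (?a - ?r h) \<le> ?r h * (?a - ?k)" by (intro mult_left_mono) auto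
    then show ?thesis by (simp add: mult.commute)
  qed simp
  have "(\<Sum>h\<in>carrier G. ?r h * (?a - ?r h)) = (\<Sum>h\<in>carrier G - Q. ?r h * (?a - ?r h))"
    using full fin Q by (intro sum.mono_neutral_right) auto
  also have "\<dots> \<le> (\<Sum>h\<in>carrier G - Q. (?a - ?k) * ?r h)"
    using pos by (intro sum_mono) auto
  also have "\<dots> = (?a - ?k) * (\<Sum>h\<in>carrier G - Q. ?r h)" by (simp add: sum_distrib_left)
  also have "(\<Sum>h\<in>carrier G - Q. ?r h) = (\<Sum>h\<in>carrier G. ?r h) - (\<Sum>h\<in>Q. ?r h)"
    using fin Q by (simp add: sum_diff finite_sub)
  also have "(\<Sum>h\<in>carrier G. ?r h) = ?a * int (card P)"
    using arg_cong[OF sum_hits[OF A_carrier P(1)], of int] by simp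
  also have "(\<Sum>h\<in>Q. ?r h) = ?a * int (card Q)" using full by simp
  finally show ?thesis unfolding cut_hits[OF A_carrier] by (simp add: algebra_simps)
qed

lemma left_stable_product:
  assumes "Q \<subseteq> carrier G"
  shows "left_stable K (A <#> Q)"
proof -
  have *: "g \<otimes> p \<in> A <#> Q" if gp: "g \<in> K" "p \<in> A <#> Q" for g p
  proof -
    obtain a q where aq: "a \<in> A" "q \<in> Q" "p = a \<otimes> q" using gp by (auto simp: set_mult_iff)
    have "g \<otimes> a \<in> A" using left_stable_A gp aq A_carrier unfolding left_stable_def by auto
    moreover have "g \<otimes> p = g \<otimes> a \<otimes> q" using aq gp A_carrier K_carrier assms by (simp add: m_assoc subset_iff)
    ultimately show ?thesis using aq by (auto simp: set_mult_iff)
  qed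
  show ?thesis
    unfolding left_stable_def
  proof (intro ballI iffI)
    fix g p assume g: "g \<in> K" "p \<in> carrier G" "g \<otimes> p \<in> A <#> Q"
    then have "inv g \<otimes> (g \<otimes> p) \<in> A <#> Q"
      using * K_subgroup subgroup.m_inv_closed by metis
    then show "p \<in> A <#> Q" using g K_carrier by (simp add: subset_iff)
  qed (use * in auto)
qed

text \<open>There are at least \<open>card A * (card A - card K)\<close> quotients of elements of \<open>A\<close> outside \<open>K\<close>.\<close>

lemma card_carrier_lower: "int (card K) + int (card A) * (int (card A) - int (card K)) \<le> int (card (carrier G))"
proof -
  have "(\<Sum>g\<in>carrier G. card (A \<inter> (g <# A))) = (\<Sum>g\<in>carrier G. \<Sum>a\<in>A. of_bool (inv g \<otimes> a \<in> A))"
  proof (rule sum.cong[OF refl])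
    fix g assume g: "g \<in> carrier G"
    have "A \<inter> (g <# A) = {a \<in> A. inv g \<otimes> a \<in> A}"
      using l_coset_mem[OF A_carrier g] A_carrier by auto
    then show "card (A \<inter> (g <# A)) = (\<Sum>a\<in>A. of_bool (inv g \<otimes> a \<in> A))"
      using finite_A by (simp add: of_bool_def sum.If_cases Int_def)
  qed
  also have "\<dots> = (\<Sum>a\<in>A. \<Sum>g\<in>carrier G. of_bool (inv g \<otimes> a \<in> A))" by (rule sum.swap)
  also have "\<dots> = (\<Sum>a\<in>A. card A)"
  proof (rule sum.cong[OF refl])
    fix a assume "a \<in> A"
    then have a: "a \<in> carrier G" using A_carrier by auto
    have "bij_betw (\<lambda>g. inv g \<otimes> a) {g \<in> carrier G. inv g \<otimes> a \<in> A} A"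
      by (rule bij_betwI[where g = "\<lambda>b. a \<otimes> inv b"])
        (use a A_carrier in \<open>auto simp: inv_mult_group m_assoc subset_iff\<close>)
    then have "card {g \<in> carrier G. inv g \<otimes> a \<in> A} = card A" by (rule bij_betw_same_card)
    then show "(\<Sum>g\<in>carrier G. of_bool (inv g \<otimes> a \<in> A)) = card A"
      using fin by (simp add: of_bool_def sum.If_cases Int_def)
  qed
  finally have e: "(\<Sum>g\<in>carrier G. card (A \<inter> (g <# A))) = card A * card A" by simp
  have "(\<Sum>g\<in>carrier G. card (A \<inter> (g <# A))) \<le> (\<Sum>g\<in>carrier G. 1 + (card A - 1) * of_bool (g \<in> K))"
    by (intro sum_mono card_overlap)
  also have "\<dots> = card (carrier G) + (card A - 1) * card K"
    using fin K_carrier by (simp add: sum_Suc sum_distrib_left[symmetric] of_bool_def sum.If_cases Int_absorb1)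
  finally have "int (card A * card A) \<le> int (card (carrier G) + (card A - 1) * card K)"
    unfolding e by (simp only: of_nat_le_iff)
  moreover have "int (card (carrier G) + (card A - 1) * card K) = int (card (carrier G)) + (int (card A) - 1) * int (card K)"
    using card_A by (simp add: of_nat_diff)
  ultimately show ?thesis by (simp add: algebra_simps)
qed

text \<open>The lower bound for the cut is a quadratic polynomial in \<open>card P\<close>. It takes the value that bounds
  \<open>cut A P\<close> by assumption at \<open>card A\<close> and at \<open>(card A - 1) * (card A - card K)\<close>, and is larger in between.\<close>

lemma card_lower_of_cut:
  assumes P: "P \<subseteq> carrier G" "card A < card P"
    and cut: "int (cut A P) \<le> 2 * int (card A) * (int (card A) - int (card K)) * (int (card A) - 1)"
  shows "(int (card A) - 1) * (int (card A) - int (card K)) \<le> int (card P)"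
proof -
  let ?a = "int (card A)" and ?k = "int (card K)" and ?q = "int (card P)"
  have "2 * ?q * (?a\<^sup>2 - (?a - 1) * ?k - ?q) \<le> 2 * ?a * (?a - ?k) * (?a - 1)"
    using cut_lower[OF P(1)] cut by linarith
  then have "0 \<le> (?q - ?a) * (?q - (?a - 1) * (?a - ?k))"
    by (simp add: algebra_simps power2_eq_square)
  then show ?thesis using P(2) by (simp add: zero_le_mult_iff)
qed

text \<open>Under the first assumption there are no sets of intermediate size and small cut, so that
  uncrossing with \<open>\<tau> = card A\<close> yields a subgroup. The lower bound on its order shows that its cut would be too large if it
  did not contain \<open>A\<close>.\<close>

lemma large_cut:
  assumes nonexc: "2 * card A < (card A - 1) * (card A - card K)"
    and P: "P \<subseteq> carrier G" "card A < card P" "card A < card (carrier G - P)"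
    and cut: "int (cut A P) \<le> 2 * int (card A) * (int (card A) - int (card K)) * (int (card A) - 1)"
  obtains H where "subgroup H G" "A \<subseteq> H" "H \<noteq> carrier G"
proof -
  let ?a = "int (card A)" and ?k = "int (card K)"
  have ne: "2 * ?a < (?a - 1) * (?a - ?k)"
  proof -
    have "int (2 * card A) < int ((card A - 1) * (card A - card K))" using nonexc by (simp only: of_nat_less_iff)
    then show ?thesis using card_A card_K_le by (simp add: of_nat_diff)
  qed
  have li: "left_stable {} P" by (simp add: left_stable_def)
  show ?thesis
  proof (cases rule: uncrossing[OF A_carrier empty_subsetI P(1) li P(2,3), case_names small subgroup])
    case (small X)
    then have "(?a - 1) * (?a - ?k) \<le> int (card X)" using cut by (intro card_lower_of_cut) auto
    then show ?thesis using small ne by linarith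
  next
    case (subgroup H)
    have Hc: "H \<subseteq> carrier G" using subgroup subgroup.subset by blast
    have cH: "int (cut A H) \<le> 2 * ?a * (?a - ?k) * (?a - 1)" using subgroup cut by linarith
    have b: "(?a - 1) * (?a - ?k) \<le> int (card H)" using card_lower_of_cut[OF Hc subgroup(4) cH] .
    have "A \<subseteq> H"
    proof (rule ccontr)
      assume "\<not> A \<subseteq> H"
      then have "4 * (?a - 1) * int (card H) \<le> 2 * ?a * (?a - ?k) * (?a - 1)"
        using cut_subgroup[OF A_carrier one_A subgroup(1)] cH by linarith
      then have "(?a - 1) * (2 * int (card H)) \<le> (?a - 1) * (?a * (?a - ?k))"
        by (simp add: algebra_simps)
      then have "2 * int (card H) \<le> ?a * (?a - ?k)" using card_A by simp
      then have "2 * ((?a - 1) * (?a - ?k)) \<le> ?a * (?a - ?k)" using b by linarith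
      then have "(2 * ?a - 2) * (?a - ?k) \<le> ?a * (?a - ?k)" by (simp add: algebra_simps)
      moreover have "0 < ?a - ?k" using card_K_le card_K_pos by linarith
      ultimately have "2 * ?a - 2 \<le> ?a" using mult_le_cancel_right_pos by blast
      then show False using card_A by simp
    qed
    then show ?thesis using subgroup that by blast
  qed
qed

text \<open>For \<open>card A = 4\<close> and \<open>card K = 2\<close> the previous argument fails, but it still works for the smaller bound 32 on the
  cut, with \<open>\<tau> = 2\<close>.\<close>

lemma cut_exceptional:
  assumes exc: "card A = 4" "card K = 2"
    and P: "P \<subseteq> carrier G" "3 \<le> card P" "3 \<le> card (carrier G - P)" "cut A P \<le> 32"
  obtains H where "subgroup H G" "A \<subseteq> H" "H \<noteq> carrier G"
proof -
  have li: "left_stable {} P" by (simp add: left_stable_def)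
  have c: "8 \<le> card X" if X: "X \<subseteq> carrier G" "2 < card X" "cut A X \<le> 32" for X
  proof -
    have "2 * int (card X) * (10 - int (card X)) \<le> 32"
      using cut_lower[OF X(1)] X(3) exc by simp
    then have "0 \<le> (int (card X) - 2) * (int (card X) - 8)" by (simp add: algebra_simps)
    then show ?thesis using X(2) by (simp add: zero_le_mult_iff)
  qed
  have P': "2 < card P" "2 < card (carrier G - P)" using P by auto
  show ?thesis
  proof (cases rule: uncrossing[OF A_carrier empty_subsetI P(1) li P', case_names small subgroup])
    case (small X)
    then show ?thesis using c[of X] P(4) by simp
  next
    case (subgroup H)
    have Hc: "H \<subseteq> carrier G" using subgroup subgroup.subset by blast
    have "8 \<le> card H" using c[OF Hc subgroup(4)] subgroup P(4) by simp
    have "A \<subseteq> H"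
    proof (rule ccontr)
      assume "\<not> A \<subseteq> H"
      then have "12 * int (card H) \<le> int (cut A H)"
        using cut_subgroup[OF A_carrier one_A subgroup(1)] exc by simp
      then show False using \<open>8 \<le> card H\<close> subgroup(5) P(4) by linarith
    qed
    then show ?thesis using subgroup that by blast
  qed
qed

end

context fin_group begin

lemma l_coset_mult: "A \<subseteq> carrier G \<Longrightarrow> g \<in> carrier G \<Longrightarrow> h \<in> carrier G \<Longrightarrow> g <# (h <# A) = (g \<otimes> h) <# A"
  by (simp add: lcos_m_assoc)

lemma subgroup_left_stabilizer:
  assumes B: "B \<subseteq> carrier G"
  shows "subgroup {g \<in> carrier G. g <# B = B} G"
proof (rule subgroupI)
  show "{g \<in> carrier G. g <# B = B} \<noteq> {}" using lcos_mult_one[OF B] by auto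
next
  fix a assume "a \<in> {g \<in> carrier G. g <# B = B}"
  then have a: "a \<in> carrier G" "a <# B = B" by auto
  have "inv a <# (a <# B) = B" using a(1) B lcos_mult_one[OF B] by (simp add: l_coset_mult)
  then show "inv a \<in> {g \<in> carrier G. g <# B = B}" using a by simp
next
  fix a b assume "a \<in> {g \<in> carrier G. g <# B = B}" "b \<in> {g \<in> carrier G. g <# B = B}"
  then have "a \<in> carrier G" "b \<in> carrier G" "a <# B = B" "b <# B = B" by auto
  then show "a \<otimes> b \<in> {g \<in> carrier G. g <# B = B}" using l_coset_mult[OF B, of a b] by simp
qed auto

lemma subgroup_right_stabilizer:
  assumes B: "B \<subseteq> carrier G"
  shows "subgroup {g \<in> carrier G. B #> g = B} G"
proof (rule subgroupI)
  show "{g \<in> carrier G. B #> g = B} \<noteq> {}" using B by auto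
next
  fix a assume "a \<in> {g \<in> carrier G. B #> g = B}"
  then have a: "a \<in> carrier G" "B #> a = B" by auto
  have "(B #> a) #> inv a = B" using a(1) B by (simp add: coset_mult_assoc)
  then show "inv a \<in> {g \<in> carrier G. B #> g = B}" using a by simp
next
  fix a b assume "a \<in> {g \<in> carrier G. B #> g = B}" "b \<in> {g \<in> carrier G. B #> g = B}"
  then have "a \<in> carrier G" "b \<in> carrier G" "B #> a = B" "B #> b = B" by auto
  then show "a \<otimes> b \<in> {g \<in> carrier G. B #> g = B}" using coset_mult_assoc[OF B, of a b] by simp
qed auto

lemma left_stable_stabilizer:
  assumes B: "B \<subseteq> carrier G"
  shows "left_stable {g \<in> carrier G. g <# B = B} B"
  unfolding left_stable_def
proof (intro ballI)
  fix k p assume k: "k \<in> {g \<in> carrier G. g <# B = B}" and p: "p \<in> carrier G"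
  then show "k \<otimes> p \<in> B \<longleftrightarrow> p \<in> B" using l_coset_mem[OF B, of k "k \<otimes> p"] by simp
qed

lemma card_le_set_mult: "1 \<le> card Q \<Longrightarrow> A \<subseteq> carrier G \<Longrightarrow> Q \<subseteq> carrier G \<Longrightarrow> card A \<le> card (A <#> Q)"
proof -
  assume Q: "1 \<le> card Q" and c: "A \<subseteq> carrier G" "Q \<subseteq> carrier G"
  obtain q where q: "q \<in> Q" using Q by fastforce
  have "A #> q \<subseteq> A <#> Q" using q by (auto simp: r_coset_image set_mult_def)
  then have "card (A #> q) \<le> card (A <#> Q)"
    using setmult_subset_G[OF c] finite_sub by (intro card_mono) auto
  then show ?thesis using card_r_coset[OF c(1)] q c by auto
qed

end

context sidon_block begin

lemma right_translate_eq:
  assumes t: "t \<in> carrier G" "A #> t = A"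
  shows "t = \<one>"
proof (rule ccontr)
  assume ne: "t \<noteq> \<one>"
  obtain g where g: "g \<in> A" "g \<notin> K" using K_subset_A A_neq_K by blast
  have gc: "g \<in> carrier G" using g A_carrier by auto
  have tA: "t \<in> A" "g \<otimes> t \<in> A"
  proof -
    have "\<one> \<otimes> t \<in> A #> t" "g \<otimes> t \<in> A #> t" using one_A g(1) by (auto simp: r_coset_image)
    then show "t \<in> A" "g \<otimes> t \<in> A" using t by auto
  qed
  have "g \<otimes> \<one> \<in> g <# A" "g \<otimes> t \<in> g <# A"
    unfolding l_coset_image using tA one_A by blast+
  then have "g \<otimes> \<one> \<in> A \<inter> (g <# A)" "g \<otimes> t \<in> A \<inter> (g <# A)"
    using g gc tA by auto
  then have "g \<otimes> \<one> = g \<otimes> t"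
    using card_le1D[OF _ A_sidon[OF gc g(2)]] finite_A by blast
  then show False using gc t ne by simp
qed

lemma card_product_gt:
  assumes Q: "Q \<subseteq> carrier G" "2 \<le> card Q"
  shows "card A < card (A <#> Q)"
proof (rule ccontr)
  assume neg: "\<not> ?thesis"
  have fP: "finite (A <#> Q)" using setmult_subset_G[OF A_carrier Q(1)] finite_sub by blast
  have eq: "A #> q = A <#> Q" if "q \<in> Q" for q
  proof (rule card_seteq[OF fP])
    show "A #> q \<subseteq> A <#> Q" using that by (auto simp: r_coset_image set_mult_def)
    show "card (A <#> Q) \<le> card (A #> q)" using neg card_r_coset[OF A_carrier] that Q by auto
  qed
  obtain q r where qr: "q \<in> Q" "r \<in> Q" "q \<noteq> r"
    using Q(2) by (metis One_nat_def Suc_1 card_le_Suc0_iff_eq finite_sub[OF Q(1)] not_less_eq_eq)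
  have c: "q \<in> carrier G" "r \<in> carrier G" using qr Q by auto
  have "A #> q #> inv r = A #> r #> inv r" using eq[OF qr(1)] eq[OF qr(2)] by simp
  then have "A #> (q \<otimes> inv r) = A" using A_carrier c by (simp add: coset_mult_assoc)
  then have "q \<otimes> inv r = \<one>" using right_translate_eq c by simp
  then have "q \<otimes> inv r \<otimes> r = r" using c by simp
  then show False using qr c by (simp add: m_assoc)
qed

text \<open>Here \<open>B\<close> is an atom for the three-element set \<open>A\<close>, with left stabilizer \<open>R\<close>. The number of pairs of incidences
  between the inverses \<open>Z\<close> of \<open>B\<close> and the translates of \<open>A\<close> is bounded from above both by unique quotients in
  \<open>A\<close> and by the atom property of \<open>B\<close>. Since there are at most \<open>card B + 2\<close> translates that meet \<open>Z\<close>, this forces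
  \<open>card B \<le> card R + 2\<close> and \<open>card B \<ge> 4\<close>. So \<open>B\<close> is a coset of \<open>R\<close>, and then \<open>A\<close> lies in its right stabilizer, or \<open>B\<close>
  has four elements and \<open>R\<close> has order two. In the latter case all bounds are attained and an involution is a
  quotient of two elements of \<open>A\<close> in exactly one way, which is absurd because inverting gives another way.\<close>

lemma three_elements_fragment:
  assumes c3: "card A = 3"
    and B: "B \<subseteq> carrier G" "2 \<le> card B" "card (B <#> A) \<le> card B + 2"
      "card (B <#> A) + 2 \<le> card (carrier G)"
    and sid: "\<And>g. g \<in> carrier G \<Longrightarrow> g <# B = B \<or> card (B \<inter> (g <# B)) \<le> 1"
  obtains H where "subgroup H G" "A \<subseteq> H" "H \<noteq> carrier G"
proof -
  have k1: "card K = 1" using card_K_le card_K_pos c3 by linarith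
  then obtain x where "K = {x}" by (rule card_1_singletonE)
  then have K1: "K = {\<one>}" using subgroup.one_closed[OF K_subgroup] by simp
  define Z where "Z = set_inv B"
  have Z: "Z \<subseteq> carrier G" "card Z = card B" unfolding Z_def using B set_inv_closed card_set_inv by auto
  have finZ: "finite Z" "finite B" using Z B finite_sub by auto
  have BAc: "B <#> A \<subseteq> carrier G" using setmult_subset_G[OF B(1) A_carrier] .
  let ?r = "hits A Z" and ?b = "int (card B)"
  define R where "R = {g \<in> carrier G. g <# B = B}"
  have R: "subgroup R G" unfolding R_def using subgroup_left_stabilizer[OF B(1)] .
  have Rc: "R \<subseteq> carrier G" unfolding R_def by auto
  have finR: "finite R" using Rc finite_sub by blast
  have liR: "left_stable R B" unfolding R_def using left_stable_stabilizer[OF B(1)] .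
  have r3: "?r h \<le> 3" for h using hits_le[OF A_carrier, of Z h] c3 by simp
  have memZ: "x \<in> Z \<longleftrightarrow> inv x \<in> B" if "x \<in> carrier G" for x
    unfolding Z_def set_inv_image using that B(1) by (force simp: image_iff)
  define M where "M = set_inv (B <#> A)"
  have M: "M \<subseteq> carrier G" "card M = card (B <#> A)"
    unfolding M_def using set_inv_closed[OF BAc] card_set_inv[OF BAc] by auto
  have r0: "?r h = 0" if h: "h \<in> carrier G" "h \<notin> M" for h
  proof -
    have "a \<otimes> h \<notin> Z" if a: "a \<in> A" for a
    proof
      assume "a \<otimes> h \<in> Z"
      have ac: "a \<in> carrier G" using a A_carrier by auto
      have "inv (a \<otimes> h) \<in> B" using memZ[of "a \<otimes> h"] \<open>a \<otimes> h \<in> Z\<close> ac h by simp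
      then have "inv (a \<otimes> h) \<otimes> a \<in> B <#> A" using a by (auto simp: set_mult_iff)
      moreover have "inv (a \<otimes> h) \<otimes> a = inv h" using ac h by (simp add: inv_mult_group m_assoc)
      ultimately have "inv (inv h) \<in> M" unfolding M_def set_inv_image by force
      then show False using h by simp
    qed
    then have "{a \<in> A. a \<otimes> h \<in> Z} = {}" by blast
    then show ?thesis unfolding hits_def by (simp only: card.empty)
  qed
  have sumr: "(\<Sum>h\<in>M. int (?r h)) = 3 * ?b"
  proof -
    have "(\<Sum>h\<in>M. ?r h) = (\<Sum>h\<in>carrier G. ?r h)"
      using r0 fin M by (intro sum.mono_neutral_left) auto
    then have "(\<Sum>h\<in>M. ?r h) = 3 * card B" using sum_hits[OF A_carrier Z(1)] c3 Z by simp
    then show ?thesis by (metis of_nat_mult of_nat_numeral of_nat_sum)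
  qed
  define s2 where "s2 = (\<Sum>h\<in>carrier G. (?r h)\<^sup>2)"
  have s2M: "int s2 = (\<Sum>h\<in>M. (int (?r h))\<^sup>2)"
  proof -
    have "s2 = (\<Sum>h\<in>M. (?r h)\<^sup>2)"
      unfolding s2_def using r0 fin M by (intro sum.mono_neutral_right) auto
    then show ?thesis by simp
  qed
  \<comment> \<open>\<open>n\<^sup>2\<close> lies above the line through its values at the consecutive integers \<open>j - 1\<close> and \<open>j\<close>\<close>
  have tangent: "(2 * j - 1) * 3 * ?b - j * (j - 1) * (?b + 2) \<le> int s2" if j: "j = 2 \<or> j = (3::int)" for j
  proof -
    have ineq: "(2 * j - 1) * int n - j * (j - 1) \<le> (int n)\<^sup>2" for n
    proof -
      have "0 \<le> (int n - j) * (int n - (j - 1))"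
        by (cases "int n \<ge> j") (auto intro: mult_nonpos_nonpos)
      then show ?thesis by (simp add: algebra_simps power2_eq_square)
    qed
    have "(2 * j - 1) * (3 * ?b) - j * (j - 1) * int (card M) = (\<Sum>h\<in>M. (2 * j - 1) * int (?r h) - j * (j - 1))"
      by (simp add: sum_subtractf sum_distrib_left[symmetric] sumr)
    also have "\<dots> \<le> int s2" unfolding s2M using ineq by (intro sum_mono)
    finally have "(2 * j - 1) * (3 * ?b) - j * (j - 1) * int (card M) \<le> int s2" .
    moreover have "j * (j - 1) * int (card M) \<le> j * (j - 1) * (?b + 2)"
      using M(2) B(3) j by (intro mult_left_mono) auto
    ultimately show ?thesis by (simp add: algebra_simps)
  qed
  have up: "int s2 \<le> ?b\<^sup>2 + 2 * ?b"
  proof -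
    have "s2 \<le> (card B)\<^sup>2 + 2 * card B"
      unfolding s2_def using sum_hits_sq_le[OF Z(1)] Z(2) c3 k1 by simp
    then have "int s2 \<le> int ((card B)\<^sup>2 + 2 * card B)" by (simp only: of_nat_le_iff)
    then show ?thesis by simp
  qed
  have b4: "4 \<le> ?b"
  proof -
    have "7 * ?b - 4 \<le> ?b\<^sup>2 + 2 * ?b" using tangent[of 2] up by simp
    then have "0 \<le> (?b - 1) * (?b - 4)" by (simp add: algebra_simps power2_eq_square)
    then show ?thesis using B(2) by (simp add: zero_le_mult_iff)
  qed
  have up2: "s2 \<le> 3 * card B + 6 * card R"
  proof -
    let ?n = "\<lambda>a c. card {h \<in> carrier G. a \<otimes> h \<in> Z \<and> c \<otimes> h \<in> Z}"
    have same: "?n a a = card B" if "a \<in> A" for a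
    proof -
      have a: "a \<in> carrier G" using that A_carrier by auto
      have "bij_betw (\<lambda>h. a \<otimes> h) {h \<in> carrier G. a \<otimes> h \<in> Z \<and> a \<otimes> h \<in> Z} Z"
        by (rule bij_betwI[where g = "\<lambda>p. inv a \<otimes> p"]) (use Z a in \<open>auto simp: subset_iff\<close>)
      then show ?thesis using Z(2) bij_betw_same_card by fastforce
    qed
    have diff: "?n a c \<le> card R" if ac: "a \<in> A" "c \<in> A" "a \<noteq> c" for a c
    proof (cases "{h \<in> carrier G. a \<otimes> h \<in> Z \<and> c \<otimes> h \<in> Z} = {}")
      case False
      have acc: "a \<in> carrier G" "c \<in> carrier G" using ac A_carrier by auto
      obtain h0 where h0: "h0 \<in> carrier G" "a \<otimes> h0 \<in> Z" "c \<otimes> h0 \<in> Z" using False by auto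
      show ?thesis
      proof (rule card_inj_on_le[OF _ _ finR])
        show "inj_on (\<lambda>h. inv h \<otimes> h0) {h \<in> carrier G. a \<otimes> h \<in> Z \<and> c \<otimes> h \<in> Z}"
        proof (rule inj_onI)
          fix h h' assume "h \<in> {h \<in> carrier G. a \<otimes> h \<in> Z \<and> c \<otimes> h \<in> Z}"
            "h' \<in> {h \<in> carrier G. a \<otimes> h \<in> Z \<and> c \<otimes> h \<in> Z}" and e: "inv h \<otimes> h0 = inv h' \<otimes> h0"
          then have hh: "h \<in> carrier G" "h' \<in> carrier G" by auto
          then have "inv h = inv h'" using e h0 by simp
          then have "inv (inv h) = inv (inv h')" by simp
          then show "h = h'" using hh by simp
        qed
        show "(\<lambda>h. inv h \<otimes> h0) ` {h \<in> carrier G. a \<otimes> h \<in> Z \<and> c \<otimes> h \<in> Z} \<subseteq> R"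
        proof
          fix t assume "t \<in> (\<lambda>h. inv h \<otimes> h0) ` {h \<in> carrier G. a \<otimes> h \<in> Z \<and> c \<otimes> h \<in> Z}"
          then obtain h where h: "h \<in> carrier G" "a \<otimes> h \<in> Z" "c \<otimes> h \<in> Z" "t = inv h \<otimes> h0" by auto
          have tc: "t \<in> carrier G" using h h0 by simp
          have m: "inv (x \<otimes> h) \<in> B \<inter> (t <# B)" if x: "x \<in> carrier G" "x \<otimes> h \<in> Z" "x \<otimes> h0 \<in> Z" for x
          proof -
            have "inv (x \<otimes> h) \<in> B" "inv (x \<otimes> h0) \<in> B" using memZ x h h0 by auto
            moreover have "inv (x \<otimes> h) = t \<otimes> inv (x \<otimes> h0)"
              using x h h0 by (simp add: inv_mult_group m_assoc)
            ultimately show ?thesis by (auto simp: l_coset_image)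
          qed
          have ne: "inv (a \<otimes> h) \<noteq> inv (c \<otimes> h)"
          proof
            assume "inv (a \<otimes> h) = inv (c \<otimes> h)"
            then have "inv (inv (a \<otimes> h)) = inv (inv (c \<otimes> h))" by simp
            then have "a \<otimes> h = c \<otimes> h" using acc h by simp
            then show False using acc h ac(3) by simp
          qed
          have "\<not> card (B \<inter> (t <# B)) \<le> 1"
            using card_le1D[OF _ _ m[OF acc(1) h(2) h0(2)] m[OF acc(2) h(3) h0(3)]] ne finZ by blast
          then show "t \<in> R" unfolding R_def using sid[OF tc] tc by auto
        qed
      qed
    qed (simp only: card.empty le0)
    have "s2 = (\<Sum>h\<in>carrier G. \<Sum>a\<in>A. \<Sum>c\<in>A. of_bool (a \<otimes> h \<in> Z \<and> c \<otimes> h \<in> Z))"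
      unfolding s2_def
    proof (rule sum.cong[OF refl])
      fix h
      have "?r h = (\<Sum>a\<in>A. of_bool (a \<otimes> h \<in> Z))"
        using finite_A by (simp add: hits_def of_bool_def sum.If_cases Int_def)
      then show "(?r h)\<^sup>2 = (\<Sum>a\<in>A. \<Sum>c\<in>A. of_bool (a \<otimes> h \<in> Z \<and> c \<otimes> h \<in> Z))"
        by (simp add: power2_eq_square sum_product of_bool_conj)
    qed
    also have "\<dots> = (\<Sum>a\<in>A. \<Sum>h\<in>carrier G. \<Sum>c\<in>A. of_bool (a \<otimes> h \<in> Z \<and> c \<otimes> h \<in> Z))" by (rule sum.swap)
    also have "\<dots> = (\<Sum>a\<in>A. \<Sum>c\<in>A. \<Sum>h\<in>carrier G. of_bool (a \<otimes> h \<in> Z \<and> c \<otimes> h \<in> Z))"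
      by (intro sum.cong refl sum.swap)
    also have "\<dots> = (\<Sum>a\<in>A. \<Sum>c\<in>A. ?n a c)"
      using fin by (intro sum.cong refl) (simp add: of_bool_def sum.If_cases Int_def)
    also have "\<dots> \<le> (\<Sum>a\<in>A. card B + 2 * card R)"
    proof (rule sum_mono)
      fix a assume a: "a \<in> A"
      have "(\<Sum>c\<in>A. ?n a c) = ?n a a + (\<Sum>c\<in>A - {a}. ?n a c)"
        using a finite_A by (simp add: sum.remove)
      also have "(\<Sum>c\<in>A - {a}. ?n a c) \<le> (\<Sum>c\<in>A - {a}. card R)"
        using a diff by (intro sum_mono) auto
      also have "(\<Sum>c\<in>A - {a}. card R) = 2 * card R" using a finite_A c3 by simp
      finally show "(\<Sum>c\<in>A. ?n a c) \<le> card B + 2 * card R" using same[OF a] by simp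
    qed
    also have "\<dots> = 3 * card B + 6 * card R" using c3 by simp
    finally show ?thesis .
  qed
  have bR: "card B \<le> card R + 2"
  proof -
    have "9 * ?b - 12 \<le> int s2" using tangent[of 3] by simp
    then show ?thesis using up2 by linarith
  qed
  obtain j where j: "card B = card R * j" using left_stable_dvd[OF R B(1) liR] by blast
  have "j \<noteq> 0" using j b4 by (intro notI) simp
  obtain b0 where b0: "b0 \<in> B" using B(2) by fastforce
  have b0c: "b0 \<in> carrier G" using b0 B by auto
  show thesis
  proof (cases "j = 1")
    case True
    have fBA: "finite (B <#> A)" using BAc finite_sub by blast
    have BR: "R #> b0 = B"
    proof (rule card_seteq[OF finZ(2)])
      show "R #> b0 \<subseteq> B" using liR b0 b0c unfolding left_stable_def by (auto simp: r_coset_image)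
      show "card B \<le> card (R #> b0)" using card_r_coset[OF Rc b0c] j True by simp
    qed
    have st: "B #> a = B" if a: "a \<in> A" for a
    proof (rule ccontr)
      assume ne: "B #> a \<noteq> B"
      have ac: "a \<in> carrier G" using a A_carrier by auto
      have "B #> a = R #> (b0 \<otimes> a)" using BR coset_mult_assoc[OF Rc b0c ac] by simp
      then have "B #> a \<in> rcosets R" "B \<in> rcosets R"
        using rcosetsI[OF Rc] b0c ac BR by (metis m_closed)+
      then have dis: "(B #> a) \<inter> B = {}"
        using rcos_disjoint[OF R] ne unfolding pairwise_def disjnt_def by blast
      have sub: "(B #> a) \<union> B \<subseteq> B <#> A"
        using a one_A B by (force simp: r_coset_image set_mult_def)
      have "finite (B #> a)" using sub fBA finite_subset by blast
      then have "2 * card B \<le> card (B <#> A)"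
        using card_mono[OF fBA sub] card_Un_disjoint[OF _ finZ(2) dis] card_r_coset[OF B(1) ac] by simp
      then show False using B(3) b4 by linarith
    qed
    let ?H = "{g \<in> carrier G. B #> g = B}"
    have "card ?H \<le> card B"
    proof (rule card_inj_on_le[OF _ _ finZ(2)])
      show "inj_on (\<lambda>g. b0 \<otimes> g) ?H" using b0c by (intro inj_onI) simp
      show "(\<lambda>g. b0 \<otimes> g) ` ?H \<subseteq> B" using b0 by (auto simp: r_coset_image)
    qed
    moreover have "card B \<le> card (B <#> A)"
      using one_A B fBA by (intro card_mono) (force simp: set_mult_def)+
    ultimately have "?H \<noteq> carrier G" using B(4) by force
    then show thesis
      using that[OF subgroup_right_stabilizer[OF B(1)]] st A_carrier by blast
  next
    case False
    then have "2 \<le> j" using \<open>j \<noteq> 0\<close> by simp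
    then have "2 * card R \<le> card B" using j by simp
    then have e: "card B = 4" "card R = 2" using bR b4 by linarith+
    have "\<not> R \<subseteq> {\<one>}" using card_mono[of "{\<one>}" R] e by auto
    then obtain t where t: "t \<in> R" "t \<noteq> \<one>" by blast
    have tc: "t \<in> carrier G" using t Rc by auto
    have tt: "t \<otimes> t = \<one>"
    proof -
      have "card {\<one>, t} = 2" using t(2) by simp
      moreover have "{\<one>, t} \<subseteq> R" using t(1) subgroup.one_closed[OF R] by blast
      ultimately have "{\<one>, t} = R" using card_subset_eq[OF finR] e by simp
      moreover have "t \<otimes> t \<in> R" using subgroup.m_closed[OF R t(1) t(1)] .
      moreover have "t \<otimes> t \<noteq> t" using t(2) tc by simp
      ultimately show ?thesis by blast
    qed
    define g where "g = inv b0 \<otimes> t \<otimes> b0"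
    have gc: "g \<in> carrier G" unfolding g_def using tc b0c by simp
    have gg: "g \<otimes> g = \<one>"
    proof -
      have "g \<otimes> g = inv b0 \<otimes> (t \<otimes> t) \<otimes> b0" unfolding g_def using tc b0c by (simp add: m_assoc)
      then show ?thesis using tt b0c by simp
    qed
    have g1: "g \<noteq> \<one>"
    proof
      assume "g = \<one>"
      then have "b0 \<otimes> g \<otimes> inv b0 = \<one>" using b0c by simp
      then have "t = \<one>" unfolding g_def using tc b0c by (simp add: m_assoc)
      then show False using t by simp
    qed
    have gA: "card (A \<inter> (g <# A)) = 0"
    proof (rule ccontr)
      assume "card (A \<inter> (g <# A)) \<noteq> 0"
      then obtain a where a: "a \<in> A" "a \<in> g <# A" by (metis IntE card.empty ex_in_conv)
      obtain a' where a': "a' \<in> A" "a = g \<otimes> a'" using a by (auto simp: l_coset_image)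
      have c: "a \<in> carrier G" "a' \<in> carrier G" using a a' A_carrier by auto
      have "g \<otimes> a = a'" using a' c gc gg by (simp add: m_assoc[symmetric])
      then have "a' \<in> g <# A" using a(1) unfolding l_coset_image by (metis imageI)
      then have "a' \<in> A \<inter> (g <# A)" using a' by auto
      then have "a = a'"
        using card_le1D[OF _ A_sidon[OF gc]] a finite_A g1 K1 by blast
      then show False using a' c gc g1 by simp
    qed
    let ?p = "inv b0" and ?q = "inv (t \<otimes> b0)"
    have tb: "t \<otimes> b0 \<in> B" using liR t b0 b0c unfolding left_stable_def by auto
    have pq: "?p \<in> Z" "?q \<in> Z" unfolding Z_def set_inv_image using b0 tb by auto
    have pqg: "?p \<otimes> inv ?q = g" unfolding g_def using tc b0c by (simp add: m_assoc)
    have "s2 = (\<Sum>(p, q)\<in>Z \<times> Z. card (A \<inter> ((p \<otimes> inv q) <# A)))"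
      unfolding s2_def using sum_hits_sq[OF A_carrier Z(1)] by (simp add: sum.cartesian_product)
    also have "\<dots> < (\<Sum>(p, q)\<in>Z \<times> Z. 1 + 2 * of_bool (p = q))"
    proof (rule sum_strict_mono_ex1)
      show "finite (Z \<times> Z)" using finZ by simp
      show "\<forall>x\<in>Z \<times> Z. (case x of (p, q) \<Rightarrow> card (A \<inter> ((p \<otimes> inv q) <# A))) \<le> (case x of (p, q) \<Rightarrow> 1 + 2 * of_bool (p = q))"
      proof clarify
        fix p q assume "p \<in> Z" "q \<in> Z"
        then have c: "p \<in> carrier G" "q \<in> carrier G" using Z by auto
        have "p \<otimes> inv q \<in> K \<longleftrightarrow> p = q"
        proof
          assume "p \<otimes> inv q \<in> K"
          then have "p \<otimes> inv q \<otimes> q = q" using c unfolding K1 by simp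
          then show "p = q" using c by (simp add: m_assoc)
        qed (use c K1 in simp)
        then show "card (A \<inter> ((p \<otimes> inv q) <# A)) \<le> 1 + 2 * of_bool (p = q)"
          using card_overlap[of "p \<otimes> inv q"] c c3 by simp
      qed
      show "\<exists>x\<in>Z \<times> Z. (case x of (p, q) \<Rightarrow> card (A \<inter> ((p \<otimes> inv q) <# A))) < (case x of (p, q) \<Rightarrow> 1 + 2 * of_bool (p = q))"
        using pq pqg gA by (intro bexI[of _ "(?p, ?q)"]) auto
    qed
    also have "\<dots> = (\<Sum>p\<in>Z. \<Sum>q\<in>Z. 1 + 2 * of_bool (p = q))"
      by (simp only: sum.cartesian_product)
    also have "\<dots> = 24"
      using finZ Z(2) e by (simp add: sum_Suc of_bool_def sum_distrib_left[symmetric] sum.delta)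
    finally show thesis using tangent[of 3] e by simp
  qed
qed

text \<open>Unique quotients on one side imply unique quotients on the other side if \<open>K\<close> is trivial.\<close>

lemma inverse_sidon_block:
  assumes K1: "K = {\<one>}"
  shows "sidon_block G (set_inv A) {\<one>}"
proof (intro sidon_block.intro sidon_block_axioms.intro)
  show "fin_group G" by (rule fin_group_axioms)
  show "set_inv A \<subseteq> carrier G" using set_inv_closed A_carrier by simp
  show "\<one> \<in> set_inv A" unfolding set_inv_image using one_A by force
  show "subgroup {\<one>} G" by (rule triv_subgroup)
  show "g <# set_inv A = set_inv A" if "g \<in> {\<one>}" for g
    using that lcos_mult_one[OF set_inv_closed[OF A_carrier]] by simp
  show "3 \<le> card (set_inv A)" using card_A card_set_inv[OF A_carrier] by simp
  then show "set_inv A \<noteq> {\<one>}" by (intro notI) simp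
  fix g assume g: "g \<in> carrier G" "g \<notin> {\<one>}"
  show "card (set_inv A \<inter> (g <# set_inv A)) \<le> 1"
  proof (rule card_le1I)
    fix x y assume "x \<in> set_inv A \<inter> (g <# set_inv A)" "y \<in> set_inv A \<inter> (g <# set_inv A)"
    then obtain a b c d where abcd: "a \<in> A" "b \<in> A" "c \<in> A" "d \<in> A"
      "x = inv a" "x = g \<otimes> inv b" "y = inv c" "y = g \<otimes> inv d"
      by (auto simp: set_inv_image l_coset_image)
    have cc: "a \<in> carrier G" "b \<in> carrier G" "c \<in> carrier G" "d \<in> carrier G" using abcd A_carrier by auto
    have gb: "inv a = g \<otimes> inv b" "inv c = g \<otimes> inv d" using abcd by simp_all
    have "a \<otimes> g = b"
    proof -
      have "a \<otimes> (g \<otimes> inv b) \<otimes> b = b" using gb(1)[symmetric] cc by simp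
      then show ?thesis using cc g by (simp add: m_assoc)
    qed
    moreover have "c \<otimes> g = d"
    proof -
      have "c \<otimes> (g \<otimes> inv d) \<otimes> d = d" using gb(2)[symmetric] cc by simp
      then show ?thesis using cc g by (simp add: m_assoc)
    qed
    ultimately have bd: "b = a \<otimes> g" "d = c \<otimes> g" by simp_all
    let ?t = "c \<otimes> inv a"
    show "x = y"
    proof (cases "?t = \<one>")
      case True
      then have "c \<otimes> inv a \<otimes> a = a" using cc by simp
      then show ?thesis using abcd cc by (simp add: m_assoc)
    next
      case False
      have tc: "?t \<in> carrier G" using cc by simp
      have "?t \<otimes> a = c" "?t \<otimes> b = d" using bd cc g by (simp_all add: m_assoc)
      then have "c \<in> ?t <# A" "d \<in> ?t <# A"
        using abcd(1,2) unfolding l_coset_image by (metis imageI)+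
      then have "c \<in> A \<inter> (?t <# A)" "d \<in> A \<inter> (?t <# A)" using abcd by auto
      then have "c = d" using card_le1D[OF _ A_sidon[OF tc]] finite_A K1 False by blast
      then show ?thesis using bd cc g by simp
    qed
  qed
qed

lemma three_elements:
  assumes c3: "card A = 3"
    and Q: "Q \<subseteq> carrier G" "2 \<le> card Q" "card (A <#> Q) \<le> card Q + 2"
      "card (A <#> Q) + 2 \<le> card (carrier G)"
  obtains H where "subgroup H G" "A \<subseteq> H" "H \<noteq> carrier G"
proof -
  have k1: "card K = 1" using card_K_le card_K_pos c3 by linarith
  then obtain x where "K = {x}" by (rule card_1_singletonE)
  then have K1: "K = {\<one>}" using subgroup.one_closed[OF K_subgroup] by simp
  have Ac: "set_inv A \<subseteq> carrier G" and Qc: "set_inv Q \<subseteq> carrier G"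
    using A_carrier Q set_inv_closed by auto
  have e: "set_inv Q <#> set_inv A = set_inv (A <#> Q)"
    using set_inv_set_mult[OF A_carrier Q(1)] by simp
  have ce: "card (set_inv Q <#> set_inv A) = card (A <#> Q)"
    unfolding e using card_set_inv[OF setmult_subset_G[OF A_carrier Q(1)]] .
  have cs: "card (set_inv A) = 3" "card (set_inv Q) = card Q" using card_set_inv A_carrier Q c3 by auto
  obtain C B where C: "C = set_inv A \<or> C = set_inv (set_inv A)" and B: "B \<subseteq> carrier G" "2 \<le> card B"
      "card (B <#> C) + 2 \<le> card (carrier G)" "card (B <#> C) < card B + card C"
      "\<And>g. g \<in> carrier G \<Longrightarrow> g <# B = B \<or> card (B \<inter> (g <# B)) \<le> 1"
  proof (rule isoperimetric_atom[OF Ac Qc])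
    show "2 \<le> card (set_inv Q)" "card (set_inv Q <#> set_inv A) + 2 \<le> card (carrier G)"
      "card (set_inv Q <#> set_inv A) < card (set_inv Q) + card (set_inv A)"
      using ce cs Q by auto
  qed blast
  have C: "C = set_inv A \<or> C = A" using C set_inv_set_inv[OF A_carrier] by simp
  interpret C: sidon_block G C "{\<one>}"
    using C inverse_sidon_block[OF K1] sidon_block_axioms K1 by auto
  have "card C = 3" using C cs c3 by auto
  then obtain H where H: "subgroup H G" "C \<subseteq> H" "H \<noteq> carrier G"
    using C.three_elements_fragment[OF _ B(1,2) _ B(3) B(5)] B(4) by auto
  have "A \<subseteq> H"
  proof
    fix a assume a: "a \<in> A"
    then have "a \<in> C \<or> inv a \<in> C" using C unfolding set_inv_image by auto
    then show "a \<in> H" using H A_carrier a subgroup.m_inv_closed[OF H(1)] by (metis inv_inv subsetD)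
  qed
  then show thesis using that H by blast
qed

text \<open>If \<open>A\<close> is not contained in a proper subgroup, then, for \<open>card Q \<ge> 2\<close>, a product \<open>A Q\<close> with \<open>card (A Q) \<le> card A + card Q - 1\<close> that omits
  more than \<open>card A\<close> elements occurs at most for \<open>card A = 4\<close> and \<open>card K = 2\<close>.\<close>

lemma small_product:
  assumes gen: "\<And>H. subgroup H G \<Longrightarrow> A \<subseteq> H \<Longrightarrow> H = carrier G"
    and Q: "Q \<subseteq> carrier G" "2 \<le> card Q" "card (A <#> Q) < card A + card Q"
      "card A + card (A <#> Q) < card (carrier G)"
  shows "card A = 4 \<and> card K = 2 \<and> card (A <#> Q) = card Q + 3"
proof -
  let ?P = "A <#> Q"
  have Pc: "?P \<subseteq> carrier G" using setmult_subset_G[OF A_carrier Q(1)] .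
  have co: "card (carrier G - ?P) = card (carrier G) - card ?P"
    using card_Diff_subset[OF finite_sub[OF Pc] Pc] .
  have P2: "card A < card ?P" "card A < card (carrier G - ?P)"
    using card_product_gt[OF Q(1,2)] co Q(4) by auto
  have cut: "int (cut A ?P) \<le> 2 * int (card A) * (int (card A) - int (card K)) * (int (card ?P) - int (card Q))"
    using cut_upper[OF Pc left_stable_product[OF Q(1)] Q(1)] by simp
  have cutle: "int (cut A ?P) \<le> 2 * int (card A) * (int (card A) - int (card K)) * (int (card A) - 1)"
  proof (rule order.trans[OF cut mult_left_mono])
    show "int (card ?P) - int (card Q) \<le> int (card A) - 1" using Q(3) by linarith
    show "0 \<le> 2 * int (card A) * (int (card A) - int (card K))" using card_K_le by simp
  qed
  have exc: "(card A - 1) * (card A - card K) \<le> 2 * card A"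
    using large_cut[OF _ Pc P2 cutle] gen by (metis not_le_imp_less)
  have "card A \<noteq> 3"
  proof
    assume c3: "card A = 3"
    then have "card ?P \<le> card Q + 2" "card ?P + 2 \<le> card (carrier G)" using Q(3,4) by linarith+
    then show False using three_elements[OF c3 Q(1,2)] gen by metis
  qed
  moreover have "card A < 5"
  proof (rule ccontr)
    assume "\<not> ?thesis"
    then have a: "5 \<le> card A" by simp
    show False
    proof (cases "card A = 5")
      case True
      then have "3 \<le> card A - card K" using card_K_le by simp
      then have "4 * 3 \<le> (card A - 1) * (card A - card K)" using True by (intro mult_le_mono) auto
      then show False using exc True by simp
    next
      case False
      have "5 * card A \<le> (card A - 1) * (2 * (card A - card K))"
        using a False card_K_le by (intro mult_le_mono) auto
      then have "5 * card A \<le> 4 * card A" using exc by simp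
      then show False using a by simp
    qed
  qed
  ultimately have a4: "card A = 4" using card_A by linarith
  have k2: "card K = 2"
  proof -
    have "card K \<noteq> 1" using exc a4 by (intro notI) simp
    then show ?thesis using card_K_le card_K_pos a4 by linarith
  qed
  have "\<not> card ?P \<le> card Q + 2"
  proof
    assume "card ?P \<le> card Q + 2"
    then have "cut A ?P \<le> 32" using cut a4 k2 by simp
    moreover have "3 \<le> card ?P" "3 \<le> card (carrier G - ?P)" using P2 a4 by auto
    ultimately show False using cut_exceptional[OF a4 k2 Pc] gen by metis
  qed
  then show ?thesis using a4 k2 Q(3) by simp
qed

text \<open>The form in which the estimates are summed over cosets: either \<open>A Q\<close> has at least \<open>card A + card Q - 1\<close> elements,
  or the number of elements that it omits is bounded by roughly \<open>card (A Q) - card Q\<close>.\<close>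

lemma small_product_dichotomy:
  assumes gen: "\<And>H. subgroup H G \<Longrightarrow> A \<subseteq> H \<Longrightarrow> H = carrier G"
    and Q: "Q \<subseteq> carrier G" "Q \<noteq> {}"
  shows "card A + card Q \<le> card (A <#> Q) + 1 \<or>
    (int (card (carrier G)) - int (card (A <#> Q))) * (int (card A) - 1)
      \<le> int (card A) * (int (card (A <#> Q)) - int (card Q))"
proof -
  let ?P = "A <#> Q" and ?a = "int (card A)" and ?k = "int (card K)"
  have Pc: "?P \<subseteq> carrier G" using setmult_subset_G[OF A_carrier Q(1)] .
  have finQ: "finite Q" using Q finite_sub by blast
  have cQ: "1 \<le> card Q" using Q finQ by (simp add: Suc_leI card_gt_0_iff)
  have aP: "card A \<le> card ?P" using card_le_set_mult[OF cQ A_carrier Q(1)] .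
  consider "card Q = 1" | "2 \<le> card Q" "card A + card ?P < card (carrier G)" | "card (carrier G) \<le> card A + card ?P"
    using cQ by linarith
  then show ?thesis
  proof cases
    case 1 then show ?thesis using aP by simp
  next
    case 2
    then show ?thesis using small_product[OF gen Q(1) 2(1) _ 2(2)] by fastforce
  next
    case 3
    let ?f = "int (card (carrier G)) - int (card ?P)"
    let ?F = "carrier G - ?P"
    have f: "int (card ?F) = ?f"
      using card_Diff_subset[OF finite_sub[OF Pc] Pc] card_mono[OF fin Pc] by simp
    have f0: "0 \<le> ?f" "?f \<le> ?a" using f 3 by auto
    have d: "0 < ?a - ?k" using card_K_le card_K_pos by linarith
    have "2 * ?f * (?a\<^sup>2 - (?a - 1) * ?k - ?f) \<le> int (cut A ?P)"
      using cut_lower[of ?F] cut_compl[OF A_carrier, of ?P] f by simp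
    also have "\<dots> \<le> 2 * ?a * (?a - ?k) * (int (card ?P) - int (card Q))"
      using cut_upper[OF Pc left_stable_product[OF Q(1)] Q(1)] by simp
    finally have 1: "2 * ?f * (?a\<^sup>2 - (?a - 1) * ?k - ?f) \<le> 2 * ?a * (?a - ?k) * (int (card ?P) - int (card Q))" .
    have "2 * ?f * ((?a - 1) * (?a - ?k)) \<le> 2 * ?f * (?a\<^sup>2 - (?a - 1) * ?k - ?f)"
    proof (rule mult_left_mono)
      have "?a\<^sup>2 - (?a - 1) * ?k - ?f = (?a - 1) * (?a - ?k) + (?a - ?f)"
        by (simp add: algebra_simps power2_eq_square)
      then show "(?a - 1) * (?a - ?k) \<le> ?a\<^sup>2 - (?a - 1) * ?k - ?f" using f0 by linarith
    qed (use f0 in simp)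
    then have "(2 * (?a - ?k)) * (?f * (?a - 1)) \<le> (2 * (?a - ?k)) * (?a * (int (card ?P) - int (card Q)))"
      using 1 by (simp add: algebra_simps)
    then have "?f * (?a - 1) \<le> ?a * (int (card ?P) - int (card Q))"
      using d by (simp add: mult_le_cancel_left_pos)
    then show ?thesis by blast
  qed
qed

end

section \<open>Sets contained in a proper subgroup\<close>

context fin_group begin

text \<open>The second alternative of the theorem for \<open>S\<close> itself: \<open>H\<close> is a nontrivial proper subgroup, and
  \<open>card (H S) \<le> card H + card S - 1\<close>.\<close>

definition compressing :: "'a set \<Rightarrow> 'a set \<Rightarrow> bool" where
  "compressing H S \<longleftrightarrow> subgroup H G \<and> H \<noteq> {\<one>} \<and> H \<noteq> carrier G \<and> card (H <#> S) < card H + card S"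

lemma sum_card_rcosets:
  assumes H: "subgroup H G" and X: "X \<subseteq> carrier G"
  shows "(\<Sum>C\<in>rcosets H. card (X \<inter> C)) = card X"
proof -
  have fin': "finite (rcosets H)" using rcosets_part_G[OF H] fin by (metis finite_UnionD)
  have "card (\<Union>C\<in>rcosets H. X \<inter> C) = (\<Sum>C\<in>rcosets H. card (X \<inter> C))"
  proof (rule card_UN_disjoint[OF fin'])
    show "\<forall>C\<in>rcosets H. finite (X \<inter> C)" using X finite_sub by blast
    show "\<forall>C\<in>rcosets H. \<forall>D\<in>rcosets H. C \<noteq> D \<longrightarrow> (X \<inter> C) \<inter> (X \<inter> D) = {}"
      using rcos_disjoint[OF H] unfolding pairwise_def disjnt_def by blast
  qed
  moreover have "(\<Union>C\<in>rcosets H. X \<inter> C) = X" using rcosets_part_G[OF H] X by blast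
  ultimately show ?thesis by simp
qed

lemma rcoset_mult_mem:
  assumes H: "subgroup H G" and C: "C \<in> rcosets H" and hx: "h \<in> H" "x \<in> carrier G"
  shows "h \<otimes> x \<in> C \<longleftrightarrow> x \<in> C"
proof -
  obtain y where y: "y \<in> carrier G" "C = H #> y" using C by (auto simp: RCOSETS_def)
  have Hc: "H \<subseteq> carrier G" using H subgroup.subset by blast
  have hc: "h \<in> carrier G" using hx Hc by auto
  have "h \<otimes> x \<in> C \<longleftrightarrow> h \<otimes> (x \<otimes> inv y) \<in> H"
    using r_coset_mem[OF Hc y(1), of "h \<otimes> x"] y hc hx by (simp add: m_assoc)
  also have "\<dots> \<longleftrightarrow> x \<otimes> inv y \<in> H"
  proof
    assume "h \<otimes> (x \<otimes> inv y) \<in> H"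
    then have "inv h \<otimes> (h \<otimes> (x \<otimes> inv y)) \<in> H"
      by (rule subgroup.m_closed[OF H subgroup.m_inv_closed[OF H hx(1)]])
    then show "x \<otimes> inv y \<in> H" using hc hx y by simp
  next
    assume "x \<otimes> inv y \<in> H"
    then show "h \<otimes> (x \<otimes> inv y) \<in> H" by (rule subgroup.m_closed[OF H hx(1)])
  qed
  also have "\<dots> \<longleftrightarrow> x \<in> C" using r_coset_mem[OF Hc y(1) hx(2)] y by simp
  finally show ?thesis .
qed

lemma product_Int_rcoset:
  assumes H: "subgroup H G" and C: "C \<in> rcosets H" and A: "A \<subseteq> H" and S: "S \<subseteq> carrier G"
  shows "(A <#> S) \<inter> C = A <#> (S \<inter> C)"
proof -
  have "a \<otimes> s \<in> C \<longleftrightarrow> s \<in> C" if "a \<in> A" "s \<in> S" for a s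
    using rcoset_mult_mem[OF H C, of a s] that A S by auto
  then show ?thesis unfolding set_mult_def by blast
qed

lemma set_mult_r_coset:
  assumes "A \<subseteq> carrier G" "Q \<subseteq> carrier G" "y \<in> carrier G"
  shows "A <#> (Q #> y) = (A <#> Q) #> y"
  using setmult_rcos_assoc[OF assms] by simp

end

context sidon_block begin

lemma restricts_to_subgroup:
  assumes H: "subgroup H G" "A \<subseteq> H"
  shows "sidon_block (G\<lparr>carrier := H\<rparr>) A K"
proof (intro sidon_block.intro sidon_block_axioms.intro fin_group.intro fin_group_axioms.intro)
  have Hc: "H \<subseteq> carrier G" using H subgroup.subset by blast
  show "group (G\<lparr>carrier := H\<rparr>)" using subgroup.subgroup_is_group[OF H(1)] is_group by blast
  show "finite (carrier (G\<lparr>carrier := H\<rparr>))" using finite_sub[OF Hc] by simp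
  show "subgroup K (G\<lparr>carrier := H\<rparr>)" using subgroup_incl[OF K_subgroup H(1)] K_subset_A H by blast
  show "g <#\<^bsub>G\<lparr>carrier := H\<rparr>\<^esub> A = A" if "g \<in> K" for g using A_stable[OF that] by simp
  show "card (A \<inter> (g <#\<^bsub>G\<lparr>carrier := H\<rparr>\<^esub> A)) \<le> 1" if "g \<in> carrier (G\<lparr>carrier := H\<rparr>)" "g \<notin> K" for g
    using A_sidon[of g] that Hc by auto
qed (use H one_A A_neq_K card_A in auto)

text \<open>Let \<open>H\<close> be a minimal subgroup that contains \<open>A\<close>, and let \<open>C\<close> run over the right cosets of \<open>H\<close> that
  meet \<open>S\<close>. The growths \<open>card (A S \<inter> C) - card (S \<inter> C)\<close> add up to at most \<open>card A - 1\<close>. If one coset accounts for all of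
  this, then \<open>S\<close> contains all the other cosets \<open>C\<close>. Otherwise the dichotomy shows that \<open>A S\<close> omits at most \<open>card A\<close>
  elements of \<open>H S\<close>, and \<open>2 * card A \<le> card H\<close>.\<close>

theorem compressing_of_proper:
  assumes H0: "subgroup H0 G" "A \<subseteq> H0" "H0 \<noteq> carrier G"
    and S: "S \<subseteq> carrier G" "card (A <#> S) < card A + card S"
  shows "\<exists>H. compressing H S"
proof -
  obtain H where H: "subgroup H G" "A \<subseteq> H"
    and Hmin: "\<And>L. subgroup L G \<Longrightarrow> A \<subseteq> L \<Longrightarrow> card H \<le> card L"
    using ex_has_least_nat[of "\<lambda>H. subgroup H G \<and> A \<subseteq> H" H0 card] H0 by blast
  have Hc: "H \<subseteq> carrier G" using H subgroup.subset by blast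
  have finH: "finite H" using Hc finite_sub by blast
  have Hne: "H \<noteq> carrier G"
  proof
    assume "H = carrier G"
    then have "card (carrier G) \<le> card H0" using Hmin[OF H0(1,2)] by simp
    then have "H0 = carrier G" using card_seteq[OF fin subgroup.subset[OF H0(1)]] by simp
    then show False using H0 by simp
  qed
  have H1: "H \<noteq> {\<one>}"
  proof
    assume "H = {\<one>}"
    then have "card A \<le> 1" using card_mono[OF finH H(2)] by simp
    then show False using card_A by simp
  qed
  interpret GH: sidon_block "G\<lparr>carrier := H\<rparr>" A K using restricts_to_subgroup[OF H] .
  have gen: "L = carrier (G\<lparr>carrier := H\<rparr>)" if "subgroup L (G\<lparr>carrier := H\<rparr>)" "A \<subseteq> L" for L
  proof -
    have L: "subgroup L G" using incl_subgroup[OF H(1) that(1)] .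
    have "L \<subseteq> H" using subgroup.subset[OF that(1)] by simp
    then show ?thesis using card_seteq[OF finH _ Hmin[OF L that(2)]] by simp
  qed
  let ?a = "int (card A)" and ?h = "int (card H)" and ?P = "A <#> S"
  let ?s = "\<lambda>C. int (card (S \<inter> C))" and ?p = "\<lambda>C. int (card (?P \<inter> C))"
  let ?J = "{C \<in> rcosets H. S \<inter> C \<noteq> {}}"
  have Pc: "?P \<subseteq> carrier G" using setmult_subset_G[OF A_carrier S(1)] .
  have HSc: "H <#> S \<subseteq> carrier G" using setmult_subset_G[OF Hc S(1)] .
  have finR: "finite (rcosets H)" using rcosets_part_G[OF H(1)] fin by (metis finite_UnionD)
  have a3: "3 \<le> ?a" using card_A by simp
  have dich: "?a + ?s C \<le> ?p C + 1 \<or> (?h - ?p C) * (?a - 1) \<le> ?a * (?p C - ?s C)" if C: "C \<in> ?J" for C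
  proof -
    obtain y where y: "y \<in> carrier G" "C = H #> y" using C by (auto simp: RCOSETS_def)
    let ?Q = "(S \<inter> C) #> inv y"
    have SC: "S \<inter> C \<subseteq> carrier G" using S by auto
    have Q: "?Q \<subseteq> H"
    proof
      fix x assume "x \<in> ?Q"
      then obtain z where z: "z \<in> S \<inter> C" "x = z \<otimes> inv y" by (auto simp: r_coset_image)
      then show "x \<in> H" using r_coset_mem[OF Hc y(1), of z] y S by auto
    qed
    have Qne: "?Q \<noteq> {}" using C by (auto simp: r_coset_image)
    have cQ: "card ?Q = card (S \<inter> C)" using card_r_coset[OF SC] y by simp
    have "A <#> ?Q = (?P \<inter> C) #> inv y"
      using set_mult_r_coset[OF A_carrier SC, of "inv y"] product_Int_rcoset[OF H(1) _ H(2) S(1), of C] C y by simp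
    then have cAQ: "card (A <#> ?Q) = card (?P \<inter> C)"
      using card_r_coset[of "?P \<inter> C" "inv y"] Pc y by (simp add: le_infI1)
    have "card A + card ?Q \<le> card (A <#>\<^bsub>G\<lparr>carrier := H\<rparr>\<^esub> ?Q) + 1 \<or>
      (int (card (carrier (G\<lparr>carrier := H\<rparr>))) - int (card (A <#>\<^bsub>G\<lparr>carrier := H\<rparr>\<^esub> ?Q))) * (int (card A) - 1)
      \<le> int (card A) * (int (card (A <#>\<^bsub>G\<lparr>carrier := H\<rparr>\<^esub> ?Q)) - int (card ?Q))"
      by (rule GH.small_product_dichotomy[OF gen _ Qne]) (use Q in auto)
    then show ?thesis using cQ cAQ by auto
  qed
  have sp: "?s C \<le> ?p C" for C
  proof -
    have "S \<inter> C \<subseteq> ?P \<inter> C" using one_A S(1) by (force simp: set_mult_def)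
    then show ?thesis using card_mono finite_sub Pc by (metis finite_Int of_nat_mono)
  qed
  have ph: "?p C \<le> ?h" if "C \<in> rcosets H" for C
  proof -
    have "card C = card H" using that card_r_coset[OF Hc] by (auto simp: RCOSETS_def)
    moreover have "finite C" using that rcosets_part_G[OF H(1)] fin finite_sub by blast
    ultimately show ?thesis using card_mono[of C "?P \<inter> C"] by auto
  qed
  have HSC: "card ((H <#> S) \<inter> C) = (if S \<inter> C \<noteq> {} then card H else 0)" if C: "C \<in> rcosets H" for C
  proof (cases "S \<inter> C = {}")
    case True
    then show ?thesis using product_Int_rcoset[OF H(1) C order.refl S(1)] by (simp add: set_mult_def)
  next
    case False
    then obtain x where x: "x \<in> S" "x \<in> C" by blast
    have xc: "x \<in> carrier G" using x S by auto
    have Cx: "C = H #> x" using C x repr_independence[OF _ _ H(1)] by (auto simp: RCOSETS_def)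
    have "C \<subseteq> H <#> S" unfolding Cx using x by (auto simp: r_coset_image set_mult_def)
    then have "(H <#> S) \<inter> C = C" by blast
    then show ?thesis using False Cx card_r_coset[OF Hc xc] by simp
  qed
  have tS: "(\<Sum>C\<in>rcosets H. ?s C) = int (card S)"
    using arg_cong[OF sum_card_rcosets[OF H(1) S(1)], of int] by simp
  have tP: "(\<Sum>C\<in>rcosets H. ?p C) = int (card ?P)"
    using arg_cong[OF sum_card_rcosets[OF H(1) Pc], of int] by simp
  have "card (H <#> S) = (\<Sum>C\<in>rcosets H. if S \<inter> C \<noteq> {} then card H else 0)"
    using sum_card_rcosets[OF H(1) HSc] HSC by (simp cong: sum.cong)
  also have "\<dots> = (\<Sum>C\<in>?J. card H)" by (rule sum.inter_filter[OF finR, symmetric])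
  finally have tHS: "int (card (H <#> S)) = (\<Sum>C\<in>?J. ?h)" by simp
  have finJ: "finite ?J" using finR by simp
  have sJ: "(\<Sum>C\<in>?J. ?s C) = int (card S)"
    unfolding tS[symmetric] using finR by (intro sum.mono_neutral_left) auto
  have pJ: "(\<Sum>C\<in>?J. ?p C) = int (card ?P)"
    unfolding tP[symmetric] using finR product_Int_rcoset[OF H(1) _ H(2) S(1)]
    by (intro sum.mono_neutral_left) (auto simp: set_mult_def)
  have lt: "(\<Sum>C\<in>?J. ?p C - ?s C) \<le> ?a - 1"
    using S(2) sJ pJ by (simp add: sum_subtractf)
  have "card (H <#> S) < card H + card S"
  proof (cases "\<exists>C0\<in>?J. ?a + ?s C0 \<le> ?p C0 + 1")
    case True
    then obtain C0 where C0: "C0 \<in> ?J" "?a + ?s C0 \<le> ?p C0 + 1" by blast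
    have full: "?s C = ?h" if C: "C \<in> ?J" "C \<noteq> C0" for C
    proof -
      have "(\<Sum>D\<in>{C0, C}. ?p D - ?s D) \<le> (\<Sum>D\<in>?J. ?p D - ?s D)"
        using C C0 finJ sp by (intro sum_mono2) auto
      then have e: "?p C = ?s C" using lt C0 C sp[of C] by auto
      then have "(?h - ?p C) * (?a - 1) \<le> 0" using dich[OF C(1)] a3 by auto
      then have "?h \<le> ?p C" using a3 by (simp add: mult_le_0_iff)
      then show ?thesis using ph[of C] C e by auto
    qed
    have "int (card (H <#> S)) = ?h + (\<Sum>C\<in>?J - {C0}. ?h)"
      unfolding tHS by (rule sum.remove[OF finJ C0(1)])
    also have "(\<Sum>C\<in>?J - {C0}. ?h) = (\<Sum>C\<in>?J - {C0}. ?s C)"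
      using full by (intro sum.cong) auto
    also have "\<dots> = int (card S) - ?s C0"
      unfolding sJ[symmetric] using sum.remove[OF finJ C0(1), of ?s] by simp
    finally have "int (card (H <#> S)) = ?h + int (card S) - ?s C0" by simp
    moreover have "0 < ?s C0" using C0 S finite_sub by (auto simp: card_gt_0_iff)
    ultimately show ?thesis by linarith
  next
    case False
    then have "(?h - ?p C) * (?a - 1) \<le> ?a * (?p C - ?s C)" if "C \<in> ?J" for C
      using dich[OF that] that by blast
    then have "(\<Sum>C\<in>?J. (?h - ?p C) * (?a - 1)) \<le> (\<Sum>C\<in>?J. ?a * (?p C - ?s C))"
      by (rule sum_mono)
    then have "(\<Sum>C\<in>?J. ?h - ?p C) * (?a - 1) \<le> ?a * (\<Sum>C\<in>?J. ?p C - ?s C)"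
      by (simp only: sum_distrib_left sum_distrib_right)
    also have "\<dots> \<le> ?a * (?a - 1)" using lt by (intro mult_left_mono) auto
    finally have "(\<Sum>C\<in>?J. ?h - ?p C) \<le> ?a" using a3 by (simp add: mult_le_cancel_right)
    then have "int (card (H <#> S)) \<le> int (card ?P) + ?a" using tHS pJ by (simp only: sum_subtractf)
    moreover have "2 * ?a \<le> ?h"
    proof -
      have lo: "int (card K) + ?a * (?a - int (card K)) \<le> ?h" using GH.card_carrier_lower by simp
      have k: "1 \<le> int (card K)" "2 * int (card K) \<le> ?a" using card_K_pos card_K_le by linarith+
      show ?thesis
      proof (cases "?a = 3")
        case True
        then have "int (card K) = 1" using k by linarith
        then show ?thesis using lo True by simp
      next
        case False
        then have "2 \<le> ?a - int (card K)" using a3 k by linarith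
        then have "?a * 2 \<le> ?a * (?a - int (card K))" using a3 by (intro mult_left_mono) auto
        then show ?thesis using lo k by linarith
      qed
    qed
    ultimately show ?thesis using S(2) by linarith
  qed
  then show ?thesis unfolding compressing_def using H H1 Hne by blast
qed

end

section \<open>Two-element atoms\<close>

context fin_group begin

text \<open>At most one element \<open>e\<close> of \<open>S\<close> has \<open>a e \<notin> S\<close>, so \<open>S\<close> is stable under \<open>a\<close> except in the coset \<open>H e\<close> of the subgroup \<open>H\<close> generated
  by \<open>a\<close>. If \<open>H\<close> is the whole group, then \<open>S\<close> consists of \<open>e\<close> and its successive multiples by the inverse of \<open>a\<close>.\<close>

theorem two_element_case:
  assumes a: "a \<in> carrier G" "a \<noteq> \<one>" and S: "S \<subseteq> carrier G" "S \<noteq> {}"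
    and small: "card ({\<one>, a} <#> S) \<le> card S + 1" "card ({\<one>, a} <#> S) < card (carrier G)"
  shows "geometric_progression G S \<or> (\<exists>H. compressing H S)"
proof -
  have finS: "finite S" using S finite_sub by blast
  define b where "b = inv a"
  have b: "b \<in> carrier G" "inv b = a" unfolding b_def using a by auto
  define H where "H = generate G {a}"
  have ordpos: "ord x \<noteq> 0" if "x \<in> carrier G" for x using ord_ge_1[OF fin that] by simp
  have Hpow: "H = {a [^] k | k. k \<in> (UNIV :: nat set)}"
    unfolding H_def using generate_pow_nat[OF a(1) ordpos[OF a(1)]] .
  have H: "subgroup H G" unfolding H_def using generate_is_subgroup a(1) by simp
  have Hc: "H \<subseteq> carrier G" using H subgroup.subset by blast
  have aH: "a \<in> H" unfolding H_def by (auto intro: generate.incl)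
  have H1: "H \<noteq> {\<one>}" using aH a by auto
  let ?P = "{\<one>, a} <#> S"
  have Pc: "?P \<subseteq> carrier G" using setmult_subset_G a S by auto
  have P: "?P = S \<union> (\<lambda>s. a \<otimes> s) ` S" using S(1) unfolding set_mult_def by force
  define E where "E = {s \<in> S. a \<otimes> s \<notin> S}"
  have "card E \<le> 1"
  proof -
    have "card (S \<union> (\<lambda>s. a \<otimes> s) ` E) \<le> card ?P"
      unfolding P E_def using finS by (intro card_mono) auto
    moreover have "card (S \<union> (\<lambda>s. a \<otimes> s) ` E) = card S + card ((\<lambda>s. a \<otimes> s) ` E)"
      using finS by (intro card_Un_disjoint) (auto simp: E_def)
    moreover have "card ((\<lambda>s. a \<otimes> s) ` E) = card E"
      using S a by (intro card_image inj_onI) (auto simp: E_def subset_iff)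
    ultimately show ?thesis using small by simp
  qed
  have next_mem: "a \<otimes> s \<in> S" if "s \<in> S" "s \<notin> E" for s using that by (auto simp: E_def)
  have finE: "finite E" using finS by (auto simp: E_def)
  have pows: "a [^] (Suc k) \<otimes> s = a \<otimes> (a [^] k \<otimes> s)" if "s \<in> carrier G" for k s
    using that a nat_pow_Suc2[OF a(1)] by (simp add: m_assoc)
  show ?thesis
  proof (cases "E = {}")
    case True
    have mem: "a [^] (k::nat) \<otimes> s \<in> S" if s: "s \<in> S" for k s
    proof (induction k)
      case 0 then show ?case using s S by auto
    next
      case (Suc k) then show ?case using pows[of s k] s S True next_mem[of "a [^] k \<otimes> s"] by auto
    qed
    then have "H <#> S \<subseteq> S" unfolding Hpow set_mult_def by blast
    then have le: "card (H <#> S) \<le> card S" using card_mono finS by blast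
    have "H \<noteq> carrier G"
    proof
      assume "H = carrier G"
      obtain s where s: "s \<in> S" using S by auto
      have sc: "s \<in> carrier G" using s S by auto
      have "carrier G \<subseteq> S"
      proof
        fix g assume g: "g \<in> carrier G"
        then have "g \<otimes> inv s \<in> H" using \<open>H = carrier G\<close> sc by simp
        then have "g \<otimes> inv s \<otimes> s \<in> S" using mem s unfolding Hpow by auto
        then show "g \<in> S" using g sc by (simp add: m_assoc)
      qed
      then have "carrier G \<subseteq> ?P" unfolding P by blast
      then show False using small(2) card_mono[OF finite_sub[OF Pc]] by (simp add: leD)
    qed
    moreover have "0 < card H" using aH Hc finite_sub by (auto simp: card_gt_0_iff)
    ultimately show ?thesis unfolding compressing_def using H H1 le by auto
  next
    case False
    then obtain e where e: "e \<in> E" by blast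
    then have Ee: "\<And>s. s \<in> E \<Longrightarrow> s = e" using card_le1D[OF finE \<open>card E \<le> 1\<close>] by blast
    have eS: "e \<in> S" "a \<otimes> e \<notin> S" using e by (auto simp: E_def)
    have ec: "e \<in> carrier G" using eS S by auto
    show ?thesis
    proof (cases "H = carrier G")
      case False
      have cHe: "card (H #> e) = card H" "e \<in> H #> e" "H #> e \<subseteq> carrier G"
        using card_r_coset[OF Hc ec] rcos_self[OF ec H] r_coset_subset_G[OF Hc ec] by auto
      have mem: "a [^] (k::nat) \<otimes> s \<in> S \<union> (H #> e)" if s: "s \<in> S" for k s
      proof (induction k)
        case 0 then show ?case using s S by auto
      next
        case (Suc k)
        have sc: "s \<in> carrier G" using s S by auto
        have c: "a [^] k \<otimes> s \<in> carrier G" using sc a by simp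
        have cl: "a \<otimes> z \<in> H #> e" if z: "z \<in> H #> e" for z
        proof -
          obtain h where h: "h \<in> H" "z = h \<otimes> e" using z by (auto simp: r_coset_image)
          then have "a \<otimes> z = a \<otimes> h \<otimes> e" using a Hc ec by (simp add: m_assoc subset_iff)
          then show ?thesis using subgroup.m_closed[OF H aH h(1)] by (auto simp: r_coset_image)
        qed
        consider "a [^] k \<otimes> s \<in> H #> e" | "a [^] k \<otimes> s \<in> S" "a [^] k \<otimes> s \<notin> E"
          using Suc Ee cHe by blast
        then show ?case using pows[OF sc] cl next_mem by cases auto
      qed
      have "H <#> S \<subseteq> S \<union> ((H #> e) - {e})"
      proof
        fix z assume "z \<in> H <#> S"
        then obtain k s where "s \<in> S" "z = a [^] (k::nat) \<otimes> s" unfolding Hpow set_mult_def by blast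
        then show "z \<in> S \<union> ((H #> e) - {e})" using mem eS by auto
      qed
      then have "card (H <#> S) \<le> card (S \<union> ((H #> e) - {e}))"
        using finS cHe finite_sub by (intro card_mono) auto
      also have "\<dots> \<le> card S + card ((H #> e) - {e})" by (rule card_Un_le)
      also have "card ((H #> e) - {e}) = card H - 1" using cHe finite_sub by simp
      finally have "card (H <#> S) \<le> card S + (card H - 1)" .
      moreover have "0 < card H" using aH Hc finite_sub by (auto simp: card_gt_0_iff)
      ultimately show ?thesis unfolding compressing_def using H H1 False by auto
    next
      case True
      let ?T = "S #> inv e"
      have Tc: "?T \<subseteq> carrier G" using S ec by (simp add: r_coset_subset_G)
      have Tm: "z \<in> ?T \<longleftrightarrow> z \<otimes> e \<in> S" if "z \<in> carrier G" for z
        using r_coset_mem[OF S(1), of "inv e" z] that ec by simp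
      have shift_mem: "a \<otimes> z \<in> ?T" if z: "z \<in> ?T" "z \<noteq> \<one>" for z
      proof -
        have zc: "z \<in> carrier G" using z Tc by auto
        have "z \<otimes> e \<in> S" using Tm[OF zc] z by simp
        moreover have "z \<otimes> e \<noteq> e" using zc ec z by simp
        ultimately have "a \<otimes> (z \<otimes> e) \<in> S" using next_mem Ee by blast
        then show ?thesis using Tm[of "a \<otimes> z"] a zc ec by (simp add: m_assoc)
      qed
      define I where "I = {i. i < ord b \<and> b [^] i \<in> ?T}"
      have finI: "finite I" unfolding I_def by simp
      have "I = {..<card I}"
      proof (rule nat_downset[OF finI])
        fix i assume i: "Suc i \<in> I"
        have "\<not> ord b dvd Suc i" using i by (auto simp: I_def dest: dvd_imp_le)
        then have "b [^] Suc i \<noteq> \<one>" using pow_eq_id[OF b(1)] by blast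
        then have "a \<otimes> b [^] Suc i \<in> ?T" using shift_mem i by (simp add: I_def)
        moreover have "a \<otimes> b [^] Suc i = b [^] i"
          unfolding nat_pow_Suc2[OF b(1)] using b a by (simp add: b_def)
        ultimately show "i \<in> I" using i by (simp add: I_def)
      qed
      moreover have T: "?T = (\<lambda>i. b [^] i) ` I"
      proof
        show "(\<lambda>i. b [^] i) ` I \<subseteq> ?T" by (auto simp: I_def)
        show "?T \<subseteq> (\<lambda>i. b [^] i) ` I"
        proof
          fix z assume z: "z \<in> ?T"
          then have "inv z \<in> H" using Tc True by auto
          then obtain k :: nat where "inv z = a [^] k" unfolding Hpow by blast
          then have "z = b [^] k" using z Tc a nat_pow_inv[OF a(1)] unfolding b_def by (metis inv_inv subsetD)
          also have "\<dots> \<in> {b [^] x | x. x \<in> {0..ord b - 1}}"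
            using ord_elems_inf_carrier[OF b(1) ordpos[OF b(1)]] by blast
          finally obtain i where "z = b [^] i" "i \<le> ord b - 1" by auto
          moreover from this have "i < ord b" using ordpos[OF b(1)] by simp
          ultimately show "z \<in> (\<lambda>i. b [^] i) ` I" using z by (auto simp: I_def)
        qed
      qed
      moreover have "card I = card S"
      proof -
        have "inj_on (\<lambda>i. b [^] i) I"
          by (rule inj_on_subset[OF ord_inj[OF b(1)]]) (auto simp: I_def)
        then have "card ?T = card I" unfolding T by (rule card_image)
        then show ?thesis using card_r_coset[OF S(1)] ec by simp
      qed
      ultimately have "?T = {b [^] i | i::nat. i < card S}" by auto
      then have "geometric_progression G S"
        unfolding geometric_progression_def using b ec by blast
      then show ?thesis ..
    qed
  qed
qed

end

section \<open>Words in an involution and another element\<close>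

context group begin

text \<open>If a product of three elements of the double coset \<open>K x K\<close>, where \<open>K = {1, k}\<close>, is trivial and \<open>k\<close> does not commute with \<open>x\<close>, then
  \<open>x\<close> or \<open>k x\<close> has order dividing three.\<close>

lemma involution_word:
  assumes c: "k \<in> carrier G" "x \<in> carrier G" and kk: "k \<otimes> k = \<one>"
    and p: "p \<in> {\<one>, k}" "q \<in> {\<one>, k}" "r \<in> {\<one>, k}"
    and comm: "x \<otimes> k \<noteq> k \<otimes> x"
    and eq: "p \<otimes> (x \<otimes> (q \<otimes> (x \<otimes> (r \<otimes> x)))) = \<one>"
  shows "x \<otimes> (x \<otimes> x) = \<one> \<or> (k \<otimes> x) \<otimes> ((k \<otimes> x) \<otimes> (k \<otimes> x)) = \<one>"
proof -
  have k1: "k \<otimes> (k \<otimes> z) = z" if "z \<in> carrier G" for z using kk c that by (simp add: m_assoc[symmetric])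
  have one: False if "k \<otimes> (x \<otimes> (x \<otimes> x)) = \<one>"
  proof -
    have "k \<otimes> (k \<otimes> (x \<otimes> (x \<otimes> x))) = k" using that c by simp
    then have e: "x \<otimes> (x \<otimes> x) = k" using k1 c by simp
    have "x \<otimes> (x \<otimes> (x \<otimes> x)) = x \<otimes> (x \<otimes> x) \<otimes> x" using c by (simp add: m_assoc)
    then show False using e comm by simp
  qed
  have two: "x \<otimes> (x \<otimes> x) = \<one>" if t: "k \<otimes> (x \<otimes> (k \<otimes> (x \<otimes> x))) = \<one>"
  proof -
    let ?x' = "k \<otimes> (x \<otimes> k)"
    have 1: "?x' \<otimes> (x \<otimes> x) = \<one>" using t c by (simp add: m_assoc)
    then have i: "x \<otimes> x = inv ?x'" using c by (metis inv_equality inv_inv m_closed)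
    have "k \<otimes> (?x' \<otimes> (x \<otimes> x)) \<otimes> k = \<one>" using 1 c kk by simp
    then have "x \<otimes> (?x' \<otimes> ?x') = \<one>" using c k1 by (simp add: m_assoc)
    then have "x = inv (?x' \<otimes> ?x')" using c by (metis inv_equality m_closed)
    also have "\<dots> = (x \<otimes> x) \<otimes> (x \<otimes> x)" unfolding i using c by (simp add: inv_mult_group)
    finally have "x \<otimes> \<one> = x \<otimes> (x \<otimes> (x \<otimes> x))" using c by (simp add: m_assoc)
    then show ?thesis using c by (metis Units_eq Units_l_cancel m_closed one_closed)
  qed
  have rot: "w \<otimes> z = \<one> \<Longrightarrow> w \<in> carrier G \<Longrightarrow> z \<in> carrier G \<Longrightarrow> z \<otimes> w = \<one>" for w z
    by (rule inv_comm)
  consider "p = \<one>" "q = \<one>" "r = \<one>" | "p = k" "q = k" "r = k"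
    | "p = k" "q = \<one>" "r = \<one>" | "p = \<one>" "q = k" "r = \<one>" | "p = \<one>" "q = \<one>" "r = k"
    | "p = k" "q = k" "r = \<one>" | "p = \<one>" "q = k" "r = k" | "p = k" "q = \<one>" "r = k"
    using p by blast
  then show ?thesis
  proof cases
    case 1 then show ?thesis using eq c by simp
  next
    case 2 then show ?thesis using eq c by (simp add: m_assoc)
  next
    case 3 then show ?thesis using eq c one by simp
  next
    case 4 then show ?thesis using eq c one rot[of x "k \<otimes> (x \<otimes> x)"] by (simp add: m_assoc)
  next
    case 5 then show ?thesis using eq c one rot[of "x \<otimes> x" "k \<otimes> x"] by (simp add: m_assoc)
  next
    case 6 then show ?thesis using eq c two by simp
  next
    case 7 then show ?thesis using eq c two rot[of x "k \<otimes> (x \<otimes> (k \<otimes> x))"] by (simp add: m_assoc)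
  next
    case 8 then show ?thesis using eq c two rot[of "k \<otimes> (x \<otimes> x)" "k \<otimes> x"] by (simp add: m_assoc)
  qed
qed

text \<open>If the inverse of \<open>x\<close> is neither \<open>x\<close> nor \<open>k x k\<close>, and \<open>x\<close> is not in \<open>K = {1, k}\<close>, then the double coset \<open>K x K\<close>
  contains no product of two of its elements.\<close>

lemma double_coset_sumfree:
  assumes c: "k \<in> carrier G" "x \<in> carrier G" and kk: "k \<otimes> k = \<one>"
    and p: "p \<in> {\<one>, k}" "q \<in> {\<one>, k}" "r \<in> {\<one>, k}"
    and x: "x \<noteq> \<one>" "x \<noteq> k" "inv x \<noteq> x" "inv x \<noteq> k \<otimes> (x \<otimes> k)"
    and eq: "x \<otimes> (p \<otimes> x) = q \<otimes> (x \<otimes> r)"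
  shows False
proof -
  have k1: "k \<otimes> (k \<otimes> z) = z" if "z \<in> carrier G" for z using kk c that by (simp add: m_assoc[symmetric])
  have ik: "inv k = k" using kk c by (metis inv_equality)
  have lc: "u \<otimes> v = u \<otimes> w \<Longrightarrow> u \<in> carrier G \<Longrightarrow> v \<in> carrier G \<Longrightarrow> w \<in> carrier G \<Longrightarrow> v = w" for u v w
    by (metis Units_eq Units_l_cancel)
  have cube: "y \<otimes> y = inv y" if y: "y \<in> carrier G" "y \<otimes> y = k \<otimes> (y \<otimes> k)" for y
  proof -
    have "k \<otimes> (y \<otimes> y) \<otimes> k = (k \<otimes> (y \<otimes> k)) \<otimes> (k \<otimes> (y \<otimes> k))" using c y(1) k1 by (simp add: m_assoc)
    also have "\<dots> = (y \<otimes> y) \<otimes> (y \<otimes> y)" using y(2) by simp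
    finally have "k \<otimes> (k \<otimes> (y \<otimes> k)) \<otimes> k = (y \<otimes> y) \<otimes> (y \<otimes> y)" using y(2) by simp
    then have "y \<otimes> \<one> = y \<otimes> (y \<otimes> y \<otimes> y)" using c y(1) k1 kk by (simp add: m_assoc)
    then have "\<one> = y \<otimes> y \<otimes> y" using lc y(1) by (metis m_closed one_closed)
    then show ?thesis using y(1) by (metis inv_equality m_closed inv_inv)
  qed
  consider "p = \<one>" "q = \<one>" "r = \<one>" | "p = \<one>" "q = k" "r = \<one>" | "p = \<one>" "q = \<one>" "r = k" | "p = \<one>" "q = k" "r = k"
    | "p = k" "q = \<one>" "r = \<one>" | "p = k" "q = k" "r = \<one>" | "p = k" "q = \<one>" "r = k" | "p = k" "q = k" "r = k"
    using p by blast
  then show False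
  proof cases
    case 1 then show ?thesis using eq c x by simp
  next
    case 2 then show ?thesis using eq c x by simp
  next
    case 3 then show ?thesis using eq c x lc[of x x k] by simp
  next
    case 4 then show ?thesis using eq c x cube[of x] by simp
  next
    case 5
    then have "k \<otimes> x = \<one>" using eq c lc[of x "k \<otimes> x" \<one>] by simp
    then have "x = k" using k1[of x] c by simp
    then show ?thesis using x by simp
  next
    case 6
    then have "x \<otimes> k \<otimes> x = k \<otimes> x" using eq c by (simp add: m_assoc)
    then have "x \<otimes> k = k" using c by simp
    then show ?thesis using c x by simp
  next
    case 7
    then have "k \<otimes> x = k" using eq c lc[of x "k \<otimes> x" k] by simp
    then show ?thesis using c x by simp
  next
    case 8
    let ?y = "x \<otimes> k"
    have e: "x \<otimes> (k \<otimes> x) = k \<otimes> (x \<otimes> k)" using eq 8 by simp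
    have "?y \<otimes> ?y = (x \<otimes> (k \<otimes> x)) \<otimes> k" using c by (simp add: m_assoc)
    also have "\<dots> = k \<otimes> x" unfolding e using c kk by (simp add: m_assoc)
    finally have yy: "?y \<otimes> ?y = k \<otimes> x" .
    then have "?y \<otimes> ?y = k \<otimes> (?y \<otimes> k)" using c kk by (simp add: m_assoc)
    then have "?y \<otimes> ?y = inv ?y" using cube c by simp
    then have "k \<otimes> x = k \<otimes> inv x" using yy c ik by (simp add: inv_mult_group)
    then have "x = inv x" using lc[of k x "inv x"] c by simp
    then show ?thesis using x by simp
  qed
qed

end

section \<open>Atoms with four elements and stabilizer of order two\<close>

context fin_group begin

lemma cut_pair:
  assumes c: "c \<in> carrier G" "c \<noteq> \<one>" "c \<otimes> c = \<one>" and U: "U \<subseteq> carrier G"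
  shows "cut {\<one>, c} U = 4 * card {u \<in> U. c \<otimes> u \<notin> U}"
proof -
  let ?B = "{u \<in> U. c \<otimes> u \<notin> U}" and ?C = "{h \<in> carrier G. h \<notin> U \<and> c \<otimes> h \<in> U}"
  have cc: "c \<otimes> (c \<otimes> z) = z" if "z \<in> carrier G" for z using c that by (simp add: m_assoc[symmetric])
  have finU: "finite U" using U finite_sub by blast
  have "bij_betw (\<lambda>u. c \<otimes> u) ?B ?C"
    by (rule bij_betwI[where g = "\<lambda>u. c \<otimes> u"]) (use c U cc in \<open>auto simp: subset_iff\<close>)
  then have BC: "card ?B = card ?C" by (rule bij_betw_same_card)
  have "cut {\<one>, c} U = (\<Sum>h\<in>carrier G. 2 * of_bool (h \<in> ?B \<union> ?C))"
    unfolding cut_def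
  proof (rule sum.cong[OF refl])
    fix h assume h: "h \<in> carrier G"
    show "(\<Sum>a\<in>{\<one>, c}. \<Sum>b\<in>{\<one>, c}. of_bool ((a \<otimes> h \<in> U) \<noteq> (b \<otimes> h \<in> U))) = (2 * of_bool (h \<in> ?B \<union> ?C) :: nat)"
      using c(2) h by auto
  qed
  also have "\<dots> = 2 * card (?B \<union> ?C)"
  proof -
    have "?B \<union> ?C \<subseteq> carrier G" using U by auto
    then show ?thesis unfolding sum_distrib_left[symmetric] by (simp only: sum_of_bool_mem[OF fin])
  qed
  also have "card (?B \<union> ?C) = card ?B + card ?C"
    using finU fin by (intro card_Un_disjoint) auto
  finally show ?thesis using BC by simp
qed

lemma subgroup_order3:
  assumes y: "y \<in> carrier G" "y \<otimes> (y \<otimes> y) = \<one>"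
  shows "subgroup {\<one>, y, y \<otimes> y} G"
proof (rule subgroupI)
  have y3: "y \<otimes> (y \<otimes> (y \<otimes> z)) = z" if "z \<in> carrier G" for z
  proof -
    have "y \<otimes> (y \<otimes> (y \<otimes> z)) = y \<otimes> (y \<otimes> y) \<otimes> z" using y(1) that by (simp add: m_assoc)
    then show ?thesis using y that by simp
  qed
  have iy: "inv y = y \<otimes> y" "inv (y \<otimes> y) = y"
    using y by (metis inv_equality m_assoc m_closed inv_inv)+
  show "{\<one>, y, y \<otimes> y} \<subseteq> carrier G" using y by auto
  show "{\<one>, y, y \<otimes> y} \<noteq> {}" by simp
  show "inv a \<in> {\<one>, y, y \<otimes> y}" if "a \<in> {\<one>, y, y \<otimes> y}" for a
    using that iy by auto
  show "a \<otimes> b \<in> {\<one>, y, y \<otimes> y}" if "a \<in> {\<one>, y, y \<otimes> y}" "b \<in> {\<one>, y, y \<otimes> y}" for a b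
    using that y y3[of \<one>] y3[of y] by (auto simp: m_assoc)
qed

end

context sidon_block begin

lemma unique_quotient:
  assumes "a \<in> A" "b \<in> A" "c \<in> A" "d \<in> A" and eq: "a \<otimes> inv b = c \<otimes> inv d" and nK: "a \<otimes> inv b \<notin> K"
  shows "a = c"
proof -
  let ?g = "a \<otimes> inv b"
  have cc: "a \<in> carrier G" "b \<in> carrier G" "c \<in> carrier G" "d \<in> carrier G" using assms A_carrier by auto
  have g: "?g \<in> carrier G" using cc by simp
  have "?g \<otimes> b = a" "?g \<otimes> d = c" using cc unfolding eq by (auto simp: m_assoc) (metis eq m_assoc inv_closed l_inv r_one)
  then have "a \<in> A \<inter> (?g <# A)" "c \<in> A \<inter> (?g <# A)"
    using assms unfolding l_coset_image by (metis IntI imageI)+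
  then show ?thesis using card_le1D[OF _ A_sidon[OF g nK]] finite_A by blast
qed

lemma exceptional_shape:
  assumes a4: "card A = 4" and k2: "card K = 2" and y: "y \<in> A" "y \<notin> K"
  obtains c where "c \<in> carrier G" "c \<noteq> \<one>" "c \<otimes> c = \<one>" "K = {\<one>, c}" "A = {\<one>, c, y, c \<otimes> y}"
    "y \<otimes> c \<noteq> c \<otimes> y" "inv y \<noteq> y" "inv y \<noteq> c \<otimes> (y \<otimes> c)"
proof -
  have yc: "y \<in> carrier G" using y A_carrier by auto
  have oneK: "\<one> \<in> K" using subgroup.one_closed[OF K_subgroup] .
  obtain c where c: "c \<in> K" "c \<noteq> \<one>"
  proof -
    have "\<not> K \<subseteq> {\<one>}" using card_mono[of "{\<one>}" K] k2 by auto
    then show thesis using that by blast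
  qed
  have cc: "c \<in> carrier G" using c K_carrier by auto
  have K: "K = {\<one>, c}"
    using card_seteq[OF finite_K, of "{\<one>, c}"] oneK c k2 by auto
  have "c \<otimes> c \<in> K" using subgroup.m_closed[OF K_subgroup c(1) c(1)] .
  moreover have "c \<otimes> c \<noteq> c" using c cc by simp
  ultimately have c2: "c \<otimes> c = \<one>" using K by auto
  have cy: "c \<otimes> y \<in> A" using left_stable_A c y yc unfolding left_stable_def by blast
  have ic: "inv c = c" using c2 cc by (metis inv_equality)
  have cK: "c \<otimes> y \<notin> K"
  proof
    assume "c \<otimes> y \<in> K"
    then have "c \<otimes> (c \<otimes> y) \<in> K" using subgroup.m_closed[OF K_subgroup c(1)] by blast
    then show False using y c2 cc yc by (simp add: m_assoc[symmetric])
  qed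
  have "c \<otimes> y \<noteq> y" using c cc yc by simp
  then have "card {\<one>, c, y, c \<otimes> y} = 4" using c y cK K by auto
  moreover have "{\<one>, c, y, c \<otimes> y} \<subseteq> A" using one_A K_subset_A c y cy by auto
  ultimately have A: "A = {\<one>, c, y, c \<otimes> y}" using card_subset_eq[OF finite_A] a4 by metis
  have cA: "c \<in> A" using K_subset_A c by auto
  have n1: "y \<otimes> c \<noteq> c \<otimes> y"
  proof
    assume "y \<otimes> c = c \<otimes> y"
    then have "y \<otimes> inv \<one> = (c \<otimes> y) \<otimes> inv c" using cc yc c2 ic by (metis inv_one m_assoc m_closed one_closed r_one)
    then have "y = c \<otimes> y" using unique_quotient[of y \<one> "c \<otimes> y" c] y cy cA one_A yc by simp
    then show False using \<open>c \<otimes> y \<noteq> y\<close> by simp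
  qed
  have iK: "inv y \<notin> K" using y yc subgroup.m_inv_closed[OF K_subgroup, of "inv y"] by auto
  have n2: "inv y \<noteq> y"
  proof
    assume "inv y = y"
    then have "\<one> \<otimes> inv y = y \<otimes> inv \<one>" using yc by simp
    then have "\<one> = y" using unique_quotient[of \<one> y y \<one>] y one_A yc iK by simp
    then show False using y oneK by simp
  qed
  have n3: "inv y \<noteq> c \<otimes> (y \<otimes> c)"
  proof
    assume "inv y = c \<otimes> (y \<otimes> c)"
    then have e: "\<one> \<otimes> inv y = (c \<otimes> y) \<otimes> inv c" using yc cc ic by (simp add: m_assoc)
    have "\<one> = c \<otimes> y" by (rule unique_quotient[OF one_A y(1) cy cA e]) (use yc iK in simp)
    then show False using cK oneK by simp
  qed
  show thesis using that[OF cc c(2) c2 K A n1 n2 n3] .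
qed

text \<open>Three pairwise adjacent elements.\<close>

text \<open>The assumption says that \<open>u\<close>, \<open>v\<close> and \<open>u v\<close> are quotients of elements of \<open>A\<close> outside \<open>K\<close>. If \<open>A = K \<union> K x\<close>, then these
  quotients lie in \<open>D = K x K\<close> or in the inverse of \<open>D\<close>. Since \<open>D\<close> contains no product of two of its
  elements, the relation is equivalent to a trivial product of three elements of \<open>D\<close>.\<close>

lemma order_three_of_triangle:
  assumes a4: "card A = 4" and k2: "card K = 2"
    and uv: "u \<in> carrier G" "v \<in> carrier G" "u \<notin> K" "v \<notin> K" "u \<otimes> v \<notin> K"
      "A \<inter> (u <# A) \<noteq> {}" "A \<inter> (v <# A) \<noteq> {}" "A \<inter> ((u \<otimes> v) <# A) \<noteq> {}"
  obtains y where "y \<in> A" "y \<notin> K" "y \<otimes> (y \<otimes> y) = \<one>"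
proof -
  note found = that
  obtain x where x: "x \<in> A" "x \<notin> K" using K_subset_A A_neq_K by blast
  obtain c where c: "c \<in> carrier G" "c \<noteq> \<one>" "c \<otimes> c = \<one>" and K: "K = {\<one>, c}" and A: "A = {\<one>, c, x, c \<otimes> x}"
    and n: "x \<otimes> c \<noteq> c \<otimes> x" "inv x \<noteq> x" "inv x \<noteq> c \<otimes> (x \<otimes> c)"
    using exceptional_shape[OF a4 k2 x] by metis
  have xc: "x \<in> carrier G" using x A_carrier by auto
  have x1: "x \<noteq> \<one>" "x \<noteq> c" using x K by auto
  have ic: "inv c = c" using c by (metis inv_equality)
  have k1: "c \<otimes> (c \<otimes> z) = z" if "z \<in> carrier G" for z using c that by (simp add: m_assoc[symmetric])
  define D where "D = {p \<otimes> (x \<otimes> q) | p q. p \<in> {\<one>, c} \<and> q \<in> {\<one>, c}}"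
  have Kc: "p \<in> carrier G" "inv p = p" "p \<otimes> p = \<one>" if "p \<in> {\<one>, c}" for p using that c ic by auto
  have Kmul: "p \<otimes> q \<in> {\<one>, c}" if "p \<in> {\<one>, c}" "q \<in> {\<one>, c}" for p q using that c by auto
  have shape: "g \<in> D \<or> inv g \<in> D" if g: "g \<in> carrier G" "g \<notin> K" "A \<inter> (g <# A) \<noteq> {}" for g
  proof -
    obtain a b where ab: "a \<in> A" "b \<in> A" "a = g \<otimes> b" using g(3) by (auto simp: l_coset_image)
    have abc: "a \<in> carrier G" "b \<in> carrier G" using ab A_carrier by auto
    have ge: "g = a \<otimes> inv b" using ab(3) abc g(1) by (simp add: m_assoc)
    have cases: "\<exists>p\<in>{\<one>, c}. z = p \<or> z = p \<otimes> x" if "z \<in> A" for z using that A xc by auto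
    obtain p where p: "p \<in> {\<one>, c}" "a = p \<or> a = p \<otimes> x" using cases[OF ab(1)] by blast
    obtain q where q: "q \<in> {\<one>, c}" "b = q \<or> b = q \<otimes> x" using cases[OF ab(2)] by blast
    consider "a = p" "b = q" | "a = p \<otimes> x" "b = q \<otimes> x" | "a = p \<otimes> x" "b = q" | "a = p" "b = q \<otimes> x"
      using p q by blast
    then show ?thesis
    proof cases
      case 1
      then have "g = p \<otimes> q" using ge Kc[OF q(1)] by simp
      then show ?thesis using g K Kmul[OF p(1) q(1)] by simp
    next
      case 2
      then have "g = p \<otimes> q" using ge Kc[OF q(1)] Kc[OF p(1)] xc by (simp add: m_assoc inv_mult_group)
      then show ?thesis using g K Kmul[OF p(1) q(1)] by simp
    next
      case 3
      then have "g = p \<otimes> (x \<otimes> q)" using ge Kc[OF q(1)] Kc[OF p(1)] xc by (simp add: m_assoc)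
      then show ?thesis unfolding D_def using p q by blast
    next
      case 4
      then have "inv g = q \<otimes> (x \<otimes> p)" using ge Kc[OF q(1)] Kc[OF p(1)] xc by (simp add: m_assoc inv_mult_group)
      then show ?thesis unfolding D_def using p q by blast
    qed
  qed
  have sumfree: "w \<otimes> z \<notin> D" if wz: "w \<in> D" "z \<in> D" for w z
  proof
    assume "w \<otimes> z \<in> D"
    then obtain p q where pq: "p \<in> {\<one>, c}" "q \<in> {\<one>, c}" "w \<otimes> z = p \<otimes> (x \<otimes> q)" unfolding D_def by blast
    obtain r s where rs: "r \<in> {\<one>, c}" "s \<in> {\<one>, c}" "w = r \<otimes> (x \<otimes> s)" using wz unfolding D_def by blast
    obtain t l where tl: "t \<in> {\<one>, c}" "l \<in> {\<one>, c}" "z = t \<otimes> (x \<otimes> l)" using wz unfolding D_def by blast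
    note cl = Kc[OF pq(1)] Kc[OF pq(2)] Kc[OF rs(1)] Kc[OF rs(2)] Kc[OF tl(1)] Kc[OF tl(2)]
    have rr: "r \<otimes> (r \<otimes> u) = u" if "u \<in> carrier G" for u using that cl by (simp add: m_assoc[symmetric])
    have ll: "u \<otimes> (l \<otimes> l) = u" if "u \<in> carrier G" for u using that cl by simp
    have "r \<otimes> (w \<otimes> z) \<otimes> l = x \<otimes> ((s \<otimes> t) \<otimes> x)" using rs tl cl xc rr by (simp add: m_assoc)
    moreover have "r \<otimes> (w \<otimes> z) \<otimes> l = (r \<otimes> p) \<otimes> (x \<otimes> (q \<otimes> l))" unfolding pq(3) using cl xc by (simp add: m_assoc)
    ultimately have "x \<otimes> ((s \<otimes> t) \<otimes> x) = (r \<otimes> p) \<otimes> (x \<otimes> (q \<otimes> l))" by simp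
    from double_coset_sumfree[OF c(1) xc c(3) Kmul[OF rs(2) tl(1)] Kmul[OF rs(1) pq(1)] Kmul[OF pq(2) tl(2)] x1 n(2,3) this]
    show False .
  qed
  have cyc: thesis if wz: "w \<in> D" "z \<in> D" "inv (w \<otimes> z) \<in> D" for w z
  proof -
    obtain p q where pq: "p \<in> {\<one>, c}" "q \<in> {\<one>, c}" "inv (w \<otimes> z) = p \<otimes> (x \<otimes> q)" using wz(3) unfolding D_def by blast
    obtain r s where rs: "r \<in> {\<one>, c}" "s \<in> {\<one>, c}" "w = r \<otimes> (x \<otimes> s)" using wz unfolding D_def by blast
    obtain t l where tl: "t \<in> {\<one>, c}" "l \<in> {\<one>, c}" "z = t \<otimes> (x \<otimes> l)" using wz unfolding D_def by blast
    note cl = Kc[OF pq(1)] Kc[OF pq(2)] Kc[OF rs(1)] Kc[OF rs(2)] Kc[OF tl(1)] Kc[OF tl(2)]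
    have wzc: "w \<otimes> z \<in> carrier G" using rs tl cl xc by simp
    have "(w \<otimes> z) \<otimes> (p \<otimes> (x \<otimes> q)) = \<one>" using wzc unfolding pq(3)[symmetric] by simp
    then have "q \<otimes> ((w \<otimes> z) \<otimes> (p \<otimes> (x \<otimes> q))) \<otimes> q = \<one>" using cl by simp
    moreover have "u \<otimes> (q \<otimes> q) = u" if "u \<in> carrier G" for u using that cl by simp
    ultimately have "(q \<otimes> r) \<otimes> (x \<otimes> ((s \<otimes> t) \<otimes> (x \<otimes> ((l \<otimes> p) \<otimes> x)))) = \<one>"
      using rs tl cl xc by (simp add: m_assoc)
    from involution_word[OF c(1) xc c(3) Kmul[OF pq(2) rs(1)] Kmul[OF rs(2) tl(1)] Kmul[OF tl(2) pq(1)] n(1) this]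
    have "x \<otimes> (x \<otimes> x) = \<one> \<or> (c \<otimes> x) \<otimes> ((c \<otimes> x) \<otimes> (c \<otimes> x)) = \<one>" .
    moreover have "c \<otimes> x \<in> A" using A by simp
    moreover have "c \<otimes> x \<notin> K" using K x1 c xc k1[OF xc] by auto
    ultimately show thesis using found x by blast
  qed
  have Dc: "D \<subseteq> carrier G" unfolding D_def using c xc by auto
  have su: "u \<in> D \<or> inv u \<in> D" and sv: "v \<in> D \<or> inv v \<in> D" and sw: "u \<otimes> v \<in> D \<or> inv (u \<otimes> v) \<in> D"
    using shape uv by auto
  have iw: "inv (u \<otimes> v) = inv v \<otimes> inv u" using uv by (simp add: inv_mult_group)
  from su show thesis
  proof
    assume u: "u \<in> D"
    from sv show thesis
    proof
      assume v: "v \<in> D"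
      show thesis using sw sumfree[OF u v] cyc[OF u v] by blast
    next
      assume v: "inv v \<in> D"
      have "(u \<otimes> v) \<otimes> inv v = u" using uv by (simp add: m_assoc)
      moreover have "inv (u \<otimes> v) \<otimes> u = inv v" unfolding iw using uv by (simp add: m_assoc)
      ultimately show thesis using sw sumfree[of "u \<otimes> v" "inv v"] sumfree[of "inv (u \<otimes> v)" u] u v by auto
    qed
  next
    assume u: "inv u \<in> D"
    from sv show thesis
    proof
      assume v: "v \<in> D"
      have "inv u \<otimes> (u \<otimes> v) = v" using uv by simp
      moreover have "v \<otimes> inv (u \<otimes> v) = inv u" unfolding iw using uv by (simp add: m_assoc[symmetric])
      ultimately show thesis using sw sumfree[of "inv u" "u \<otimes> v"] sumfree[of v "inv (u \<otimes> v)"] u v by auto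
    next
      assume v: "inv v \<in> D"
      have "inv (inv v \<otimes> inv u) = u \<otimes> v" using uv by (simp add: inv_mult_group)
      then show thesis using sw sumfree[OF v u] cyc[OF v u] iw by auto
    qed
  qed
qed

text \<open>Regard \<open>p\<close> and \<open>q\<close> as adjacent if \<open>p q\<^sup>-\<^sup>1\<close> is a quotient of elements of \<open>A\<close> outside \<open>K\<close>. The bound on the cut leaves at
  most \<open>4 * (card X - 6)\<close> ordered pairs in different cosets of \<open>K\<close> that are not adjacent, which is too few to
  destroy all triangles.\<close>

lemma triangle_exists:
  assumes a4: "card A = 4" and k2: "card K = 2"
    and X: "X \<subseteq> carrier G" "cut A X \<le> 48" "card X = 6 \<or> card X = 8"
  obtains p q r where "p \<in> X" "q \<in> X" "r \<in> X" "p \<otimes> inv q \<notin> K" "q \<otimes> inv r \<notin> K" "p \<otimes> inv r \<notin> K"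
    "A \<inter> ((p \<otimes> inv q) <# A) \<noteq> {}" "A \<inter> ((q \<otimes> inv r) <# A) \<noteq> {}" "A \<inter> ((p \<otimes> inv r) <# A) \<noteq> {}"
proof -
  have finX: "finite X" using X finite_sub by blast
  define N where "N = {(p, q) \<in> X \<times> X. p \<otimes> inv q \<notin> K \<and> A \<inter> ((p \<otimes> inv q) <# A) = {}}"
  have finN: "finite N" unfolding N_def using finX by (auto intro: finite_subset[of _ "X \<times> X"])
  have Kn: "card {q \<in> Y. p \<otimes> inv q \<in> K} \<le> 2" if p: "p \<in> X" "Y \<subseteq> X" for p Y
  proof -
    have pc: "p \<in> carrier G" using p X by auto
    have "card {q \<in> Y. p \<otimes> inv q \<in> K} \<le> card K"
    proof (rule card_inj_on_le[OF _ _ finite_K])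
      show "inj_on (\<lambda>q. p \<otimes> inv q) {q \<in> Y. p \<otimes> inv q \<in> K}"
      proof (rule inj_onI)
        fix q r assume "q \<in> {q \<in> Y. p \<otimes> inv q \<in> K}" "r \<in> {q \<in> Y. p \<otimes> inv q \<in> K}" "p \<otimes> inv q = p \<otimes> inv r"
        moreover from this have qr: "q \<in> carrier G" "r \<in> carrier G" using p X by auto
        ultimately have "inv q = inv r" using pc by simp
        then have "inv (inv q) = inv (inv r)" by simp
        then show "q = r" using qr by simp
      qed
    qed auto
    then show ?thesis using k2 by simp
  qed
  have cN: "card N + 10 * card X \<le> (card X)\<^sup>2 + 24"
  proof -
    have "(\<Sum>h\<in>carrier G. (hits A X h)\<^sup>2) + card N \<le> (card X)\<^sup>2 + 6 * card X"
    proof -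
      have "card N = (\<Sum>p\<in>X. \<Sum>q\<in>X. of_bool ((p, q) \<in> N))"
      proof -
        have "N \<subseteq> X \<times> X" unfolding N_def by auto
        then have "card N = (\<Sum>z\<in>X \<times> X. of_bool (z \<in> N))"
          using finX by (simp add: of_bool_def sum.If_cases Int_absorb1)
        then show ?thesis by (simp add: sum.cartesian_product)
      qed
      then have "(\<Sum>h\<in>carrier G. (hits A X h)\<^sup>2) + card N =
          (\<Sum>p\<in>X. \<Sum>q\<in>X. card (A \<inter> ((p \<otimes> inv q) <# A)) + of_bool ((p, q) \<in> N))"
        unfolding sum_hits_sq[OF A_carrier X(1)] by (simp add: sum.distrib)
      also have "\<dots> \<le> (\<Sum>p\<in>X. \<Sum>q\<in>X. 1 + 3 * of_bool (p \<otimes> inv q \<in> K))"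
      proof (intro sum_mono)
        fix p q assume pq: "p \<in> X" "q \<in> X"
        then have g: "p \<otimes> inv q \<in> carrier G" using X by auto
        show "card (A \<inter> ((p \<otimes> inv q) <# A)) + of_bool ((p, q) \<in> N) \<le> 1 + 3 * of_bool (p \<otimes> inv q \<in> K)"
        proof (cases "(p, q) \<in> N")
          case True
          then have "A \<inter> ((p \<otimes> inv q) <# A) = {}" by (auto simp: N_def)
          then show ?thesis using True by simp
        next
          case False
          then show ?thesis using card_overlap[OF g] a4 by simp
        qed
      qed
      also have "\<dots> = (\<Sum>p\<in>X. card X + 3 * card {q \<in> X. p \<otimes> inv q \<in> K})"
        using finX by (simp add: sum_Suc sum_distrib_left[symmetric] of_bool_def sum.If_cases Int_def add.commute)
      also have "\<dots> \<le> (\<Sum>p\<in>X. card X + 3 * 2)" using Kn by (intro sum_mono add_mono mult_left_mono) auto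
      also have "\<dots> = (card X)\<^sup>2 + 6 * card X" by (simp add: power2_eq_square algebra_simps)
      finally show ?thesis .
    qed
    moreover have "16 * int (card X) - int (\<Sum>h\<in>carrier G. (hits A X h)\<^sup>2) \<le> 24"
      using cut_sum[OF X(1)] X(2) a4 by simp
    ultimately show ?thesis by linarith
  qed
  have cN8: "card N \<le> (card X - 6) * 4"
    using X(3)
  proof
    assume "card X = 6" then show ?thesis using cN by simp
  next
    assume "card X = 8" then show ?thesis using cN by simp
  qed
  have "\<exists>p\<in>X. card {q \<in> X. (p, q) \<in> N} \<le> (card X - 6) div 2"
  proof (rule ccontr)
    assume "\<not> ?thesis"
    then have no: "(card X - 6) div 2 < card {q \<in> X. (p, q) \<in> N}" if "p \<in> X" for p
      using that by auto
    have "N = (SIGMA p:X. {q \<in> X. (p, q) \<in> N})" unfolding N_def by blast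
    then have "card N = card (SIGMA p:X. {q \<in> X. (p, q) \<in> N})" by simp
    also have "\<dots> = (\<Sum>p\<in>X. card {q \<in> X. (p, q) \<in> N})" using finX by (intro card_SigmaI) auto
    finally have "card N = (\<Sum>p\<in>X. card {q \<in> X. (p, q) \<in> N})" .
    moreover have "(\<Sum>p\<in>X. (card X - 6) div 2 + 1) \<le> (\<Sum>p\<in>X. card {q \<in> X. (p, q) \<in> N})"
    proof (rule sum_mono)
      fix p assume "p \<in> X"
      then show "(card X - 6) div 2 + 1 \<le> card {q \<in> X. (p, q) \<in> N}" using no[of p] by simp
    qed
    moreover have "(\<Sum>p\<in>X. (card X - 6) div 2 + 1) = card X * ((card X - 6) div 2 + 1)" by simp
    ultimately show False using cN8 X(3) by auto
  qed
  then obtain p where p: "p \<in> X" "card {q \<in> X. (p, q) \<in> N} \<le> (card X - 6) div 2" by blast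
  define Y where "Y = {q \<in> X. p \<otimes> inv q \<notin> K \<and> (p, q) \<notin> N}"
  have YX: "Y \<subseteq> X" unfolding Y_def by auto
  have finY: "finite Y" using YX finX finite_subset by blast
  have "X = Y \<union> {q \<in> X. p \<otimes> inv q \<in> K} \<union> {q \<in> X. (p, q) \<in> N}" unfolding Y_def by auto
  then have "card X \<le> card Y + card {q \<in> X. p \<otimes> inv q \<in> K} + card {q \<in> X. (p, q) \<in> N}"
    using card_Un_le[of "Y \<union> {q \<in> X. p \<otimes> inv q \<in> K}" "{q \<in> X. (p, q) \<in> N}"]
      card_Un_le[of Y "{q \<in> X. p \<otimes> inv q \<in> K}"] by simp
  then have cY: "4 + (card X - 6) div 2 \<le> card Y" using Kn[OF p(1) order.refl] p(2) X(3) by auto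
  have "\<exists>q\<in>Y. \<exists>r\<in>Y. q \<otimes> inv r \<notin> K \<and> (q, r) \<notin> N"
  proof (rule ccontr)
    assume neg: "\<not> ?thesis"
    have "Y \<times> Y \<subseteq> N \<union> (SIGMA q:Y. {r \<in> Y. q \<otimes> inv r \<in> K})" using neg by auto
    then have "card (Y \<times> Y) \<le> card (N \<union> (SIGMA q:Y. {r \<in> Y. q \<otimes> inv r \<in> K}))"
      using finN finY by (intro card_mono) auto
    also have "\<dots> \<le> card N + card (SIGMA q:Y. {r \<in> Y. q \<otimes> inv r \<in> K})" by (rule card_Un_le)
    also have "card (SIGMA q:Y. {r \<in> Y. q \<otimes> inv r \<in> K}) = (\<Sum>q\<in>Y. card {r \<in> Y. q \<otimes> inv r \<in> K})"
      using finY by simp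
    also have "\<dots> \<le> (\<Sum>q\<in>Y. 2)" using Kn YX by (intro sum_mono) auto
    finally have "card Y * card Y \<le> card N + 2 * card Y" by (simp add: card_cartesian_product)
    moreover have "(2 + (2 + (card X - 6) div 2)) * card Y \<le> card Y * card Y" using cY by (intro mult_right_mono) auto
    ultimately have "(2 + (card X - 6) div 2) * card Y \<le> card N" by (simp add: algebra_simps)
    moreover have "(2 + (card X - 6) div 2) * (4 + (card X - 6) div 2) \<le> (2 + (card X - 6) div 2) * card Y"
      using cY by (intro mult_left_mono) auto
    ultimately show False using cN8 X(3) by auto
  qed
  then obtain q r where qr: "q \<in> Y" "r \<in> Y" "q \<otimes> inv r \<notin> K" "(q, r) \<notin> N" by blast
  show thesis
    using that[of p q r] p qr unfolding Y_def N_def by auto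
qed

end

context sidon_block begin

text \<open>Uncrossing with \<open>\<tau> = 4\<close> among the \<open>K\<close>-stable sets leaves only sets of six or eight elements, and these contain a
  triangle.\<close>

lemma exceptional_order_three:
  assumes a4: "card A = 4" and k2: "card K = 2"
    and gen: "\<And>H. subgroup H G \<Longrightarrow> A \<subseteq> H \<Longrightarrow> H = carrier G"
    and P: "P \<subseteq> carrier G" "left_stable K P" "4 < card P" "4 < card (carrier G - P)" "cut A P \<le> 48"
  obtains y where "y \<in> A" "y \<notin> K" "y \<otimes> (y \<otimes> y) = \<one>"
proof -
  \<comment> \<open>the lower bound for the cut is \<open>2 q (10 - q)\<close> for a set of \<open>q\<close> elements, which exceeds 48 for \<open>q = 5\<close>\<close>
  have six: "6 \<le> card X" if X: "X \<subseteq> carrier G" "4 < card X" "cut A X \<le> 48" for X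
  proof -
    have "2 * int (card X) * (10 - int (card X)) \<le> 48"
      using cut_lower[OF X(1)] X(3) a4 k2 by simp
    then have "0 \<le> (int (card X) - 4) * (int (card X) - 6)" by (simp add: algebra_simps)
    then show ?thesis using X(2) by (simp add: zero_le_mult_iff)
  qed
  show thesis
  proof (cases rule: uncrossing[OF A_carrier K_carrier P(1,2,3,4), case_names small subgroup])
    case (small X)
    have cut: "cut A X \<le> 48" using small P by simp
    have "2 dvd card X" using left_stable_dvd[OF K_subgroup small(1,2)] k2 by simp
    moreover have "6 \<le> card X" "card X \<le> 8" using six[OF small(1,3) cut] small by auto
    ultimately have "card X = 6 \<or> card X = 8" by presburger
    then obtain p q r where pqr: "p \<in> X" "q \<in> X" "r \<in> X" "p \<otimes> inv q \<notin> K" "q \<otimes> inv r \<notin> K" "p \<otimes> inv r \<notin> K"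
      "A \<inter> ((p \<otimes> inv q) <# A) \<noteq> {}" "A \<inter> ((q \<otimes> inv r) <# A) \<noteq> {}" "A \<inter> ((p \<otimes> inv r) <# A) \<noteq> {}"
      using triangle_exists[OF a4 k2 small(1) cut] by metis
    have c: "p \<in> carrier G" "q \<in> carrier G" "r \<in> carrier G" using pqr small by auto
    have e: "(p \<otimes> inv q) \<otimes> (q \<otimes> inv r) = p \<otimes> inv r" using c by (simp add: m_assoc)
    show thesis
      by (rule order_three_of_triangle[OF a4 k2, of "p \<otimes> inv q" "q \<otimes> inv r"])
        (use pqr c e that in auto)
  next
    case (subgroup H)
    have Hc: "H \<subseteq> carrier G" using subgroup subgroup.subset by blast
    have "\<not> A \<subseteq> H" using gen subgroup by blast
    then have "12 * int (card H) \<le> int (cut A H)" using cut_subgroup[OF A_carrier one_A subgroup(1)] a4 by simp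
    then show thesis using six[OF Hc subgroup(4)] subgroup(5) P by linarith
  qed
qed

text \<open>The cubic graph has the right cosets of \<open>{1, y, y\<^sup>2}\<close> as vertices and the sets \<open>{h, c h}\<close> as edges, joining the coset of
  \<open>h\<close> to that of \<open>c h\<close>. A set of at least two vertices that misses at least two vertices has more than three boundary edges. In
  the uncrossing with \<open>\<tau> = 3\<close>, a small set consists of two vertices; these are joined by at most one edge, because \<open>c\<close> does
  not normalize \<open>{1, y, y\<^sup>2}\<close>.\<close>

lemma exceptional_cubic_cut:
  assumes c: "c \<in> carrier G" "c \<noteq> \<one>" "c \<otimes> c = \<one>" and y: "y \<in> carrier G" "y \<noteq> \<one>" "y \<otimes> (y \<otimes> y) = \<one>"
    and ncomm: "y \<otimes> c \<noteq> c \<otimes> y" "inv y \<noteq> c \<otimes> (y \<otimes> c)"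
    and gen: "\<And>H. subgroup H G \<Longrightarrow> c \<in> H \<Longrightarrow> y \<in> H \<Longrightarrow> H = carrier G"
    and U: "U \<subseteq> carrier G" "left_stable {\<one>, y, y \<otimes> y} U" "3 < card U" "3 < card (carrier G - U)"
  shows "3 < card {u \<in> U. c \<otimes> u \<notin> U}"
proof (rule ccontr)
  assume neg: "\<not> ?thesis"
  let ?Y = "{\<one>, y, y \<otimes> y}"
  have Y: "subgroup ?Y G" using subgroup_order3[OF y(1,3)] .
  have Yc: "?Y \<subseteq> carrier G" using y by auto
  have cc: "c \<otimes> (c \<otimes> z) = z" if "z \<in> carrier G" for z using c that by (simp add: m_assoc[symmetric])
  have iy: "inv y = y \<otimes> y" using y by (metis inv_equality m_assoc m_closed)
  have "y \<otimes> y \<noteq> \<one>" using y by (metis r_one)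
  moreover have "y \<otimes> y \<noteq> y" using y by simp
  ultimately have cY: "card ?Y = 3" using y by auto
  have ic: "inv c = c" using c by (metis inv_equality)
  have cnY: "c \<notin> ?Y"
  proof
    assume "c \<in> ?Y"
    then have "y \<otimes> c = c \<otimes> y" using c y by (auto simp: m_assoc)
    then show False using ncomm by simp
  qed
  have conj: "c \<otimes> (t \<otimes> c) \<notin> ?Y" if t: "t \<in> ?Y" "t \<noteq> \<one>" for t
  proof
    assume m: "c \<otimes> (t \<otimes> c) \<in> ?Y"
    have tc: "t \<in> carrier G" using t Yc by auto
    have "c \<otimes> (inv t \<otimes> c) = inv (c \<otimes> (t \<otimes> c))" using c tc ic by (simp add: inv_mult_group m_assoc)
    then have m2: "c \<otimes> (inv t \<otimes> c) \<in> ?Y" using subgroup.m_inv_closed[OF Y m] by simp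
    have "inv (y \<otimes> y) = y" using iy inv_inv[OF y(1)] by simp
    then have "t = y \<or> inv t = y" using t by auto
    then have "c \<otimes> (y \<otimes> c) \<in> ?Y" using m m2 by auto
    moreover have "c \<otimes> (y \<otimes> c) \<noteq> \<one>"
    proof
      assume "c \<otimes> (y \<otimes> c) = \<one>"
      then have "c \<otimes> (c \<otimes> (y \<otimes> c)) \<otimes> c = c \<otimes> \<one> \<otimes> c" by simp
      then have "y = \<one>" using c y cc by (simp add: m_assoc)
      then show False using y by simp
    qed
    moreover have "c \<otimes> (y \<otimes> c) \<noteq> y"
    proof
      assume "c \<otimes> (y \<otimes> c) = y"
      then have "c \<otimes> (c \<otimes> (y \<otimes> c)) = c \<otimes> y" by simp
      then show False using c y cc ncomm by simp
    qed
    ultimately show False using ncomm iy by auto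
  qed
  have C: "{\<one>, c} \<subseteq> carrier G" "\<one> \<in> {\<one>, c}" using c by auto
  have cut: "cut {\<one>, c} U \<le> 12" unfolding cut_pair[OF c U(1)] using neg by simp
  show False
  proof (cases rule: uncrossing[OF C(1) Yc U, case_names small subgroup])
    case (small W)
    have finW: "finite W" using small finite_sub by blast
    let ?V = "{w \<in> W. c \<otimes> w \<in> W}"
    have "3 dvd card W" using left_stable_dvd[OF Y small(1,2)] unfolding cY .
    then have W6: "card W = 6" using small(3,4) by presburger
    have "4 * card {u \<in> W. c \<otimes> u \<notin> W} \<le> 12" using small(5) cut cut_pair[OF c small(1)] by simp
    moreover have "card W = card ?V + card {u \<in> W. c \<otimes> u \<notin> W}"
      using card_Int_Diff[OF finW, of "{w. c \<otimes> w \<in> W}"] by (simp add: Int_def set_diff_eq)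
    ultimately have V3: "3 \<le> card ?V" using W6 by simp
    have sub: "?Y #> w \<subseteq> W" if "w \<in> W" for w
      using small(2) that small(1) unfolding left_stable_def r_coset_image by blast
    have Ymem: "z \<in> ?Y #> w \<longleftrightarrow> z \<otimes> inv w \<in> ?Y" if "z \<in> carrier G" "w \<in> carrier G" for z w
      using r_coset_mem[OF Yc that(2,1)] .
    have dis: "(?Y #> v) \<inter> (?Y #> w) = {}" if vw: "v \<in> ?V" "w \<in> ?V" "v \<noteq> w" for v w
    proof (rule ccontr)
      assume ne: "(?Y #> v) \<inter> (?Y #> w) \<noteq> {}"
      have vc: "v \<in> carrier G" "w \<in> carrier G" using vw small(1) by auto
      have R: "?Y #> z \<in> rcosets ?Y" if "z \<in> carrier G" for z using rcosetsI[OF Yc that] .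
      have same: "?Y #> v = ?Y #> w"
        using rcos_disjoint[OF Y] R[OF vc(1)] R[OF vc(2)] ne unfolding pairwise_def disjnt_def by blast
      define t where "t = v \<otimes> inv w"
      have tc: "t \<in> carrier G" unfolding t_def using vc by simp
      have "v \<in> ?Y #> w" using same rcos_self[OF vc(1) Y] by simp
      then have tY: "t \<in> ?Y" using Ymem[OF vc] t_def by simp
      have vt: "v = t \<otimes> w" unfolding t_def using vc by (simp add: m_assoc)
      then have t1: "t \<noteq> \<one>" using vw vc by auto
      have 1: "(?Y #> w) \<inter> (?Y #> (c \<otimes> z)) = {}" if z: "z \<in> {v, w}" for z
      proof (rule ccontr)
        assume n: "(?Y #> w) \<inter> (?Y #> (c \<otimes> z)) \<noteq> {}"
        have zc: "z \<in> carrier G" using z vc by auto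
        have "?Y #> w = ?Y #> z" using z same by auto
        then have "?Y #> z = ?Y #> (c \<otimes> z)"
          using rcos_disjoint[OF Y] R[of z] R[of "c \<otimes> z"] n zc c unfolding pairwise_def disjnt_def by blast
        then have "c \<otimes> z \<in> ?Y #> z" using rcos_self[OF _ Y, of "c \<otimes> z"] c zc by simp
        then have "c \<otimes> z \<otimes> inv z \<in> ?Y" using Ymem[of "c \<otimes> z" z] zc c by simp
        then show False using cnY c zc by (simp add: m_assoc)
      qed
      have 2: "(?Y #> (c \<otimes> v)) \<inter> (?Y #> (c \<otimes> w)) = {}"
      proof (rule ccontr)
        assume n: "(?Y #> (c \<otimes> v)) \<inter> (?Y #> (c \<otimes> w)) \<noteq> {}"
        have "?Y #> (c \<otimes> v) = ?Y #> (c \<otimes> w)"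
          using rcos_disjoint[OF Y] R[of "c \<otimes> v"] R[of "c \<otimes> w"] n vc c unfolding pairwise_def disjnt_def by blast
        then have "c \<otimes> v \<in> ?Y #> (c \<otimes> w)" using rcos_self[OF _ Y, of "c \<otimes> v"] c vc by simp
        then have "c \<otimes> v \<otimes> inv (c \<otimes> w) \<in> ?Y" using Ymem[of "c \<otimes> v" "c \<otimes> w"] vc c by simp
        moreover have "c \<otimes> v \<otimes> inv (c \<otimes> w) = c \<otimes> (t \<otimes> c)"
          using vc c tc ic by (simp add: vt inv_mult_group m_assoc)
        ultimately show False using conj[OF tY t1] by simp
      qed
      have "(?Y #> w) \<union> (?Y #> (c \<otimes> v)) \<union> (?Y #> (c \<otimes> w)) \<subseteq> W"
        using sub vw by blast
      then have "card ((?Y #> w) \<union> (?Y #> (c \<otimes> v)) \<union> (?Y #> (c \<otimes> w))) \<le> 6"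
        using card_mono[OF finW] W6 by metis
      moreover have fc: "finite (?Y #> z)" "card (?Y #> z) = 3" if "z \<in> carrier G" for z
        using card_r_coset[OF Yc that] cY unfolding r_coset_image by simp_all
      moreover have "card ((?Y #> w) \<union> (?Y #> (c \<otimes> v)) \<union> (?Y #> (c \<otimes> w)))
          = card (?Y #> w) + card (?Y #> (c \<otimes> v)) + card (?Y #> (c \<otimes> w))"
      proof -
        have f: "finite (?Y #> w)" "finite (?Y #> (c \<otimes> v))" "finite (?Y #> (c \<otimes> w))" using fc(1) vc c by auto
        have "((?Y #> w) \<union> (?Y #> (c \<otimes> v))) \<inter> (?Y #> (c \<otimes> w)) = {}" using 1[of w] 2 by blast
        then show ?thesis using card_Un_disjoint[OF _ f(3)] card_Un_disjoint[OF f(1,2) 1[of v]] f by simp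
      qed
      ultimately show False using vc c by simp
    qed
    have "card (\<Union>v\<in>?V. ?Y #> v) = (\<Sum>v\<in>?V. card (?Y #> v))"
      using finW dis by (intro card_UN_disjoint) (auto simp: r_coset_image)
    also have "\<dots> = (\<Sum>v\<in>?V. 3)"
      using card_r_coset[OF Yc] cY small(1) by (intro sum.cong) auto
    finally have "card (\<Union>v\<in>?V. ?Y #> v) = 3 * card ?V" by simp
    moreover have "card (\<Union>v\<in>?V. ?Y #> v) \<le> card W" using sub finW by (intro card_mono) blast+
    ultimately show False using V3 W6 by simp
  next
    case (subgroup H)
    have "\<not> {\<one>, c} \<subseteq> H" using gen[OF subgroup(1)] subgroup by auto
    moreover have "card {\<one>, c} = 2" using c by auto
    ultimately have "4 * int (card H) \<le> int (cut {\<one>, c} H)"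
      using cut_subgroup[OF C subgroup(1)] by simp
    then show False using subgroup(4,5) cut by linarith
  qed
qed

text \<open>Let \<open>P = A S\<close>. Then \<open>S\<close> consists of all \<open>p \<in> P\<close> with \<open>y p \<in> P\<close>, and the set \<open>E\<close> of the other elements of \<open>P\<close> has exactly three
  elements, one for each right coset of \<open>{1, y, y\<^sup>2}\<close> that meets \<open>P\<close> without being contained in it. The subset \<open>E2\<close>
  corresponds to the cosets that meet \<open>P\<close> in two elements. If \<open>E2\<close> has at most one element, then \<open>{1, y, y\<^sup>2}\<close> is
  the required subgroup. Otherwise the union \<open>U\<close> of the cosets that meet \<open>P\<close> in at least two elements
  has at most three boundary edges in the cubic graph, contrary to the preceding lemma.\<close>

theorem exceptional_case:
  assumes a4: "card A = 4" and k2: "card K = 2"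
    and gen: "\<And>H. subgroup H G \<Longrightarrow> A \<subseteq> H \<Longrightarrow> H = carrier G"
    and S: "S \<subseteq> carrier G" "2 \<le> card S" "card (A <#> S) = card S + 3"
    and big: "card (A <#> S) + 7 \<le> card (carrier G)"
  shows "\<exists>H. compressing H S"
proof -
  define P where "P = A <#> S"
  have cardP: "card P = card S + 3" "card P + 7 \<le> card (carrier G)" unfolding P_def using S big by auto
  have Pc: "P \<subseteq> carrier G" unfolding P_def using setmult_subset_G[OF A_carrier S(1)] .
  have finP: "finite P" and finS: "finite S" using Pc S finite_sub by auto
  have co: "7 \<le> card (carrier G - P)"
    using card_Diff_subset[OF finP Pc] cardP by simp
  have liP: "left_stable K P" unfolding P_def using left_stable_product[OF S(1)] .
  have "int (cut A P) \<le> 48" using cut_upper[OF Pc liP S(1)] a4 k2 cardP unfolding P_def by simp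
  then have cutP: "cut A P \<le> 48" by simp
  have P4: "4 < card P" "4 < card (carrier G - P)" using S cardP co by auto
  obtain y where y: "y \<in> A" "y \<notin> K" "y \<otimes> (y \<otimes> y) = \<one>"
    using exceptional_order_three[OF a4 k2 gen Pc liP P4 cutP] by metis
  obtain c where c: "c \<in> carrier G" "c \<noteq> \<one>" "c \<otimes> c = \<one>" and K: "K = {\<one>, c}" and A: "A = {\<one>, c, y, c \<otimes> y}"
    and n: "y \<otimes> c \<noteq> c \<otimes> y" "inv y \<noteq> y" "inv y \<noteq> c \<otimes> (y \<otimes> c)"
    using exceptional_shape[OF a4 k2 y(1,2)] by metis
  have yc: "y \<in> carrier G" using y A_carrier by auto
  have y1: "y \<noteq> \<one>" using y K by auto
  let ?Y = "{\<one>, y, y \<otimes> y}"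
  have Y: "subgroup ?Y G" using subgroup_order3[OF yc y(3)] .
  have y3: "y \<otimes> (y \<otimes> (y \<otimes> z)) = z" if "z \<in> carrier G" for z
  proof -
    have "y \<otimes> (y \<otimes> (y \<otimes> z)) = y \<otimes> (y \<otimes> y) \<otimes> z" using yc that by (simp add: m_assoc)
    then show ?thesis using y that by simp
  qed
  have cc: "c \<otimes> (c \<otimes> z) = z" if "z \<in> carrier G" for z using c that by (simp add: m_assoc[symmetric])
  have cP: "c \<otimes> p \<in> P \<longleftrightarrow> p \<in> P" if "p \<in> carrier G" for p
    using liP that K unfolding left_stable_def by auto
  have cu: "p \<in> carrier G" if "p \<in> P" for p using that Pc by auto
  define E where "E = {p \<in> P. y \<otimes> p \<notin> P}"
  define E2 where "E2 = {e \<in> E. y \<otimes> (y \<otimes> e) \<in> P}"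
  have finE: "finite E" "finite E2" unfolding E_def E2_def using finP by auto
  have SPE: "S \<subseteq> P - E"
  proof
    fix s assume s: "s \<in> S"
    have "\<one> \<otimes> s \<in> P" "y \<otimes> s \<in> P" using s one_A y(1) unfolding P_def set_mult_def by blast+
    then show "s \<in> P - E" using s S(1) by (auto simp: E_def)
  qed
  have cPE: "card (P - E) + card E = card P"
  proof -
    have "E \<subseteq> P" unfolding E_def by auto
    then show ?thesis using card_Diff_subset[OF finE(1)] card_mono[OF finP] by simp
  qed
  have E3: "card E = 3"
  proof -
    have "card E \<le> 3" using card_mono[OF _ SPE] finP cPE cardP(1) by simp
    moreover have "\<not> card E \<le> 2"
    proof
      assume E2: "card E \<le> 2"
      have "A <#> (P - E) \<subseteq> P"
      proof
        fix z assume "z \<in> A <#> (P - E)"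
        then obtain a p where ap: "a \<in> A" "p \<in> P" "p \<notin> E" "z = a \<otimes> p" unfolding set_mult_iff by blast
        have pc: "p \<in> carrier G" using cu[OF ap(2)] .
        have yp: "y \<otimes> p \<in> P" using ap by (simp add: E_def)
        have cp: "c \<otimes> p \<in> P" "c \<otimes> y \<otimes> p \<in> P" "\<one> \<otimes> p \<in> P"
          using cP[OF pc] cP[of "y \<otimes> p"] yp ap(2) yc pc c(1) by (simp_all add: m_assoc)
        have "a = \<one> \<or> a = c \<or> a = y \<or> a = c \<otimes> y" using ap(1) A by blast
        then show "z \<in> P" unfolding ap(4) using cp yp by blast
      qed
      then have "int (cut A P) \<le> 16 * (int (card P) - int (card (P - E)))"
        using cut_upper[OF Pc liP _, of "P - E"] Pc a4 k2 by auto
      also have "int (card P) = int (card (P - E)) + int (card E)" using cPE by simp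
      also have "16 * (int (card (P - E)) + int (card E) - int (card (P - E))) \<le> 32" using E2 by simp
      finally have "cut A P \<le> 32" by simp
      moreover have "3 \<le> card P" "3 \<le> card (carrier G - P)" using P4 by linarith+
      ultimately show False using cut_exceptional[OF a4 k2 Pc] gen by metis
    qed
    ultimately show ?thesis by simp
  qed
  have SE: "S = P - E"
    using card_seteq[OF _ SPE] finP cPE cardP(1) E3 by simp
  have yS: "(?Y <#> S) \<subseteq> S \<union> E2 \<union> (\<lambda>e. y \<otimes> e) ` E2"
  proof
    fix z assume "z \<in> ?Y <#> S"
    then obtain t s where ts: "t \<in> ?Y" "s \<in> S" "z = t \<otimes> s" unfolding set_mult_iff by blast
    have sc: "s \<in> carrier G" using ts S(1) by auto
    have sP: "s \<in> P" "y \<otimes> s \<in> P" using ts(2) unfolding SE by (auto simp: E_def)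
    have ysE2: "y \<otimes> s \<in> E2" if "y \<otimes> (y \<otimes> s) \<notin> P"
      using that sP y3[OF sc] unfolding E2_def E_def by simp
    show "z \<in> S \<union> E2 \<union> (\<lambda>e. y \<otimes> e) ` E2"
    proof (cases "y \<otimes> (y \<otimes> s) \<in> P")
      case True
      then have "y \<otimes> s \<in> S" "y \<otimes> (y \<otimes> s) \<in> S" unfolding SE using sP y3[OF sc] by (auto simp: E_def)
      then show ?thesis using ts sc yc by (auto simp: m_assoc)
    next
      case False
      then show ?thesis using ysE2 ts sc yc by (auto simp: m_assoc)
    qed
  qed
  have cY: "card ?Y = 3"
  proof -
    have "y \<otimes> y \<noteq> \<one>" using n yc by (metis inv_equality)
    moreover have "y \<otimes> y \<noteq> y" using yc y1 by simp
    ultimately show ?thesis using y1 by auto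
  qed
  have bigG: "9 \<le> card (carrier G)" using cardP by linarith
  show ?thesis
  proof (cases "card E2 \<le> 1")
    case True
    have "card (?Y <#> S) \<le> card (S \<union> E2 \<union> (\<lambda>e. y \<otimes> e) ` E2)"
      using yS finS finE by (intro card_mono) auto
    also have "\<dots> \<le> card (S \<union> E2) + card ((\<lambda>e. y \<otimes> e) ` E2)" by (rule card_Un_le)
    also have "\<dots> \<le> (card S + card E2) + card E2" using card_Un_le card_image_le[OF finE(2)] by (intro add_mono)
    finally have "card (?Y <#> S) < card ?Y + card S" using True cY by simp
    moreover have "?Y \<noteq> {\<one>}" using y1 by auto
    moreover have "?Y \<noteq> carrier G" using cY bigG by force
    ultimately have "compressing ?Y S" unfolding compressing_def using Y by blast
    then show ?thesis by blast
  next
    case False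
    define two where "two g \<longleftrightarrow> (g \<in> P \<and> y \<otimes> g \<in> P) \<or> (g \<in> P \<and> y \<otimes> (y \<otimes> g) \<in> P) \<or> (y \<otimes> g \<in> P \<and> y \<otimes> (y \<otimes> g) \<in> P)" for g
    define U where "U = {g \<in> carrier G. two g}"
    have Uc: "U \<subseteq> carrier G" unfolding U_def by auto
    have finU: "finite U" using Uc finite_sub by blast
    have twoy: "two (y \<otimes> g) \<longleftrightarrow> two g" if "g \<in> carrier G" for g
      unfolding two_def using y3[OF that] by auto
    have liU: "left_stable ?Y U"
      unfolding left_stable_def
    proof (intro ballI)
      fix t g assume t: "t \<in> ?Y" and g: "g \<in> carrier G"
      have "two (t \<otimes> g) \<longleftrightarrow> two g" using t twoy[OF g] twoy[of "y \<otimes> g"] g yc by (auto simp: m_assoc)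
      then show "t \<otimes> g \<in> U \<longleftrightarrow> g \<in> U" unfolding U_def using t g yc by auto
    qed
    have few: "card {u \<in> U. c \<otimes> u \<notin> U} \<le> 3"
    proof -
      let ?B = "{u \<in> U. c \<otimes> u \<notin> U}"
      let ?f = "\<lambda>u. if u \<in> P then c \<otimes> u else y \<otimes> (y \<otimes> u)"
      \<comment> \<open>a boundary edge of \<open>U\<close> leads to a coset with one element in \<open>P\<close>, or starts at the missing element of a coset with two\<close>
      have in1: "c \<otimes> u \<in> E - E2" if u: "u \<in> ?B" "u \<in> P" for u
      proof -
        have uc: "u \<in> carrier G" using u Uc by auto
        have "c \<otimes> u \<in> P" using cP uc u by simp
        moreover have "\<not> two (c \<otimes> u)" using u uc c unfolding U_def by simp
        ultimately show ?thesis unfolding two_def E_def E2_def by auto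
      qed
      have in2: "y \<otimes> (y \<otimes> u) \<in> E2" if u: "u \<in> U" "u \<notin> P" for u
      proof -
        have uc: "u \<in> carrier G" using u Uc by auto
        have "y \<otimes> u \<in> P" "y \<otimes> (y \<otimes> u) \<in> P" using u unfolding U_def two_def by auto
        then show ?thesis unfolding E_def E2_def using u y3[of u] y3[of "y \<otimes> u"] uc yc by simp
      qed
      have "inj_on ?f ?B"
      proof (rule inj_onI)
        fix u v assume uv: "u \<in> ?B" "v \<in> ?B" "?f u = ?f v"
        have uc: "u \<in> carrier G" "v \<in> carrier G" using uv Uc by auto
        have fu: "?f u \<in> E2 \<longleftrightarrow> u \<notin> P" using in1[OF uv(1)] in2[of u] uv(1) by auto
        have fv: "?f v \<in> E2 \<longleftrightarrow> v \<notin> P" using in1[OF uv(2)] in2[of v] uv(2) by auto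
        have iff: "u \<in> P \<longleftrightarrow> v \<in> P" using fu fv uv(3) by argo
        show "u = v"
        proof (cases "u \<in> P")
          case True
          then have "c \<otimes> u = c \<otimes> v" using iff uv(3) by simp
          then show ?thesis using c uc by simp
        next
          case False
          then have "y \<otimes> (y \<otimes> u) = y \<otimes> (y \<otimes> v)" using iff uv(3) by simp
          then show ?thesis using yc uc by simp
        qed
      qed
      moreover have "?f ` ?B \<subseteq> E" using in1 in2 unfolding E2_def by auto
      ultimately show ?thesis using card_inj_on_le[OF _ _ finE(1)] E3 by metis
    qed
    have UP: "card (U - P) \<le> 3"
    proof -
      have "inj_on (\<lambda>u. y \<otimes> (y \<otimes> u)) (U - P)"
        using Uc yc by (intro inj_onI) (auto simp: subset_iff)
      moreover have "(\<lambda>u. y \<otimes> (y \<otimes> u)) ` (U - P) \<subseteq> E"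
      proof
        fix z assume "z \<in> (\<lambda>u. y \<otimes> (y \<otimes> u)) ` (U - P)"
        then obtain u where u: "u \<in> U" "u \<notin> P" "z = y \<otimes> (y \<otimes> u)" by blast
        have uc: "u \<in> carrier G" using u Uc by auto
        show "z \<in> E" using u y3[OF uc] unfolding U_def two_def E_def by auto
      qed
      ultimately show ?thesis using card_inj_on_le[OF _ _ finE(1)] E3 by metis
    qed
    have "carrier G - P \<subseteq> (carrier G - U) \<union> (U - P)" by blast
    then have "card (carrier G - P) \<le> card ((carrier G - U) \<union> (U - P))"
      using fin finU by (intro card_mono) auto
    then have coU: "3 < card (carrier G - U)"
      using card_Un_le[of "carrier G - U" "U - P"] UP co by linarith
    have U3: "3 < card U"
    proof -
      obtain e f where ef: "e \<in> E2" "f \<in> E2" "e \<noteq> f"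
        using card_le1I[of E2] False by blast
      have ec: "e \<in> carrier G" "f \<in> carrier G" using ef cu unfolding E2_def E_def by auto
      have eP: "e \<in> P" "y \<otimes> e \<notin> P" "y \<otimes> (y \<otimes> e) \<in> P" using ef unfolding E2_def E_def by auto
      have fP: "f \<in> P" "y \<otimes> f \<notin> P" using ef unfolding E2_def E_def by auto
      have "f \<noteq> y \<otimes> e" using fP eP by auto
      moreover have "f \<noteq> y \<otimes> (y \<otimes> e)" using fP eP y3[OF ec(1)] by auto
      moreover have "y \<otimes> e \<noteq> e" "y \<otimes> e \<noteq> y \<otimes> (y \<otimes> e)" using eP by auto
      moreover have "e \<noteq> y \<otimes> (y \<otimes> e)" using eP y3[OF ec(1)] by metis
      ultimately have "card {e, y \<otimes> e, y \<otimes> (y \<otimes> e), f} = 4" using ef by auto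
      moreover have "{e, y \<otimes> e, y \<otimes> (y \<otimes> e), f} \<subseteq> U"
      proof -
        have "two e" "two f" using ef unfolding two_def E2_def E_def by auto
        then show ?thesis unfolding U_def using twoy[OF ec(1)] twoy[of "y \<otimes> e"] ec yc by auto
      qed
      ultimately show ?thesis using card_mono[OF finU, of "{e, y \<otimes> e, y \<otimes> (y \<otimes> e), f}"] by linarith
    qed
    have gen': "H = carrier G" if "subgroup H G" "c \<in> H" "y \<in> H" for H
      using gen[OF that(1)] that subgroup.one_closed[OF that(1)] subgroup.m_closed[OF that(1)] unfolding A by auto
    show ?thesis
      using exceptional_cubic_cut[OF c yc y1 y(3) n(1,3) gen' Uc liU U3 coU] few by simp
  qed
qed

section \<open>The structure theorem\<close>

text \<open>If \<open>A\<close> generates the group, the density assumption is used twice: to see that \<open>A S\<close> omits more than \<open>card A\<close> elements, since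
  \<open>(card A)\<^sup>2 \<le> 2 * card G\<close>, and in the exceptional case, where \<open>card G \<ge> 10\<close>, to see that it omits at least seven elements.\<close>

theorem atom_structure:
  assumes S: "S \<subseteq> carrier G" "2 \<le> card S" "card (A <#> S) < card A + card S"
    and dense: "real (card S) \<le> real (card (carrier G)) - 4 * sqrt (real (card (carrier G)))"
  shows "\<exists>H. compressing H S"
proof (cases "\<exists>H. subgroup H G \<and> A \<subseteq> H \<and> H \<noteq> carrier G")
  case True
  then show ?thesis using compressing_of_proper S by blast
next
  case False
  then have gen: "H = carrier G" if "subgroup H G" "A \<subseteq> H" for H using that by blast
  let ?N = "card (carrier G)"
  have root: "real x \<le> sqrt (real ?N)" if "x * x \<le> ?N" for x
  proof -
    have "(real x)\<^sup>2 \<le> real ?N" using that by (simp add: power2_eq_square flip: of_nat_mult)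
    then show ?thesis by (rule real_le_rsqrt)
  qed
  have lo: "int (card K) + int (card A) * (int (card A) - int (card K)) \<le> int ?N" using card_carrier_lower .
  have "card A * card A \<le> 2 * ?N"
  proof -
    have "int (card A) * int (card A) \<le> int (card A) * (2 * (int (card A) - int (card K)))"
      using card_K_le by (intro mult_left_mono) auto
    moreover have "int (card A) * (2 * (int (card A) - int (card K))) = 2 * (int (card A) * (int (card A) - int (card K)))"
      by simp
    ultimately have "int (card A) * int (card A) \<le> 2 * int ?N" using lo by linarith
    then show ?thesis by (metis of_nat_le_iff of_nat_mult of_nat_numeral)
  qed
  then have "(real (card A))\<^sup>2 \<le> 4 * real ?N"
    by (simp add: power2_eq_square flip: of_nat_mult)
  then have "real (card A) \<le> sqrt (4 * real ?N)" by (rule real_le_rsqrt)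
  then have "real (card A) \<le> 2 * sqrt (real ?N)" by (simp add: real_sqrt_mult)
  then have "real (card S) + 2 * real (card A) \<le> real ?N" using dense by linarith
  then have f: "card A + card (A <#> S) < ?N" using S(3) by linarith
  have sp: "card A = 4 \<and> card K = 2 \<and> card (A <#> S) = card S + 3"
    by (rule small_product[OF gen S f])
  then have "10 \<le> ?N" using lo by simp
  then have "real 3 \<le> sqrt (real ?N)" by (intro root) simp
  then have "card S + 12 \<le> ?N" using dense by linarith
  then show ?thesis using exceptional_case[OF _ _ gen S(1,2)] sp by simp
qed

end

context fin_group begin

theorem product_structure:
  assumes S: "S \<subseteq> carrier G" and T: "T \<subseteq> carrier G" "2 \<le> card T"
    "card (T <#> S) + 2 \<le> card (carrier G)" "card (T <#> S) < card T + card S"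
    and dense: "real (card S) \<le> real (card (carrier G)) - 4 * sqrt (real (card (carrier G)))"
  shows "\<exists>R. (R = S \<or> R = set_inv S) \<and> (geometric_progression G R \<or> (\<exists>H. compressing H R))"
proof -
  obtain R A where R: "R = S \<or> R = set_inv S" and A: "A \<subseteq> carrier G" "\<one> \<in> A" "2 \<le> card A"
    "card (A <#> R) + 2 \<le> card (carrier G)" "card (A <#> R) < card A + card R"
    and sid: "\<And>g. g \<in> carrier G \<Longrightarrow> g <# A = A \<or> card (A \<inter> (g <# A)) \<le> 1"
    using isoperimetric_atom[OF S T] by metis
  have Rc: "R \<subseteq> carrier G" using R S set_inv_closed by auto
  have cR: "card R = card S" using R card_set_inv[OF S] by auto
  have finR: "finite R" and finA: "finite A" using Rc A finite_sub by auto
  have "geometric_progression G R \<or> (\<exists>H. compressing H R)"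
  proof -
    consider "card R = 0" | "card R = 1" | "2 \<le> card R" "card A = 2" | "2 \<le> card R" "3 \<le> card A"
      using A(3) by linarith
    then show ?thesis
    proof cases
      case 1
      then have "R = {}" using finR by simp
      then have "geometric_progression G R"
        unfolding geometric_progression_def by (intro bexI[of _ \<one>]) (auto simp: l_coset_def)
      then show ?thesis ..
    next
      case 2
      then obtain r where r: "R = {r}" by (rule card_1_singletonE)
      have rc: "r \<in> carrier G" using r Rc by auto
      have "inv r <# R = {\<one> [^] i | i::nat. i < card R}"
        unfolding 2 using rc r by (auto simp: l_coset_def)
      then have "geometric_progression G R"
        unfolding geometric_progression_def using rc by blast
      then show ?thesis ..
    next
      case 3
      have "\<exists>a. a \<noteq> \<one> \<and> A = {\<one>, a}"
      proof -
        have "card (A - {\<one>}) = 1" using 3 A finA by simp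
        then obtain a where "A - {\<one>} = {a}" by (rule card_1_singletonE)
        then show ?thesis using A(2) by (intro exI[of _ a]) blast
      qed
      then obtain a where a: "a \<noteq> \<one>" "A = {\<one>, a}" by blast
      have ac: "a \<in> carrier G" using a A by auto
      have "card ({\<one>, a} <#> R) \<le> card R + 1" "card ({\<one>, a} <#> R) < card (carrier G)"
        using A(4,5) 3 a by auto
      moreover have "R \<noteq> {}" using 3 by auto
      ultimately show ?thesis using two_element_case[OF ac a(1) Rc] by blast
    next
      case 4
      define K where "K = {g \<in> carrier G. g <# A = A}"
      have K: "subgroup K G" unfolding K_def using subgroup_left_stabilizer[OF A(1)] .
      show ?thesis
      proof (cases "A = K")
        case True
        have "A \<noteq> {\<one>}" using A(3) by (intro notI) simp
        moreover have "A \<noteq> carrier G"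
        proof
          assume "A = carrier G"
          then have "card (carrier G) \<le> card (A <#> R)"
            using card_le_set_mult[of R A] 4 A(1) Rc by simp
          then show False using A(4) by simp
        qed
        ultimately have "compressing A R" unfolding compressing_def using K True A(5) by simp
        then show ?thesis by blast
      next
        case False
        interpret sidon_block G A K
        proof (intro sidon_block.intro sidon_block_axioms.intro)
          show "fin_group G" by (rule fin_group_axioms)
        qed (use A K False 4 sid in \<open>auto simp: K_def\<close>)
        show ?thesis using atom_structure[OF Rc 4(1) A(5)] dense cR by simp
      qed
    qed
  qed
  then show ?thesis using R by blast
qed

lemma geometric_progression_inv:
  assumes S: "S \<subseteq> carrier G" and gp: "geometric_progression G (set_inv S)"
  shows "geometric_progression G S"
proof -
  obtain g a where g: "g \<in> carrier G" and a: "a \<in> carrier G"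
    and e: "g <# set_inv S = {a [^] i | i::nat. i < card S} \<or> set_inv S #> g = {a [^] i | i::nat. i < card S}"
    using gp card_set_inv[OF S] unfolding geometric_progression_def by auto
  have iS: "set_inv S \<subseteq> carrier G" "set_inv (set_inv S) = S" using S set_inv_closed set_inv_set_inv by auto
  have l: "set_inv (g <# set_inv S) = S #> inv g"
    using set_inv_set_mult[of "{g}" "set_inv S"] g iS
    by (simp add: l_coset_eq_set_mult r_coset_eq_set_mult SET_INV_def[of _ "{g}"])
  have r: "set_inv (set_inv S #> g) = inv g <# S"
    using set_inv_set_mult[of "set_inv S" "{g}"] g iS
    by (simp add: l_coset_eq_set_mult r_coset_eq_set_mult SET_INV_def[of _ "{g}"])
  have p: "set_inv {a [^] i | i::nat. i < card S} = {inv a [^] i | i::nat. i < card S}"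
    unfolding set_inv_image using nat_pow_inv[OF a] by (auto simp: image_iff)
  have "S #> inv g = {inv a [^] i | i::nat. i < card S} \<or> inv g <# S = {inv a [^] i | i::nat. i < card S}"
    using e l r unfolding p[symmetric] by presburger
  then show ?thesis
    unfolding geometric_progression_def using g a by blast
qed

end

theorem corollary2:
  fixes G :: "('a, 'b) monoid_scheme" (structure) and S :: "'a set"
  assumes "group G" and "finite (carrier G)"
    and "S \<subseteq> carrier G"
    and "\<exists>T. T \<subseteq> carrier G \<and> 2 \<le> card T \<and>
           int (card (T <#> S)) \<le> min (int (order G) - 2) (int (card T) + int (card S) - 1)"
    and "real (card S) \<le> real (order G) - 4 * sqrt (real (order G))"
  shows "geometric_progression G S \<or>
         (\<exists>H. \<exists>\<epsilon> \<in> {1, -1}. subgroup H G \<and> H \<noteq> {\<one>} \<and> H \<noteq> carrier G \<and>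
            int (card (H <#> set_power G S \<epsilon>)) \<le> int (card H) + int (card S) - 1)"
proof -
  interpret group G by fact
  interpret fin_group G by unfold_locales fact
  obtain T where T: "T \<subseteq> carrier G" "2 \<le> card T"
    "int (card (T <#> S)) \<le> int (order G) - 2" "int (card (T <#> S)) \<le> int (card T) + int (card S) - 1"
    using assms(4) by auto
  have "card (T <#> S) + 2 \<le> card (carrier G)" "card (T <#> S) < card T + card S"
    using T(3,4) unfolding order_def by linarith+
  then obtain R where R: "R = S \<or> R = set_inv S"
    "geometric_progression G R \<or> (\<exists>H. compressing H R)"
    using product_structure[OF assms(3) T(1,2)] assms(5) unfolding order_def by blast
  show ?thesis
  proof (cases "geometric_progression G R")
    case True
    then show ?thesis using R(1) geometric_progression_inv[OF assms(3)] by blast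
  next
    case False
    then obtain H where H: "compressing H R" using R(2) by blast
    have "\<exists>\<epsilon> \<in> {1, -1}. R = set_power G S \<epsilon>"
      using R(1) set_power_1[OF assms(3)] set_power_minus_1[OF assms(3)] by auto
    then obtain \<epsilon> where \<epsilon>: "\<epsilon> \<in> {1, -1}" "R = set_power G S \<epsilon>" by blast
    have "card R = card S" using R(1) card_set_inv[OF assms(3)] by auto
    then have "subgroup H G" "H \<noteq> {\<one>}" "H \<noteq> carrier G"
      "int (card (H <#> set_power G S \<epsilon>)) \<le> int (card H) + int (card S) - 1"
      using H unfolding compressing_def \<epsilon>(2) by auto
    then show ?thesis using \<epsilon>(1) by blast
  qed
qed

end
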